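(* Let $\Sigma$ be a Riemann surface, let $\varphi:\Sigma\to S^6\subset\mathbb{R}^7$ be a conformal harmonic immersion and let $F:\Sigma\to\mathbb{R}^7$ be such that $dF=\varphi\times *d\varphi$. Then $F$ has parallel mean curvature vector field and is not pseudo-umbilical if, and only if, $\varphi$ is superconformal in some $3$-dimensional sphere $S^3=S^6\cap W$, where $W$ is a coassociative $4$-space.
   Context: $\times$ is the $7$-dimensional cross product on $\mathbb{R}^7$: the bilinear antisymmetric product with $\mathbf{e}_i\times\mathbf{e}_j=\mathbf{e}_k$ for $(i,j,k)$ equal to, or a cyclic permutation of, one of $(1,2,3),(1,4,5),(1,7,6),(2,4,6),(2,5,7),(3,4,7),(3,6,5)$. $S^6$ is the unit sphere of $\mathbb{R}^7$. A $3$-dimensional subspace $V\subset\mathbb{R}^7$ is an associative $3$-plane if it is closed under $\times$; a $4$-dimensional subspace $W$ is coassociative if $W^\perp$ is an associative $3$-plane. With a local conformal coordinate $z=x+iy$, $dF=\varphi\times *d\varphi$ means $F_x=\varphi\times\varphi_y$, $F_y=-\varphi\times\varphi_x$ ($F$ exists if $\Sigma$ is simply connected, and is unique up to an additive constant; it is a conformal immersion). $\mathbf{I}_F$, $\mathbf{I\!I}_F$ are the first and second fundamental forms, $\mathbf{h}_F=\frac12\mathrm{tr}\,\mathbf{I}_F^{-1}\mathbf{I\!I}_F$ is the mean curvature vector; it is parallel if its covariant derivative in the normal bundle $TF^\perp$ vanishes. $F$ is pseudo-umbilical if $\mathbf{I\!I}_F\cdot\mathbf{h}_F=\lambda\,\mathbf{I}_F$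 for some smooth function $\lambda$ on $\Sigma$. Harmonic sequence: a harmonic map $\varphi:\Sigma\to S^n\subset\mathbb{R}^{n+1}$ is identified with the line subbundle $\varphi_0=\varphi$ it spans in $\Sigma\times\mathbb{C}^{n+1}$ (a harmonic map into $\mathbb{C}P^n$). For $j\ge0$, $\varphi_{j+1}$ is the image bundle (extended across isolated singularities) of $A'_{\varphi_j}(v)=P^{\perp_h}_{\varphi_j}(\partial v/\partial z)$, where $v$ is a section of $\varphi_j$ and $P^{\perp_h}_{\varphi_j}$ is the Hermitian projection onto the orthogonal bundle of $\varphi_j$; $\varphi_{-j}=\overline{\varphi_j}$. The isotropy order of $\varphi$ is $r>0$ if $\varphi\perp_h\varphi_i$ for $0<i\le r$ but $\varphi\not\perp_h\varphi_{r+1}$, where $\perp_h$ is orthogonality for the standard Hermitian product. A harmonic map into a sphere $S^m=S^6\cap W$ ($\dim W=m+1$) is superconformal in $S^m$ if its isotropy order is $r=m$. *)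

theory Defs
  imports "HOL-Analysis.Analysis"
begin

unbundle no fps_syntax

section \<open>The cross product on \<open>\<real>\<^sup>7\<close>\<close>

definition cross7_triples :: "(7 \<times> 7 \<times> 7) list" where
  "cross7_triples = [(1,2,3), (1,4,5), (1,7,6), (2,4,6), (2,5,7), (3,4,7), (3,6,5)]"

definition cross7 :: "real ^ 7 \<Rightarrow> real ^ 7 \<Rightarrow> real ^ 7"  (infixr \<open>\<times>\<^sub>7\<close> 80) where
  "v \<times>\<^sub>7 w = (\<Sum>(i, j, k) \<leftarrow> cross7_triples.
       (v $ i * w $ j - v $ j * w $ i) *\<^sub>R axis k 1
     + (v $ j * w $ k - v $ k * w $ j) *\<^sub>R axis i 1
     + (v $ k * w $ i - v $ i * w $ k) *\<^sub>R axis j 1)"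

lemma bilinear_cross7: "bilinear cross7"
proof -
  have add: "(\<Sum>x\<leftarrow>xs. f x + g x) = sum_list (map f xs) + sum_list (map g xs)"
    and scale: "(\<Sum>x\<leftarrow>xs. c *\<^sub>R f x) = c *\<^sub>R sum_list (map f xs)"
    for f g :: "7 \<times> 7 \<times> 7 \<Rightarrow> real ^ 7" and c xs
    by (induction xs) (simp_all add: algebra_simps)
  show ?thesis
    unfolding bilinear_def linear_iff cross7_def add[symmetric] scale[symmetric]
    by (auto simp: algebra_simps intro!: arg_cong[of _ _ sum_list] map_cong)
qed

lemma cross7_antisym: "w \<times>\<^sub>7 v = - (v \<times>\<^sub>7 w)"
  unfolding cross7_def uminus_sum_list_map
  by (auto simp: algebra_simps intro!: arg_cong[of _ _ sum_list] map_cong)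

lemma cross7_axis:
  "\<forall>(i, j, k) \<in> set cross7_triples.
     axis i 1 \<times>\<^sub>7 axis j 1 = axis k 1 \<and>
     axis j 1 \<times>\<^sub>7 axis k 1 = axis i 1 \<and>
     axis k 1 \<times>\<^sub>7 axis i 1 = axis j 1"
proof -
  have nth: "axis i (1::real) $ j = (if j = i then 1 else 0)" for i j :: 7
    by (simp add: axis_def)
  show ?thesis
    by (simp add: cross7_def cross7_triples_def nth)
qed

definition associative_plane :: "(real ^ 7) set \<Rightarrow> bool" where
  "associative_plane V \<longleftrightarrow> subspace V \<and> dim V = 3 \<and> (\<forall>u\<in>V. \<forall>v\<in>V. u \<times>\<^sub>7 v \<in> V)"

definition coassociative :: "(real ^ 7) set \<Rightarrow> bool" where
  "coassociative W \<longleftrightarrow> subspace W \<and> dim W = 4 \<and> associative_plane (W\<^sup>\<bottom>)"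


section \<open>Smooth functions and Riemann surfaces\<close>

text \<open>For open \<open>S\<close>, the class \<open>C\<^sup>n\<close>; derivatives at the points of \<open>S\<close> do not depend on the
  values outside \<open>S\<close>.\<close>

primrec n_times_differentiable_on ::
    "nat \<Rightarrow> 'a::real_normed_vector set \<Rightarrow> ('a \<Rightarrow> 'b::real_normed_vector) \<Rightarrow> bool" where
  "n_times_differentiable_on 0 S f \<longleftrightarrow> continuous_on S f"
| "n_times_differentiable_on (Suc n) S f \<longleftrightarrow>
     (\<forall>x\<in>S. f differentiable (at x)) \<and>
     (\<forall>v. n_times_differentiable_on n S (\<lambda>x. frechet_derivative f (at x) v))"

definition smooth_on ::
    "'a::real_normed_vector set \<Rightarrow> ('a \<Rightarrow> 'b::real_normed_vector) \<Rightarrow> bool" where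
  "smooth_on S f \<longleftrightarrow> (\<forall>n. n_times_differentiable_on n S f)"

type_synonym 'a chart = "'a set \<times> ('a \<Rightarrow> complex)"

text \<open>Second countability is not required: it is automatic for connected Riemann surfaces
  (Rado).\<close>

locale riemann_surface =
  fixes X :: "'a topology" and A :: "'a chart set"
  assumes Hausdorff: "Hausdorff_space X"
    and connected: "connected_space X"
    and nonempty: "topspace X \<noteq> {}"
    and chart_open: "(U, z) \<in> A \<Longrightarrow> openin X U"
    and chart_image_open: "(U, z) \<in> A \<Longrightarrow> open (z ` U)"
    and chart_homeo: "(U, z) \<in> A \<Longrightarrow> homeomorphic_map (subtopology X U) (top_of_set (z ` U)) z"
    and covers: "(\<Union>(U, z)\<in>A. U) = topspace X"
    and holomorphic_transitions:
      "(U, z) \<in> A \<Longrightarrow> (V, w) \<in> A \<Longrightarrow> (w \<circ> inv_into U z) holomorphic_on z ` (U \<inter> V)"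

definition local_rep :: "'a chart \<Rightarrow> ('a \<Rightarrow> 'b) \<Rightarrow> complex \<Rightarrow> 'b" where
  "local_rep c f = f \<circ> inv_into (fst c) (snd c)"

definition smooth_map_on :: "'a chart set \<Rightarrow> 'a set \<Rightarrow> ('a \<Rightarrow> 'b::real_normed_vector) \<Rightarrow> bool" where
  "smooth_map_on A V f \<longleftrightarrow> (\<forall>c\<in>A. smooth_on (snd c ` (fst c \<inter> V)) (local_rep c f))"

definition coord_diff ::
    "'a chart \<Rightarrow> ('a \<Rightarrow> 'b::real_normed_vector) \<Rightarrow> 'a \<Rightarrow> complex \<Rightarrow> 'b" where
  "coord_diff c f p = frechet_derivative (local_rep c f) (at (snd c p))"

text \<open>For a chart \<open>z = x + iy\<close>, \<open>pd c 1 f\<close> and \<open>pd c 2 f\<close> are the partial derivatives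
  \<open>f\<^sub>x\<close> and \<open>f\<^sub>y\<close>, again as functions on the surface.\<close>

definition pd :: "'a chart \<Rightarrow> 2 \<Rightarrow> ('a \<Rightarrow> 'b::real_normed_vector) \<Rightarrow> 'a \<Rightarrow> 'b" where
  "pd c i f p = coord_diff c f p (if i = 1 then 1 else \<i>)"


section \<open>Conformal harmonic immersions into spheres\<close>

definition immersion :: "'a topology \<Rightarrow> 'a chart set \<Rightarrow> ('a \<Rightarrow> real ^ 'n) \<Rightarrow> bool" where
  "immersion X A f \<longleftrightarrow> smooth_map_on A (topspace X) f \<and>
     (\<forall>c\<in>A. \<forall>p\<in>fst c. inj (coord_diff c f p))"

definition conformal :: "'a chart set \<Rightarrow> ('a \<Rightarrow> real ^ 'n) \<Rightarrow> bool" where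
  "conformal A f \<longleftrightarrow> (\<forall>c\<in>A. \<forall>p\<in>fst c.
     norm (pd c 1 f p) = norm (pd c 2 f p) \<and> pd c 1 f p \<bullet> pd c 2 f p = 0)"

text \<open>Up to a positive conformal factor, the tension field of a map into the unit sphere is
  the component of \<open>f\<^sub>x\<^sub>x + f\<^sub>y\<^sub>y\<close> tangent to the sphere. The formula does not
  change if the sphere is replaced by a great subsphere containing the image.\<close>

definition harmonic_into_sphere :: "'a topology \<Rightarrow> 'a chart set \<Rightarrow> ('a \<Rightarrow> real ^ 'n) \<Rightarrow> bool" where
  "harmonic_into_sphere X A f \<longleftrightarrow>
     smooth_map_on A (topspace X) f \<and> f ` topspace X \<subseteq> sphere 0 1 \<and>
     (\<forall>c\<in>A. \<forall>p\<in>fst c.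
        let \<Delta> = pd c 1 (pd c 1 f) p + pd c 2 (pd c 2 f) p in \<Delta> - (\<Delta> \<bullet> f p) *\<^sub>R f p = 0)"

text \<open>\<open>dF = \<phi> \<times> *d\<phi>\<close>\<close>

definition cross_star_primitive ::
    "'a topology \<Rightarrow> 'a chart set \<Rightarrow> ('a \<Rightarrow> real ^ 7) \<Rightarrow> ('a \<Rightarrow> real ^ 7) \<Rightarrow> bool" where
  "cross_star_primitive X A \<phi> F \<longleftrightarrow> smooth_map_on A (topspace X) F \<and>
     (\<forall>c\<in>A. \<forall>p\<in>fst c.
        pd c 1 F p = \<phi> p \<times>\<^sub>7 pd c 2 \<phi> p \<and>
        pd c 2 F p = - (\<phi> p \<times>\<^sub>7 pd c 1 \<phi> p))"


section \<open>Extrinsic geometry of immersed surfaces\<close>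

text \<open>All quantities are expressed in a chart \<open>c\<close>, the fundamental forms by their matrices in the
  coordinate frame. The conditions imposed are invariant under holomorphic changes of chart.\<close>

definition tangent_plane :: "'a chart \<Rightarrow> ('a \<Rightarrow> real ^ 'n) \<Rightarrow> 'a \<Rightarrow> (real ^ 'n) set" where
  "tangent_plane c F p = range (coord_diff c F p)"

definition normal_part :: "(real ^ 'n) set \<Rightarrow> real ^ 'n \<Rightarrow> real ^ 'n" where
  "normal_part T v = (THE n. n \<in> T\<^sup>\<bottom> \<and> v - n \<in> T)"

definition first_form :: "'a chart \<Rightarrow> ('a \<Rightarrow> real ^ 'n) \<Rightarrow> 'a \<Rightarrow> real ^ 2 ^ 2" where
  "first_form c F p = (\<chi> i j. pd c i F p \<bullet> pd c j F p)"

definition second_form :: "'a chart \<Rightarrow> ('a \<Rightarrow> real ^ 'n) \<Rightarrow> 'a \<Rightarrow> (real ^ 'n) ^ 2 ^ 2" where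
  "second_form c F p = (\<chi> i j. normal_part (tangent_plane c F p) (pd c i (pd c j F) p))"

definition mean_curvature :: "'a chart \<Rightarrow> ('a \<Rightarrow> real ^ 'n) \<Rightarrow> 'a \<Rightarrow> real ^ 'n" where
  "mean_curvature c F p =
     (1/2) *\<^sub>R (\<Sum>i\<in>UNIV. \<Sum>j\<in>UNIV. matrix_inv (first_form c F p) $ i $ j *\<^sub>R second_form c F p $ j $ i)"

definition parallel_mean_curvature :: "'a chart set \<Rightarrow> ('a \<Rightarrow> real ^ 'n) \<Rightarrow> bool" where
  "parallel_mean_curvature A F \<longleftrightarrow> (\<forall>c\<in>A. \<forall>p\<in>fst c. \<forall>i.
     normal_part (tangent_plane c F p) (pd c i (mean_curvature c F) p) = 0)"

definition pseudo_umbilical :: "'a topology \<Rightarrow> 'a chart set \<Rightarrow> ('a \<Rightarrow> real ^ 'n) \<Rightarrow> bool" where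
  "pseudo_umbilical X A F \<longleftrightarrow> (\<exists>l::'a \<Rightarrow> real. smooth_map_on A (topspace X) l \<and>
     (\<forall>c\<in>A. \<forall>p\<in>fst c. \<forall>i j.
        second_form c F p $ i $ j \<bullet> mean_curvature c F p = l p * first_form c F p $ i $ j))"


section \<open>Harmonic sequences\<close>

definition herm :: "complex ^ 'n \<Rightarrow> complex ^ 'n \<Rightarrow> complex" where
  "herm u v = (\<Sum>i\<in>UNIV. u $ i * cnj (v $ i))"

definition herm_perp :: "(complex ^ 'n) set \<Rightarrow> complex ^ 'n \<Rightarrow> complex ^ 'n" where
  "herm_perp L v = (THE n. (\<forall>u\<in>L. herm n u = 0) \<and> v - n \<in> L)"

definition pd_z :: "'a chart \<Rightarrow> ('a \<Rightarrow> complex ^ 'n) \<Rightarrow> 'a \<Rightarrow> complex ^ 'n" where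
  "pd_z c v p = (1/2) *s (pd c 1 v p - \<i> *s pd c 2 v p)"

text \<open>A family \<open>L\<close> of subspaces \<open>L p\<close> is a smooth complex subbundle of rank \<open>k\<close> of the trivial
  bundle if it is locally spanned by \<open>k\<close> smooth, pointwise independent sections.\<close>

definition subbundle ::
    "'a topology \<Rightarrow> 'a chart set \<Rightarrow> nat \<Rightarrow> ('a \<Rightarrow> (complex ^ 'n) set) \<Rightarrow> bool" where
  "subbundle X A k L \<longleftrightarrow> (\<forall>p\<in>topspace X. \<exists>V s. openin X V \<and> p \<in> V \<and>
     (\<forall>i<k. smooth_map_on A V (s i)) \<and>
     (\<forall>q\<in>V. L q = vec.span ((\<lambda>i. s i q) ` {..<k}) \<and> vec.dim (L q) = k))"

definition local_section ::
    "'a topology \<Rightarrow> 'a chart set \<Rightarrow> ('a \<Rightarrow> (complex ^ 'n) set) \<Rightarrow> 'a \<Rightarrow> ('a \<Rightarrow> complex ^ 'n) \<Rightarrow> bool" where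
  "local_section X A L p v \<longleftrightarrow>
     (\<exists>V. openin X V \<and> p \<in> V \<and> smooth_map_on A V v \<and> (\<forall>q\<in>V. v q \<in> L q))"

text \<open>The image of the fibre \<open>L p\<close> under \<open>A'\<^sub>L\<close>; it does not depend on the chart, since changing
  the coordinate multiplies \<open>\<partial>/\<partial>z\<close> by a nonzero factor.\<close>

definition A'_image ::
    "'a topology \<Rightarrow> 'a chart set \<Rightarrow> 'a chart \<Rightarrow> ('a \<Rightarrow> (complex ^ 'n) set) \<Rightarrow> 'a \<Rightarrow> (complex ^ 'n) set" where
  "A'_image X A c L p = {herm_perp (L p) (pd_z c v p) | v. local_section X A L p v}"

text \<open>\<open>L'\<close> is the image bundle of \<open>A'\<^sub>L\<close> extended across isolated singularities: a subbundle whose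
  fibre is the image of \<open>A'\<^sub>L\<close> away from a set without accumulation points. Such an extension is
  unique by continuity; it is the zero bundle if \<open>A'\<^sub>L\<close> vanishes identically.\<close>

definition image_bundle ::
    "'a topology \<Rightarrow> 'a chart set \<Rightarrow> ('a \<Rightarrow> (complex ^ 'n) set) \<Rightarrow> ('a \<Rightarrow> (complex ^ 'n) set) \<Rightarrow> bool" where
  "image_bundle X A L L' \<longleftrightarrow> (\<exists>k. subbundle X A k L') \<and>
     X derived_set_of {p \<in> topspace X. \<exists>c\<in>A. p \<in> fst c \<and> A'_image X A c L p \<noteq> L' p} = {}"

definition spanned_line :: "('a \<Rightarrow> real ^ 'n) \<Rightarrow> 'a \<Rightarrow> (complex ^ 'n) set" where
  "spanned_line \<phi> p = vec.span {\<chi> i. complex_of_real (\<phi> p $ i)}"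

text \<open>The terms of nonnegative index, which are the only ones entering the isotropy order. Each
  term is determined on \<open>topspace X\<close> by the preceding one.\<close>

definition harmonic_sequence ::
    "'a topology \<Rightarrow> 'a chart set \<Rightarrow> ('a \<Rightarrow> real ^ 'n) \<Rightarrow> (nat \<Rightarrow> 'a \<Rightarrow> (complex ^ 'n) set) \<Rightarrow> bool" where
  "harmonic_sequence X A \<phi> \<Phi> \<longleftrightarrow>
     \<Phi> 0 = spanned_line \<phi> \<and> (\<forall>j. image_bundle X A (\<Phi> j) (\<Phi> (Suc j)))"

definition bundle_orthogonal ::
    "'a topology \<Rightarrow> ('a \<Rightarrow> (complex ^ 'n) set) \<Rightarrow> ('a \<Rightarrow> (complex ^ 'n) set) \<Rightarrow> bool" where
  "bundle_orthogonal X L L' \<longleftrightarrow> (\<forall>p\<in>topspace X. \<forall>u\<in>L p. \<forall>v\<in>L' p. herm u v = 0)"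

definition isotropy_order :: "'a topology \<Rightarrow> 'a chart set \<Rightarrow> ('a \<Rightarrow> real ^ 'n) \<Rightarrow> nat \<Rightarrow> bool" where
  "isotropy_order X A \<phi> r \<longleftrightarrow> r > 0 \<and> (\<exists>\<Phi>. harmonic_sequence X A \<phi> \<Phi> \<and>
     (\<forall>i. 0 < i \<and> i \<le> r \<longrightarrow> bundle_orthogonal X (\<Phi> 0) (\<Phi> i)) \<and>
     \<not> bundle_orthogonal X (\<Phi> 0) (\<Phi> (r + 1)))"

text \<open>Superconformality in the great sphere \<open>S\<^sup>m = sphere 0 1 \<inter> W\<close>, where \<open>dim W = m + 1\<close>.\<close>

definition superconformal_in ::
    "'a topology \<Rightarrow> 'a chart set \<Rightarrow> ('a \<Rightarrow> real ^ 'n) \<Rightarrow> (real ^ 'n) set \<Rightarrow> bool" where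
  "superconformal_in X A \<phi> W \<longleftrightarrow> subspace W \<and> harmonic_into_sphere X A \<phi> \<and>
     \<phi> ` topspace X \<subseteq> sphere 0 1 \<inter> W \<and>
     (\<exists>m. dim W = m + 1 \<and> isotropy_order X A \<phi> m)"

end

theory Submission
  imports Defs "HOL-Complex_Analysis.Conformal_Mappings"
begin

text \<open>
  In a conformal coordinate \<open>z = x + \<i> y\<close> let \<open>p\<close> be the coordinate expression of \<open>\<phi>\<close>, let indices denote
  partial derivatives, and put \<open>E = p\<^sub>x \<bullet> p\<^sub>x\<close>. Then \<open>F\<^sub>x = p \<times>\<^sub>7 p\<^sub>y\<close>, \<open>F\<^sub>y = - (p \<times>\<^sub>7 p\<^sub>x)\<close>, and the mean curvature vector
  of \<open>F\<close> is the unit vector \<open>h = (p\<^sub>x \<times>\<^sub>7 p\<^sub>y) / E\<close>. The trace-free part of the second fundamental form of \<open>F\<close> in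
  the direction \<open>h\<close> is given by two functions \<open>\<alpha>\<close> and \<open>\<beta>\<close>, and \<open>F\<close> is pseudo-umbilical if and only if they
  vanish identically (\<open>pseudo_umbilical_iff\<close>).

  Suppose that \<open>h\<close> is parallel. Then \<open>h\<^sub>x\<close> and \<open>h\<^sub>y\<close> are explicit combinations of \<open>F\<^sub>x\<close> and \<open>F\<^sub>y\<close>, and the symmetry of
  the second derivatives of \<open>h\<close> says two things. Its tangential part (\<open>codazzi\<close>) says that \<open>\<alpha> - \<i> \<beta>\<close> is
  holomorphic; as \<open>F\<close> is not pseudo-umbilical, \<open>\<alpha>\<close> and \<open>\<beta>\<close> have only isolated common zeros
  (\<open>umbilics_isolated\<close>). Its normal part (\<open>ricci\<close>) says that \<open>\<alpha> p\<^sub>x\<^sub>x + \<beta> p\<^sub>x\<^sub>y\<close> is a combination of \<open>p\<close>, \<open>p\<^sub>x\<close>, \<open>p\<^sub>y\<close>.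
  Its component along \<open>h\<close>, and its components along \<open>F\<^sub>x\<close> and \<open>F\<^sub>y\<close> combined with the derivative of
  \<open>p \<bullet> h = 0\<close>, show that, where \<open>\<alpha>\<close> and \<open>\<beta>\<close> do not both vanish and
  hence everywhere, \<open>p \<bullet> h = 0\<close> and the second derivatives of \<open>p\<close> lie in the span \<open>W\<close> of \<open>p\<close>, \<open>p\<^sub>x\<close>, \<open>p\<^sub>y\<close> and
  \<open>N = p \<times>\<^sub>7 h\<close> (\<open>coassociative_surface_if_parallel\<close>). By octonionic algebra \<open>W\<close> is coassociative. The
  derivative of \<open>N\<close> also lies in \<open>W\<close>, so \<open>W\<close> is constant and contains the image of \<open>\<phi>\<close>
  (\<open>contained_in_coassociative\<close>). In the 3-sphere of \<open>W\<close> the harmonic sequence of \<open>\<phi>\<close> is spanned by \<open>\<phi>\<close>, \<open>\<phi>\<^sub>z\<close>,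
  \<open>N\<close>, the conjugate of \<open>\<phi>\<^sub>z\<close>, and again \<open>\<phi>\<close>; the steps to \<open>N\<close> and from it degenerate exactly at the isolated
  common zeros of \<open>\<alpha>\<close> and \<open>\<beta>\<close>. So the isotropy order is 3 (\<open>isotropy_order_3\<close>).

  Conversely, let \<open>\<phi>\<close> take values in a coassociative \<open>W\<close>. Products of two vectors of \<open>W\<close> lie in \<open>W\<^sup>\<bottom>\<close>
  (\<open>coassociative_cross\<close>), so \<open>F\<^sub>x\<close>, \<open>F\<^sub>y\<close> and \<open>h\<close> span the 3-dimensional \<open>W\<^sup>\<bottom>\<close>, and the unit field \<open>h\<close> is parallel
  (\<open>coassociative_surface_if_contained\<close>). If \<open>\<alpha>\<close> and \<open>\<beta>\<close> vanished identically, \<open>\<phi>\<^sub>z\<^sub>z\<close> would be a multiple of \<open>\<phi>\<^sub>z\<close>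
  and the harmonic sequence would break off, contrary to isotropy order 3 (\<open>not_all_umbilic\<close>).
\<close>

section \<open>Directional derivatives and smooth functions\<close>

definition dird :: "'a::real_normed_vector \<Rightarrow> ('a \<Rightarrow> 'b::real_normed_vector) \<Rightarrow> 'a \<Rightarrow> 'b" where
  "dird v f = (\<lambda>w. frechet_derivative f (at w) v)"

lemma dird_cong:
  assumes "open S" "x \<in> S" "\<And>y. y \<in> S \<Longrightarrow> f y = g y"
  shows "dird v f x = dird v g x"
proof -
  have "(f has_derivative f') (at x) \<longleftrightarrow> (g has_derivative f') (at x)" for f'
    using has_derivative_transform_within_open[OF _ assms(1,2)] assms(3) by metis
  then show ?thesis
    by (simp add: dird_def frechet_derivative_def)
qed

lemma differentiable_cong_open:
  assumes "open S" "x \<in> S" "\<And>y. y \<in> S \<Longrightarrow> f y = g y" "f differentiable (at x)"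
  shows "g differentiable (at x)"
  using assms has_derivative_transform_within_open[OF _ assms(1,2)]
  unfolding differentiable_def by metis

lemma dird_has_derivative:
  "f differentiable (at x) \<Longrightarrow> (f has_derivative (\<lambda>v. dird v f x)) (at x)"
  unfolding dird_def using frechet_derivative_works by force

lemma dird_eqI: "(f has_derivative f') (at x) \<Longrightarrow> dird v f x = f' v"
  unfolding dird_def using frechet_derivative_at by metis

lemma dird_const [simp]: "dird v (\<lambda>x. c) = (\<lambda>x. 0)"
  by (rule ext) (rule dird_eqI[OF has_derivative_const])

lemma dird_linear:
  assumes "f differentiable (at x)"
  shows "linear (\<lambda>v. dird v f x)"
  using dird_has_derivative[OF assms] has_derivative_linear by blast

lemma dird_complex:
  assumes "f differentiable (at x)"
  shows "dird v f x = Re v *\<^sub>R dird 1 f x + Im v *\<^sub>R dird \<i> f x"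
proof -
  interpret linear "\<lambda>v. dird v f x" by (rule dird_linear[OF assms])
  have "v = Re v *\<^sub>R 1 + Im v *\<^sub>R \<i>" by (simp add: complex_eq_iff)
  then show ?thesis by (metis add scale)
qed

lemma differentiable_bilinear:
  assumes "bounded_bilinear B" "f differentiable (at x)" "g differentiable (at x)"
  shows "(\<lambda>x. B (f x) (g x)) differentiable (at x)"
  using bounded_bilinear.FDERIV[OF assms(1)] assms(2,3) unfolding differentiable_def by blast

lemma dird_bilinear:
  assumes "bounded_bilinear B" "f differentiable (at x)" "g differentiable (at x)"
  shows "dird v (\<lambda>x. B (f x) (g x)) x = B (dird v f x) (g x) + B (f x) (dird v g x)"
  using dird_eqI[OF bounded_bilinear.FDERIV[OF assms(1) dird_has_derivative[OF assms(2)]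
      dird_has_derivative[OF assms(3)]]] by simp

lemma dird_add:
  assumes "f differentiable (at x)" "g differentiable (at x)"
  shows "dird v (\<lambda>x. f x + g x) x = dird v f x + dird v g x"
  by (rule dird_eqI) (intro has_derivative_add dird_has_derivative assms)

lemma differentiable_bounded_linear:
  assumes "bounded_linear L" "f differentiable (at x)"
  shows "(\<lambda>x. L (f x)) differentiable (at x)"
  using bounded_linear.has_derivative[OF assms(1)] assms(2) unfolding differentiable_def by blast

lemma dird_bounded_linear:
  assumes "bounded_linear L" "f differentiable (at x)"
  shows "dird v (\<lambda>x. L (f x)) x = L (dird v f x)"
  by (rule dird_eqI) (rule bounded_linear.has_derivative[OF assms(1) dird_has_derivative[OF assms(2)]])

lemma dird_inverse:
  fixes f :: "'a::real_normed_vector \<Rightarrow> 'b::real_normed_field"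
  assumes "f differentiable (at x)" "f x \<noteq> 0"
  shows "dird v (\<lambda>x. inverse (f x)) x = - (inverse (f x) * dird v f x * inverse (f x))"
  by (rule dird_eqI) (rule Deriv.has_derivative_inverse[OF assms(2) dird_has_derivative[OF assms(1)]])

lemma n_times_Suc:
  "n_times_differentiable_on (Suc n) S f \<longleftrightarrow>
     (\<forall>x\<in>S. f differentiable (at x)) \<and> (\<forall>v. n_times_differentiable_on n S (dird v f))"
  by (simp add: dird_def)

declare n_times_differentiable_on.simps(2) [simp del]

lemma n_times_cong:
  assumes "open S" "\<And>x. x \<in> S \<Longrightarrow> f x = g x" "n_times_differentiable_on n S f"
  shows "n_times_differentiable_on n S g"
  using assms
proof (induction n arbitrary: f g)
  case 0
  then show ?case using continuous_on_cong by force
next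
  case (Suc n)
  have "n_times_differentiable_on n S (dird v g)" for v
    by (rule Suc.IH[OF Suc.prems(1), of "dird v f"])
      (use Suc.prems(3) dird_cong[OF Suc.prems(1), of _ f g] Suc.prems(2) in \<open>auto simp: n_times_Suc\<close>)
  then show ?case
    using differentiable_cong_open[OF Suc.prems(1), of _ f g] Suc.prems(2,3)
    unfolding n_times_Suc by blast
qed

lemma n_times_SucD: "n_times_differentiable_on (Suc n) S f \<Longrightarrow> n_times_differentiable_on n S f"
proof (induction n arbitrary: f)
  case 0
  then show ?case
    by (auto simp: n_times_Suc intro!: continuous_at_imp_continuous_on differentiable_imp_continuous_within)
next
  case (Suc n)
  then show ?case unfolding n_times_Suc[of "Suc n"] n_times_Suc[of n] by blast
qed

lemma n_times_subset:
  "n_times_differentiable_on n S f \<Longrightarrow> T \<subseteq> S \<Longrightarrow> n_times_differentiable_on n T f"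
  by (induction n arbitrary: f) (auto simp: n_times_Suc intro: continuous_on_subset)

lemma n_times_const: "n_times_differentiable_on n S (\<lambda>x. c)"
  by (induction n arbitrary: c) (auto simp: n_times_Suc)

text \<open>The closure properties are inductions on the order of differentiability: the rule for the derivative
  of a sum, product or inverse leads back to functions that the induction hypothesis covers.\<close>

lemma n_times_add:
  assumes "open S" "n_times_differentiable_on n S f" "n_times_differentiable_on n S g"
  shows "n_times_differentiable_on n S (\<lambda>x. f x + g x)"
  using assms(2,3)
proof (induction n arbitrary: f g)
  case 0
  then show ?case by (auto intro: continuous_on_add)
next
  case (Suc n)
  have "n_times_differentiable_on n S (dird v (\<lambda>x. f x + g x))" for v
    by (rule n_times_cong[OF assms(1) _ Suc.IH[of "dird v f" "dird v g"]])
      (use Suc.prems in \<open>auto simp: n_times_Suc dird_add\<close>)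
  then show ?case
    using Suc.prems by (auto simp: n_times_Suc)
qed

lemma n_times_bounded_linear:
  assumes "open S" "bounded_linear L" "n_times_differentiable_on n S f"
  shows "n_times_differentiable_on n S (\<lambda>x. L (f x))"
  using assms(3)
proof (induction n arbitrary: f)
  case 0
  then show ?case by (auto intro: bounded_linear.continuous_on[OF assms(2)])
next
  case (Suc n)
  have "n_times_differentiable_on n S (dird v (\<lambda>x. L (f x)))" for v
    by (rule n_times_cong[OF assms(1) _ Suc.IH[of "dird v f"]])
      (use Suc.prems in \<open>auto simp: n_times_Suc dird_bounded_linear[OF assms(2)]\<close>)
  then show ?case
    using Suc.prems differentiable_bounded_linear[OF assms(2)] by (auto simp: n_times_Suc)
qed

lemma n_times_bilinear:
  assumes "open S" "bounded_bilinear B" "n_times_differentiable_on n S f" "n_times_differentiable_on n S g"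
  shows "n_times_differentiable_on n S (\<lambda>x. B (f x) (g x))"
  using assms(3,4)
proof (induction n arbitrary: f g)
  case 0
  then show ?case by (auto intro: bounded_bilinear.continuous_on[OF assms(2)])
next
  case (Suc n)
  have "n_times_differentiable_on n S (dird v (\<lambda>x. B (f x) (g x)))" for v
    by (rule n_times_cong[OF assms(1) _ n_times_add[OF assms(1) Suc.IH[of "dird v f" g] Suc.IH[of f "dird v g"]]])
      (use Suc.prems n_times_SucD[OF Suc.prems(1)] n_times_SucD[OF Suc.prems(2)] in
        \<open>auto simp: n_times_Suc dird_bilinear[OF assms(2)]\<close>)
  then show ?case
    using Suc.prems differentiable_bilinear[OF assms(2), of f _ g] by (simp add: n_times_Suc)
qed

lemma n_times_inverse:
  fixes f :: "'a::real_normed_vector \<Rightarrow> 'b::real_normed_field"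
  assumes "open S" "\<And>x. x \<in> S \<Longrightarrow> f x \<noteq> 0" "n_times_differentiable_on n S f"
  shows "n_times_differentiable_on n S (\<lambda>x. inverse (f x))"
  using assms(3)
proof (induction n)
  case 0
  then show ?case using assms(2) by (auto intro: continuous_on_inverse)
next
  case (Suc n)
  have inv: "n_times_differentiable_on n S (\<lambda>x. inverse (f x))"
    using Suc.IH n_times_SucD[OF Suc.prems] by blast
  have D: "n_times_differentiable_on n S (dird v f)" for v
    using Suc.prems by (simp add: n_times_Suc)
  have "n_times_differentiable_on n S (\<lambda>x. (- 1) * (inverse (f x) * dird v f x * inverse (f x)))" for v
    by (intro n_times_bilinear[OF assms(1) bounded_bilinear_mult] inv D n_times_const)
  then have "n_times_differentiable_on n S (dird v (\<lambda>x. inverse (f x)))" for v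
    by (rule n_times_cong[OF assms(1), rotated]) (use Suc.prems assms(2) in \<open>auto simp: n_times_Suc dird_inverse\<close>)
  then show ?case
    using Suc.prems assms(2)
    by (auto simp: n_times_Suc intro: differentiable_inverse)
qed

lemma smooth_on_cong:
  "open S \<Longrightarrow> (\<And>x. x \<in> S \<Longrightarrow> f x = g x) \<Longrightarrow> smooth_on S f \<Longrightarrow> smooth_on S g"
  unfolding smooth_on_def using n_times_cong by blast

lemma smooth_on_subset: "smooth_on S f \<Longrightarrow> T \<subseteq> S \<Longrightarrow> smooth_on T f"
  unfolding smooth_on_def using n_times_subset by blast

lemma smooth_on_const [intro]: "smooth_on S (\<lambda>x. c)"
  unfolding smooth_on_def using n_times_const by blast

lemma smooth_on_add:
  "open S \<Longrightarrow> smooth_on S f \<Longrightarrow> smooth_on S g \<Longrightarrow> smooth_on S (\<lambda>x. f x + g x)"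
  unfolding smooth_on_def using n_times_add by blast

lemma smooth_on_linear:
  "bounded_linear L \<Longrightarrow> open S \<Longrightarrow> smooth_on S f \<Longrightarrow> smooth_on S (\<lambda>x. L (f x))"
  unfolding smooth_on_def using n_times_bounded_linear by blast

lemma smooth_on_bilinear:
  "bounded_bilinear B \<Longrightarrow> open S \<Longrightarrow> smooth_on S f \<Longrightarrow> smooth_on S g \<Longrightarrow> smooth_on S (\<lambda>x. B (f x) (g x))"
  unfolding smooth_on_def using n_times_bilinear by blast

lemma smooth_on_inverse:
  fixes f :: "'a::real_normed_vector \<Rightarrow> 'b::real_normed_field"
  shows "open S \<Longrightarrow> (\<And>x. x \<in> S \<Longrightarrow> f x \<noteq> 0) \<Longrightarrow> smooth_on S f \<Longrightarrow> smooth_on S (\<lambda>x. inverse (f x))"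
  unfolding smooth_on_def using n_times_inverse by blast

lemma smooth_on_minus: "open S \<Longrightarrow> smooth_on S f \<Longrightarrow> smooth_on S (\<lambda>x. - f x)"
  by (rule smooth_on_linear[OF bounded_linear_minus[OF bounded_linear_ident]])

lemma smooth_on_diff:
  "open S \<Longrightarrow> smooth_on S f \<Longrightarrow> smooth_on S g \<Longrightarrow> smooth_on S (\<lambda>x. f x - g x)"
  using smooth_on_add[of S f "\<lambda>x. - g x"] smooth_on_minus by force

lemma smooth_on_dird: "smooth_on S f \<Longrightarrow> smooth_on S (dird v f)"
  unfolding smooth_on_def by (metis n_times_Suc)

lemma smooth_on_differentiable: "smooth_on S f \<Longrightarrow> x \<in> S \<Longrightarrow> f differentiable (at x)"
  unfolding smooth_on_def by (metis n_times_Suc)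

lemma smooth_on_continuous: "smooth_on S f \<Longrightarrow> continuous_on S f"
  unfolding smooth_on_def by (metis n_times_differentiable_on.simps(1))

lemma differentiable_along_line:
  fixes g :: "'a::real_normed_vector \<Rightarrow> real"
  assumes "g differentiable (at (w + t *\<^sub>R u))"
  shows "((\<lambda>t. g (w + t *\<^sub>R u)) has_real_derivative dird u g (w + t *\<^sub>R u)) (at t)"
proof -
  have "((\<lambda>t. w + t *\<^sub>R u) has_derivative (\<lambda>t. t *\<^sub>R u)) (at t)"
    by (auto intro!: derivative_eq_intros)
  from has_derivative_compose[OF this dird_has_derivative[OF assms]]
  have *: "((\<lambda>t. g (w + t *\<^sub>R u)) has_derivative (\<lambda>s. dird (s *\<^sub>R u) g (w + t *\<^sub>R u))) (at t)" .
  have eq: "(\<lambda>s. dird (s *\<^sub>R u) g (w + t *\<^sub>R u)) = (*) (dird u g (w + t *\<^sub>R u))"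
    using linear.scaleR[OF dird_linear[OF assms]] by (auto simp: mult.commute)
  show ?thesis
    unfolding has_field_derivative_def using *[unfolded eq] .
qed

text \<open>The mixed second difference is a first difference in direction \<open>u\<close> of a first difference in
  direction \<open>v\<close>, so that the mean value theorem applies once in each direction. The left hand side is
  symmetric in \<open>u\<close> and \<open>v\<close>, which is what makes mixed derivatives commute.\<close>

lemma second_difference:
  fixes g :: "'a::real_normed_vector \<Rightarrow> real"
  assumes sm: "smooth_on S g" and s: "0 < s"
    and sub: "\<And>a b. 0 \<le> a \<Longrightarrow> a \<le> s \<Longrightarrow> 0 \<le> b \<Longrightarrow> b \<le> s \<Longrightarrow> w + a *\<^sub>R u + b *\<^sub>R v \<in> S"
  shows "\<exists>a b. 0 < a \<and> a < s \<and> 0 < b \<and> b < s \<and>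
     g (w + s *\<^sub>R u + s *\<^sub>R v) - g (w + s *\<^sub>R u) - g (w + s *\<^sub>R v) + g w
       = s * s * dird v (dird u g) (w + a *\<^sub>R u + b *\<^sub>R v)"
proof -
  have dg: "g differentiable (at (w + a *\<^sub>R u + b *\<^sub>R v))" "dird u g differentiable (at (w + a *\<^sub>R u + b *\<^sub>R v))"
    if "0 \<le> a" "a \<le> s" "0 \<le> b" "b \<le> s" for a b
    using smooth_on_differentiable[OF sm] smooth_on_differentiable[OF smooth_on_dird[OF sm]] sub[OF that] by auto
  define k where "k = (\<lambda>a. g ((w + s *\<^sub>R v) + a *\<^sub>R u) - g (w + a *\<^sub>R u))"
  have "\<exists>a. 0 < a \<and> a < s \<and> k s - k 0 = (s - 0) * (dird u g ((w + s *\<^sub>R v) + a *\<^sub>R u) - dird u g (w + a *\<^sub>R u))"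
    unfolding k_def using dg[of _ s] dg[of _ 0] s
    by (intro MVT2 s DERIV_diff differentiable_along_line) (auto simp: algebra_simps)
  then obtain a where a: "0 < a" "a < s"
    "k s - k 0 = s * (dird u g ((w + s *\<^sub>R v) + a *\<^sub>R u) - dird u g (w + a *\<^sub>R u))" by auto
  have "\<exists>b. 0 < b \<and> b < s \<and> dird u g (w + a *\<^sub>R u + s *\<^sub>R v) - dird u g (w + a *\<^sub>R u + 0 *\<^sub>R v)
      = (s - 0) * dird v (dird u g) (w + a *\<^sub>R u + b *\<^sub>R v)"
    using dg[of a] a by (intro MVT2 s differentiable_along_line) auto
  then obtain b where b: "0 < b" "b < s" "dird u g (w + a *\<^sub>R u + s *\<^sub>R v) - dird u g (w + a *\<^sub>R u)
      = s * dird v (dird u g) (w + a *\<^sub>R u + b *\<^sub>R v)" by auto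
  show ?thesis
    using a b by (intro exI[of _ a] exI[of _ b]) (auto simp: k_def algebra_simps)
qed

lemma dird_commute_real:
  fixes g :: "'a::real_normed_vector \<Rightarrow> real"
  assumes "open S" "smooth_on S g" "w \<in> S"
  shows "dird u (dird v g) w = dird v (dird u g) w"
proof (rule ccontr)
  assume neq: "dird u (dird v g) w \<noteq> dird v (dird u g) w"
  define P where "P = dird u (dird v g)"
  define Q where "Q = dird v (dird u g)"
  define e where "e = \<bar>P w - Q w\<bar> / 2"
  have e: "e > 0" using neq by (simp add: e_def P_def Q_def)
  have cont: "isCont P w" "isCont Q w"
    using smooth_on_continuous[OF smooth_on_dird[OF smooth_on_dird[OF assms(2)]]] assms(1,3)
    by (auto simp: P_def Q_def continuous_on_eq_continuous_at)
  obtain d0 where d0: "d0 > 0" "ball w d0 \<subseteq> S" using assms openE by blast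
  obtain d1 where d1: "d1 > 0" "\<And>y. dist y w < d1 \<Longrightarrow> dist (P y) (P w) < e"
    using cont(1) e unfolding continuous_at_eps_delta by blast
  obtain d2 where d2: "d2 > 0" "\<And>y. dist y w < d2 \<Longrightarrow> dist (Q y) (Q w) < e"
    using cont(2) e unfolding continuous_at_eps_delta by blast
  define d where "d = min d0 (min d1 d2)"
  \<comment> \<open>small enough that the parallelogram with sides \<open>s u\<close>, \<open>s v\<close> stays within \<open>d\<close> of \<open>w\<close>\<close>
  define s where "s = d / (2 * (norm u + norm v + 1))"
  have pos: "norm u + norm v + 1 > 0" by (smt (verit) norm_ge_zero)
  have d: "d > 0" using d0 d1 d2 by (simp add: d_def)
  then have s: "s > 0" using pos by (simp add: s_def)
  have sd: "s * (norm u + norm v) < d"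
  proof -
    have "s * (norm u + norm v) < s * (2 * (norm u + norm v + 1))"
      using s pos by (intro mult_strict_left_mono) (auto simp: add_pos_nonneg add_nonneg_pos)
    also have "\<dots> = d" using pos by (simp add: s_def)
    finally show ?thesis .
  qed
  have near: "dist (w + a *\<^sub>R u + b *\<^sub>R v) w < d" if "0 \<le> a" "a \<le> s" "0 \<le> b" "b \<le> s" for a b
  proof -
    have "dist (w + a *\<^sub>R u + b *\<^sub>R v) w = norm (a *\<^sub>R u + b *\<^sub>R v)"
      by (simp add: dist_norm algebra_simps)
    also have "\<dots> \<le> a * norm u + b * norm v"
      using norm_triangle_ineq[of "a *\<^sub>R u" "b *\<^sub>R v"] that by simp
    also have "\<dots> \<le> s * norm u + s * norm v"
      using that by (intro add_mono mult_right_mono) auto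
    finally show ?thesis using sd by (simp add: algebra_simps)
  qed
  then have inS: "w + a *\<^sub>R u + b *\<^sub>R v \<in> S" "w + a *\<^sub>R v + b *\<^sub>R u \<in> S"
    if "0 \<le> a" "a \<le> s" "0 \<le> b" "b \<le> s" for a b
    using d0 that near[OF that] near[OF that(3,4) that(1,2)]
    by (auto simp: d_def subset_iff dist_commute algebra_simps)
  obtain a b where ab: "0 < a" "a < s" "0 < b" "b < s"
    "g (w + s *\<^sub>R u + s *\<^sub>R v) - g (w + s *\<^sub>R u) - g (w + s *\<^sub>R v) + g w = s * s * Q (w + a *\<^sub>R u + b *\<^sub>R v)"
    using second_difference[OF assms(2) s inS(1)] unfolding Q_def by blast
  obtain a' b' where ab': "0 < a'" "a' < s" "0 < b'" "b' < s"
    "g (w + s *\<^sub>R v + s *\<^sub>R u) - g (w + s *\<^sub>R v) - g (w + s *\<^sub>R u) + g w = s * s * P (w + a' *\<^sub>R v + b' *\<^sub>R u)"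
    using second_difference[OF assms(2) s inS(2)] unfolding P_def by blast
  have "s * s * Q (w + a *\<^sub>R u + b *\<^sub>R v) = s * s * P (w + b' *\<^sub>R u + a' *\<^sub>R v)"
    using ab(5) ab'(5) by (simp add: algebra_simps)
  then have "Q (w + a *\<^sub>R u + b *\<^sub>R v) = P (w + b' *\<^sub>R u + a' *\<^sub>R v)"
    using s by simp
  moreover have "dist (Q (w + a *\<^sub>R u + b *\<^sub>R v)) (Q w) < e" "dist (P (w + b' *\<^sub>R u + a' *\<^sub>R v)) (P w) < e"
    using near[of a b] near[of b' a'] ab ab' d1 d2 by (auto simp: d_def)
  ultimately show False
    by (simp add: dist_real_def e_def abs_if split: if_splits)
qed

lemma dird_commute:
  fixes f :: "'a::real_normed_vector \<Rightarrow> 'b::euclidean_space"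
  assumes "open S" "smooth_on S f" "w \<in> S"
  shows "dird u (dird v f) w = dird v (dird u f) w"
proof (rule euclidean_eqI)
  fix b :: 'b assume "b \<in> Basis"
  have L: "bounded_linear (\<lambda>x::'b. x \<bullet> b)" by (rule bounded_linear_inner_left)
  have "dird u (dird v (\<lambda>x. f x \<bullet> b)) w = dird u (dird v f) w \<bullet> b" for u v
    using dird_cong[OF assms(1,3), of "dird v (\<lambda>x. f x \<bullet> b)" "\<lambda>x. dird v f x \<bullet> b"]
      dird_bounded_linear[OF L smooth_on_differentiable[OF assms(2)]]
      dird_bounded_linear[OF L smooth_on_differentiable[OF smooth_on_dird[OF assms(2)] assms(3)]]
    by simp
  then show "dird u (dird v f) w \<bullet> b = dird v (dird u f) w \<bullet> b"
    using dird_commute_real[OF assms(1) smooth_on_linear[OF L assms(1,2)] assms(3), of u v] by simp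
qed

section \<open>Algebra of the cross product\<close>

lemma UNIV_7: "(UNIV :: 7 set) = {1, 2, 3, 4, 5, 6, 7}"
proof -
  have "x \<in> {1, 2, 3, 4, 5, 6, 7}" for x :: 7
  proof (induct x)
    case (of_int z)
    then have "z = 0 \<or> z = 1 \<or> z = 2 \<or> z = 3 \<or> z = 4 \<or> z = 5 \<or> z = 6" by auto
    then show ?case by auto
  qed
  then show ?thesis by auto
qed

lemma sum_7: "sum f (UNIV :: 7 set) = f 1 + f 2 + f 3 + f 4 + f 5 + f 6 + f 7"
  unfolding UNIV_7 by (simp add: ac_simps)

lemma forall_7: "(\<forall>i::7. P i) \<longleftrightarrow> P 1 \<and> P 2 \<and> P 3 \<and> P 4 \<and> P 5 \<and> P 6 \<and> P 7"
proof -
  have "(\<forall>i::7. P i) \<longleftrightarrow> (\<forall>i\<in>{1,2,3,4,5,6,7}. P i)" unfolding UNIV_7[symmetric] by blast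
  then show ?thesis by simp
qed

lemma cross7_nth:
  "(v \<times>\<^sub>7 w) $ 1 = v$2 * w$3 - v$3 * w$2 + (v$4 * w$5 - v$5 * w$4) + (v$7 * w$6 - v$6 * w$7)"
  "(v \<times>\<^sub>7 w) $ 2 = v$3 * w$1 - v$1 * w$3 + (v$4 * w$6 - v$6 * w$4) + (v$5 * w$7 - v$7 * w$5)"
  "(v \<times>\<^sub>7 w) $ 3 = v$1 * w$2 - v$2 * w$1 + (v$4 * w$7 - v$7 * w$4) + (v$6 * w$5 - v$5 * w$6)"
  "(v \<times>\<^sub>7 w) $ 4 = v$5 * w$1 - v$1 * w$5 + (v$6 * w$2 - v$2 * w$6) + (v$7 * w$3 - v$3 * w$7)"
  "(v \<times>\<^sub>7 w) $ 5 = v$1 * w$4 - v$4 * w$1 + (v$7 * w$2 - v$2 * w$7) + (v$3 * w$6 - v$6 * w$3)"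
  "(v \<times>\<^sub>7 w) $ 6 = v$1 * w$7 - v$7 * w$1 + (v$2 * w$4 - v$4 * w$2) + (v$5 * w$3 - v$3 * w$5)"
  "(v \<times>\<^sub>7 w) $ 7 = v$6 * w$1 - v$1 * w$6 + (v$2 * w$5 - v$5 * w$2) + (v$3 * w$4 - v$4 * w$3)"
  by (simp_all add: cross7_def cross7_triples_def axis_def)

lemma inner_7: "(v::real^7) \<bullet> w = v$1 * w$1 + v$2 * w$2 + v$3 * w$3 + v$4 * w$4 + v$5 * w$5 + v$6 * w$6 + v$7 * w$7"
  by (simp add: inner_vec_def sum_7)

lemma cross7_triple: "(a \<times>\<^sub>7 b) \<bullet> c = a \<bullet> (b \<times>\<^sub>7 c)"
  unfolding inner_7 cross7_nth by (simp add: algebra_simps)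

text \<open>This polynomial identity expresses that the octonions are alternative. Together with bilinearity,
  antisymmetry and \<open>cross7_triple\<close> it is all that is used about the multiplication table.\<close>

lemma cross7_cross7: "a \<times>\<^sub>7 (a \<times>\<^sub>7 b) = (a \<bullet> b) *\<^sub>R a - (a \<bullet> a) *\<^sub>R b"
  unfolding vec_eq_iff forall_7 inner_7 vector_minus_component vector_scaleR_component cross7_nth
  by (simp add: algebra_simps)

lemma bounded_bilinear_cross7: "bounded_bilinear cross7"
  using bilinear_cross7 bilinear_conv_bounded_bilinear by blast

lemmas cross7_add_left = bilinear_ladd[OF bilinear_cross7]
  and cross7_add_right = bilinear_radd[OF bilinear_cross7]
  and cross7_diff_left = bilinear_lsub[OF bilinear_cross7]
  and cross7_diff_right = bilinear_rsub[OF bilinear_cross7]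
  and cross7_neg_left = bilinear_lneg[OF bilinear_cross7]
  and cross7_neg_right = bilinear_rneg[OF bilinear_cross7]
  and cross7_zero_left = bilinear_lzero[OF bilinear_cross7]
  and cross7_zero_right = bilinear_rzero[OF bilinear_cross7]

lemma cross7_scaleR_left: "(r *\<^sub>R a) \<times>\<^sub>7 b = r *\<^sub>R (a \<times>\<^sub>7 b)"
  using bilinear_lmul[OF bilinear_cross7] by blast

lemma cross7_scaleR_right: "a \<times>\<^sub>7 (r *\<^sub>R b) = r *\<^sub>R (a \<times>\<^sub>7 b)"
  using bilinear_rmul[OF bilinear_cross7] by blast

lemmas cross7_simps = cross7_add_left cross7_add_right cross7_diff_left cross7_diff_right
  cross7_neg_left cross7_neg_right cross7_zero_left cross7_zero_right
  cross7_scaleR_left cross7_scaleR_right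

lemma cross7_self [simp]: "a \<times>\<^sub>7 a = 0"
  using cross7_antisym[of a a] by (simp add: eq_neg_iff_add_eq_0 flip: scaleR_2)

lemma inner_cross7_self [simp]:
  "a \<bullet> (a \<times>\<^sub>7 b) = 0" "(a \<times>\<^sub>7 b) \<bullet> a = 0" "b \<bullet> (a \<times>\<^sub>7 b) = 0" "(a \<times>\<^sub>7 b) \<bullet> b = 0"
  using cross7_triple[of a a b] cross7_triple[of a b b] by (simp_all add: inner_commute cross7_simps)

lemma cross7_swap: "a \<bullet> (b \<times>\<^sub>7 c) = - (b \<bullet> (a \<times>\<^sub>7 c))"
  using cross7_triple[of a b c] cross7_triple[of b a c] cross7_antisym[of a b] by simp

lemma cross7_cycle: "a \<bullet> (b \<times>\<^sub>7 c) = b \<bullet> (c \<times>\<^sub>7 a)"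
  using cross7_swap[of a b c] cross7_antisym[of a c] by simp

lemma inner_cross7_cross7: "(a \<times>\<^sub>7 b) \<bullet> (a \<times>\<^sub>7 d) = (a \<bullet> a) * (b \<bullet> d) - (a \<bullet> b) * (a \<bullet> d)"
proof -
  have "(a \<times>\<^sub>7 b) \<bullet> (a \<times>\<^sub>7 d) = - (b \<bullet> (a \<times>\<^sub>7 (a \<times>\<^sub>7 d)))"
    using cross7_triple[of b a "a \<times>\<^sub>7 d"] cross7_antisym[of a b] by simp
  then show ?thesis
    by (simp add: cross7_cross7 inner_diff_right inner_commute algebra_simps)
qed

lemma cross7_cross7_polarized:
  "a \<times>\<^sub>7 (b \<times>\<^sub>7 d) + b \<times>\<^sub>7 (a \<times>\<^sub>7 d) = (a \<bullet> d) *\<^sub>R b + (b \<bullet> d) *\<^sub>R a - (2 * (a \<bullet> b)) *\<^sub>R d"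
proof -
  have "(a + b) \<times>\<^sub>7 ((a + b) \<times>\<^sub>7 d) = ((a + b) \<bullet> d) *\<^sub>R (a + b) - ((a + b) \<bullet> (a + b)) *\<^sub>R d"
    by (rule cross7_cross7)
  then show ?thesis
    by (simp add: cross7_simps cross7_cross7 inner_simps inner_commute algebra_simps)
qed

lemma cross7_anticommute:
  assumes "a \<bullet> b = 0" "a \<bullet> d = 0" "b \<bullet> d = 0"
  shows "a \<times>\<^sub>7 (b \<times>\<^sub>7 d) = - (b \<times>\<^sub>7 (a \<times>\<^sub>7 d))"
  using cross7_cross7_polarized[of a b d] assms by (simp add: eq_neg_iff_add_eq_0)

text \<open>If \<open>a \<bullet> (b \<times>\<^sub>7 d) = 0\<close>, the products of orthogonal \<open>a\<close>, \<open>b\<close>, \<open>d\<close> are totally antisymmetric, like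
  those of three generators of the octonions. Moving factors past each other reduces the claim to
  \<open>b \<times>\<^sub>7 (b \<times>\<^sub>7 _)\<close>.\<close>

lemma cross7_of_cross7:
  assumes "a \<bullet> b = 0" "a \<bullet> d = 0" "b \<bullet> d = 0" "a \<bullet> (b \<times>\<^sub>7 d) = 0"
  shows "(a \<times>\<^sub>7 b) \<times>\<^sub>7 (b \<times>\<^sub>7 d) = (b \<bullet> b) *\<^sub>R (a \<times>\<^sub>7 d)"
proof -
  have o: "d \<bullet> a = 0" "b \<bullet> a = 0" "d \<bullet> b = 0" using assms by (simp_all add: inner_commute)
  have "(a \<times>\<^sub>7 b) \<times>\<^sub>7 (b \<times>\<^sub>7 d) = - (b \<times>\<^sub>7 ((a \<times>\<^sub>7 b) \<times>\<^sub>7 d))"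
    using assms cross7_cycle[of d a b] cross7_triple[of a b d] by (intro cross7_anticommute) auto
  also have "(a \<times>\<^sub>7 b) \<times>\<^sub>7 d = d \<times>\<^sub>7 (b \<times>\<^sub>7 a)"
    using cross7_antisym[of d "a \<times>\<^sub>7 b"] cross7_antisym[of b a] by (simp add: cross7_simps)
  also have "d \<times>\<^sub>7 (b \<times>\<^sub>7 a) = - (b \<times>\<^sub>7 (d \<times>\<^sub>7 a))"
    by (rule cross7_anticommute) (simp_all add: o)
  also have "d \<times>\<^sub>7 a = - (a \<times>\<^sub>7 d)" by (rule cross7_antisym)
  also have "- (b \<times>\<^sub>7 (- (b \<times>\<^sub>7 (- (a \<times>\<^sub>7 d))))) = - (b \<times>\<^sub>7 (b \<times>\<^sub>7 (a \<times>\<^sub>7 d)))"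
    by (simp add: cross7_simps)
  also have "\<dots> = (b \<bullet> b) *\<^sub>R (a \<times>\<^sub>7 d)"
    using assms cross7_swap[of b a d] by (simp add: cross7_cross7)
  finally show ?thesis .
qed

lemma orthogonal_set_span:
  fixes B :: "'b::euclidean_space set"
  assumes "B \<subseteq> T" "subspace T" "dim T = card B" "finite B" "pairwise orthogonal B" "0 \<notin> B"
  shows "span B = T"
proof -
  have "independent B" by (rule pairwise_orthogonal_independent[OF assms(5,6)])
  then show ?thesis
    by (metis assms(1-4) card_eq_dim order_refl span_minimal subset_antisym)
qed

text \<open>The vectors \<open>a\<close>, \<open>b\<close>, \<open>d\<close> stand for \<open>\<phi>\<close>, \<open>\<phi>\<^sub>x\<close>, \<open>\<phi>\<^sub>y\<close> at one point; then \<open>x\<close> and \<open>y\<close> are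
  \<open>- F\<^sub>y\<close> and \<open>F\<^sub>x\<close>, and \<open>h\<close> is the mean curvature vector of \<open>F\<close>.\<close>

locale orthogonal_triple =
  fixes a b d :: "real ^ 7" and E :: real
  assumes E: "E > 0" and aa: "a \<bullet> a = 1" and bb: "b \<bullet> b = E" and dd: "d \<bullet> d = E"
    and ab: "a \<bullet> b = 0" and ad: "a \<bullet> d = 0" and bd: "b \<bullet> d = 0"
begin

definition "x = a \<times>\<^sub>7 b"
definition "y = a \<times>\<^sub>7 d"
definition "h = (1 / E) *\<^sub>R (b \<times>\<^sub>7 d)"
definition "n = a \<times>\<^sub>7 h"

lemma orth_sym: "b \<bullet> a = 0" "d \<bullet> a = 0" "d \<bullet> b = 0"
  using ab ad bd by (simp_all add: inner_commute)

lemma bh: "b \<bullet> h = 0" and dh: "d \<bullet> h = 0" and ax: "a \<bullet> x = 0" and ay: "a \<bullet> y = 0"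
  and bx: "b \<bullet> x = 0" and dy: "d \<bullet> y = 0" and an: "a \<bullet> n = 0" and hn: "h \<bullet> n = 0"
  by (simp_all add: h_def x_def y_def n_def)

lemma xx: "x \<bullet> x = E" and yy: "y \<bullet> y = E" and xy: "x \<bullet> y = 0"
  by (simp_all add: x_def y_def inner_cross7_cross7 aa bb dd ab ad bd)

lemma hh: "h \<bullet> h = 1"
  using E by (simp add: h_def inner_cross7_cross7 bb dd bd)

lemma xh: "x \<bullet> h = 0"
proof -
  have "x = - (b \<times>\<^sub>7 a)" unfolding x_def by (rule cross7_antisym)
  then show ?thesis by (simp add: h_def inner_cross7_cross7 orth_sym ab ad bd)
qed

lemma yh: "y \<bullet> h = 0"
proof -
  have "y = - (d \<times>\<^sub>7 a)" "b \<times>\<^sub>7 d = - (d \<times>\<^sub>7 b)" unfolding y_def by (rule cross7_antisym)+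
  then show ?thesis by (simp add: h_def inner_cross7_cross7 orth_sym ab ad bd)
qed

lemma bn: "b \<bullet> n = 0" and dn: "d \<bullet> n = 0"
proof -
  have "b \<times>\<^sub>7 a = - x" "d \<times>\<^sub>7 a = - y" unfolding x_def y_def by (rule cross7_antisym)+
  then show "b \<bullet> n = 0" "d \<bullet> n = 0"
    using cross7_cycle[of b a h] cross7_cycle[of a h b] cross7_cycle[of d a h] cross7_cycle[of a h d] xh yh
    by (simp_all add: n_def inner_commute)
qed

lemma xd: "x \<bullet> d = E * (a \<bullet> h)" and yb: "y \<bullet> b = - E * (a \<bullet> h)"
  using E cross7_antisym[of b d] by (simp_all add: x_def y_def h_def cross7_triple)

lemma xn: "x \<bullet> n = 0" and yn: "y \<bullet> n = 0"
  by (simp_all add: x_def y_def n_def inner_cross7_cross7 ab ad aa bh dh)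

lemma nn: "n \<bullet> n = 1 - (a \<bullet> h)\<^sup>2"
  by (simp add: n_def inner_cross7_cross7 aa hh power2_eq_square)

end

text \<open>The condition says that the plane of \<open>b\<close> and \<open>d\<close> is totally real for the almost complex structure
  \<open>a \<times>\<^sub>7 _\<close> of the 6-sphere. It makes the seven vectors \<open>a\<close>, \<open>b\<close>, \<open>d\<close>, \<open>n\<close>, \<open>x\<close>, \<open>y\<close>, \<open>h\<close> an orthogonal basis.\<close>

locale coassociative_triple = orthogonal_triple +
  assumes ah: "a \<bullet> h = 0"
begin

lemmas inners = aa bb dd xx yy hh ab ad bd bh dh ax ay bx dy an hn xy xh yh bn dn xn yn ah
  xd[unfolded ah mult_zero_right] yb[unfolded ah mult_zero_right]

lemma nn1: "n \<bullet> n = 1" using nn ah by simp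

lemma frame_nonzero: "a \<noteq> 0" "b \<noteq> 0" "d \<noteq> 0" "n \<noteq> 0" "x \<noteq> 0" "y \<noteq> 0" "h \<noteq> 0"
  using E aa bb dd nn1 xx yy hh by auto

lemma frame_inners_sym: "b \<bullet> a = 0" "d \<bullet> a = 0" "d \<bullet> b = 0" "h \<bullet> b = 0" "h \<bullet> d = 0"
  "x \<bullet> a = 0" "y \<bullet> a = 0" "x \<bullet> b = 0" "y \<bullet> d = 0" "n \<bullet> a = 0" "n \<bullet> h = 0" "y \<bullet> x = 0" "h \<bullet> x = 0"
  "h \<bullet> y = 0" "n \<bullet> b = 0" "n \<bullet> d = 0" "n \<bullet> x = 0" "n \<bullet> y = 0" "h \<bullet> a = 0" "d \<bullet> x = 0" "b \<bullet> y = 0"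
  using inners by (simp_all add: inner_commute)

lemmas frame_inner = inners nn1 frame_inners_sym

lemma frame_distinct: "distinct [a, b, d, n, x, y, h]"
proof -
  have neq: "u \<noteq> v" if "u \<bullet> v = 0" "u \<noteq> 0" for u v :: "real ^ 7"
    using that by auto
  show ?thesis by (simp add: neq frame_inner frame_nonzero)
qed

lemma frame_complete:
  assumes "u \<bullet> a = 0" "u \<bullet> b = 0" "u \<bullet> d = 0" "u \<bullet> n = 0" "u \<bullet> x = 0" "u \<bullet> y = 0" "u \<bullet> h = 0"
  shows "u = 0"
proof -
  let ?B = "{a, b, d, n, x, y, h}"
  have card: "card ?B = 7"
    using distinct_card[OF frame_distinct] by simp
  have "pairwise orthogonal ?B"
    using frame_inner by (auto simp: pairwise_insert orthogonal_def)
  then have "span ?B = UNIV"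
    by (intro orthogonal_set_span) (use card frame_nonzero in auto)
  then have "u \<in> span ?B" by simp
  moreover have "orthogonal u v" if "v \<in> ?B" for v
    using that assms by (auto simp: orthogonal_def)
  ultimately have "orthogonal u u" using orthogonal_to_span by blast
  then show ?thesis by (simp add: orthogonal_self)
qed

lemma frame_expansion:
  "u = (u \<bullet> a) *\<^sub>R a + (u \<bullet> b / E) *\<^sub>R b + (u \<bullet> d / E) *\<^sub>R d + (u \<bullet> n) *\<^sub>R n
     + (u \<bullet> x / E) *\<^sub>R x + (u \<bullet> y / E) *\<^sub>R y + (u \<bullet> h) *\<^sub>R h" (is "u = ?v")
proof -
  have "u - ?v = 0"
    by (rule frame_complete) (use E in \<open>simp_all add: inner_diff_left inner_add_left frame_inner\<close>)
  then show ?thesis by simp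
qed

text \<open>This is the coassociative space of the theorem; its orthogonal complement is spanned by the
  tangent plane of \<open>F\<close> and the mean curvature vector.\<close>

definition "W = span {a, b, d, n}"

lemma W_perp_iff: "u \<in> W\<^sup>\<bottom> \<longleftrightarrow> u \<bullet> a = 0 \<and> u \<bullet> b = 0 \<and> u \<bullet> d = 0 \<and> u \<bullet> n = 0"
proof
  assume "u \<in> W\<^sup>\<bottom>"
  then show "u \<bullet> a = 0 \<and> u \<bullet> b = 0 \<and> u \<bullet> d = 0 \<and> u \<bullet> n = 0"
    by (auto simp: W_def orthogonal_comp_def orthogonal_def span_base inner_commute)
next
  assume "u \<bullet> a = 0 \<and> u \<bullet> b = 0 \<and> u \<bullet> d = 0 \<and> u \<bullet> n = 0"
  then have "orthogonal u v" if "v \<in> W" for v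
    using that orthogonal_to_span[of v "{a,b,d,n}" u] by (auto simp: W_def orthogonal_def)
  then show "u \<in> W\<^sup>\<bottom>" by (auto simp: orthogonal_comp_def orthogonal_commute)
qed

lemma W_perp_span: "W\<^sup>\<bottom> = span {x, y, h}"
proof
  show "W\<^sup>\<bottom> \<subseteq> span {x, y, h}"
  proof
    fix u assume "u \<in> W\<^sup>\<bottom>"
    then have "u = (u \<bullet> x / E) *\<^sub>R x + (u \<bullet> y / E) *\<^sub>R y + (u \<bullet> h) *\<^sub>R h"
      using frame_expansion[of u] by (simp add: W_perp_iff)
    also have "\<dots> \<in> span {x, y, h}"
      by (intro span_add span_scale span_base) auto
    finally show "u \<in> span {x, y, h}" .
  qed
  have "{x, y, h} \<subseteq> W\<^sup>\<bottom>" by (auto simp: W_perp_iff frame_inner)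
  then show "span {x, y, h} \<subseteq> W\<^sup>\<bottom>" by (rule span_minimal) (rule subspace_orthogonal_comp)
qed

lemma dim_span_orthogonal:
  assumes "pairwise orthogonal B" "0 \<notin> B" "finite B"
  shows "dim (span B) = card B"
  using pairwise_orthogonal_independent[OF assms(1,2)] by (simp add: dim_eq_card)

lemma dim_W: "dim W = 4"
proof -
  have "distinct [a, b, d, n]" using frame_distinct by auto
  from distinct_card[OF this] have "card {a, b, d, n} = 4" by simp
  moreover have "pairwise orthogonal {a, b, d, n}"
    using frame_inner by (auto simp: pairwise_insert orthogonal_def)
  ultimately show ?thesis unfolding W_def
    by (subst dim_span_orthogonal) (use frame_nonzero in auto)
qed

lemma dim_W_perp: "dim (W\<^sup>\<bottom>) = 3"
proof -
  have "distinct [x, y, h]" using frame_distinct by auto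
  from distinct_card[OF this] have "card {x, y, h} = 3" by simp
  moreover have "pairwise orthogonal {x, y, h}"
    using frame_inner by (auto simp: pairwise_insert orthogonal_def)
  ultimately show ?thesis unfolding W_perp_span
    by (subst dim_span_orthogonal) (use frame_nonzero in auto)
qed

lemma cross_xyh: "x \<times>\<^sub>7 y = - E *\<^sub>R h" "y \<times>\<^sub>7 h = - x" "h \<times>\<^sub>7 x = - y"
proof -
  have abd: "a \<bullet> (b \<times>\<^sub>7 d) = 0" using ah E by (simp add: h_def)
  have "(b \<times>\<^sub>7 a) \<times>\<^sub>7 (a \<times>\<^sub>7 d) = (a \<bullet> a) *\<^sub>R (b \<times>\<^sub>7 d)"
    by (rule cross7_of_cross7) (simp_all add: frame_inner abd cross7_swap[of b a d])
  moreover have "b \<times>\<^sub>7 a = - x" unfolding x_def by (rule cross7_antisym)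
  moreover have "b \<times>\<^sub>7 d = E *\<^sub>R h" using E by (simp add: h_def)
  ultimately have "- (x \<times>\<^sub>7 y) = E *\<^sub>R h" by (simp add: y_def aa cross7_neg_left)
  then show "x \<times>\<^sub>7 y = - E *\<^sub>R h" by (metis minus_minus scaleR_minus_left)
  have "(a \<times>\<^sub>7 d) \<times>\<^sub>7 (d \<times>\<^sub>7 b) = (d \<bullet> d) *\<^sub>R (a \<times>\<^sub>7 b)"
    by (rule cross7_of_cross7) (simp_all add: frame_inner abd cross7_antisym[of d b] cross7_simps)
  moreover have "d \<times>\<^sub>7 b = - (E *\<^sub>R h)"
    using E cross7_antisym[of d b] by (simp add: h_def)
  ultimately have "E *\<^sub>R (y \<times>\<^sub>7 h) = E *\<^sub>R (- x)"
    by (simp add: x_def y_def dd cross7_simps minus_equation_iff[of _ "E *\<^sub>R (a \<times>\<^sub>7 b)"])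
  then show "y \<times>\<^sub>7 h = - x" using E by (simp del: scaleR_minus_right)
  have "(a \<times>\<^sub>7 b) \<times>\<^sub>7 (b \<times>\<^sub>7 d) = (b \<bullet> b) *\<^sub>R (a \<times>\<^sub>7 d)"
    by (rule cross7_of_cross7) (simp_all add: frame_inner abd)
  then have "x \<times>\<^sub>7 h = y"
    using E by (simp add: x_def y_def h_def bb cross7_simps)
  then show "h \<times>\<^sub>7 x = - y" using cross7_antisym[of h x] by simp
qed

lemma coassociative_W: "coassociative W"
proof -
  have comb: "\<exists>p q r. u = p *\<^sub>R x + q *\<^sub>R y + r *\<^sub>R h" if "u \<in> W\<^sup>\<bottom>" for u
  proof (intro exI)
    show "u = (u \<bullet> x / E) *\<^sub>R x + (u \<bullet> y / E) *\<^sub>R y + (u \<bullet> h) *\<^sub>R h"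
      using frame_expansion[of u] that by (simp add: W_perp_iff)
  qed
  have "u \<times>\<^sub>7 v \<in> W\<^sup>\<bottom>" if u: "u \<in> W\<^sup>\<bottom>" and v: "v \<in> W\<^sup>\<bottom>" for u v
  proof -
    obtain p q r p' q' r' where uv: "u = p *\<^sub>R x + q *\<^sub>R y + r *\<^sub>R h" "v = p' *\<^sub>R x + q' *\<^sub>R y + r' *\<^sub>R h"
      using comb[OF u] comb[OF v] by metis
    have "y \<times>\<^sub>7 x = E *\<^sub>R h" "h \<times>\<^sub>7 y = x" "x \<times>\<^sub>7 h = y"
      using cross_xyh cross7_antisym[of y x] cross7_antisym[of h y] cross7_antisym[of x h] by simp_all
    then show ?thesis
      unfolding W_perp_iff uv using cross_xyh
      by (simp add: cross7_simps inner_simps frame_inner)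
  qed
  then show ?thesis
    unfolding coassociative_def associative_plane_def
    using dim_W dim_W_perp subspace_orthogonal_comp by (auto simp: W_def)
qed

end

text \<open>For a nonzero \<open>u\<close> in \<open>W\<close>, the map \<open>u \<times>\<^sub>7 _\<close> is a similarity from the 3-dimensional \<open>W\<^sup>\<bottom>\<close> into the
  orthogonal complement of \<open>u\<close> in \<open>W\<close>, which also has dimension 3. Hence every vector of \<open>W\<close> is a
  combination of \<open>u\<close> and of vectors \<open>u \<times>\<^sub>7 a\<close> with \<open>a\<close> in \<open>W\<^sup>\<bottom>\<close>, and
  \<open>u \<times>\<^sub>7 (u \<times>\<^sub>7 a) = - (u \<bullet> u) *\<^sub>R a\<close>.\<close>

lemma coassociative_cross:
  assumes W: "coassociative W" and u: "u \<in> W" and v: "v \<in> W"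
  shows "u \<times>\<^sub>7 v \<in> W\<^sup>\<bottom>"
proof (cases "u = 0")
  case True
  then show ?thesis by (simp add: cross7_simps subspace_0 subspace_orthogonal_comp)
next
  case False
  have sW: "subspace W" and dW: "dim W = 4" and sV: "subspace (W\<^sup>\<bottom>)" and dV: "dim (W\<^sup>\<bottom>) = 3"
    and cl: "\<And>a b. a \<in> W\<^sup>\<bottom> \<Longrightarrow> b \<in> W\<^sup>\<bottom> \<Longrightarrow> a \<times>\<^sub>7 b \<in> W\<^sup>\<bottom>"
    using W by (auto simp: coassociative_def associative_plane_def)
  have perp: "a \<bullet> w = 0" "w \<bullet> a = 0" if "a \<in> W\<^sup>\<bottom>" "w \<in> W" for a w
    using that by (auto simp: orthogonal_comp_def orthogonal_def inner_commute)
  have mixed: "w \<times>\<^sub>7 a \<in> W" if "a \<in> W\<^sup>\<bottom>" "w \<in> W" for a w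
  proof -
    have "b \<bullet> (w \<times>\<^sub>7 a) = 0" if "b \<in> W\<^sup>\<bottom>" for b
      using cross7_cycle[of b w a] perp cl \<open>a \<in> W\<^sup>\<bottom>\<close> \<open>w \<in> W\<close> that by auto
    then have "w \<times>\<^sub>7 a \<in> W\<^sup>\<bottom>\<^sup>\<bottom>" by (simp add: orthogonal_comp_def orthogonal_def)
    then show ?thesis using orthogonal_comp_self[OF sW] by simp
  qed
  obtain B where B: "B \<subseteq> W\<^sup>\<bottom>" "pairwise orthogonal B" "\<And>x. x \<in> B \<Longrightarrow> norm x = 1"
    "independent B" "card B = 3" 
    using orthonormal_basis_subspace[OF sV] dV by metis
  have ip: "(u \<times>\<^sub>7 a) \<bullet> (u \<times>\<^sub>7 b) = (u \<bullet> u) * (a \<bullet> b)" if "a \<in> B" "b \<in> B" for a b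
    using that B(1) perp[OF _ u] by (auto simp: inner_cross7_cross7)
  let ?C = "(\<lambda>a. u \<times>\<^sub>7 a) ` B"
  have uu: "u \<bullet> u > 0" using False by simp
  have nz: "u \<times>\<^sub>7 a \<noteq> 0" if "a \<in> B" for a
    using ip[OF that that] B(3)[OF that] uu by (auto simp: norm_eq_1)
  have inj: "inj_on (\<lambda>a. u \<times>\<^sub>7 a) B"
  proof (rule inj_onI)
    fix a b assume ab: "a \<in> B" "b \<in> B" "u \<times>\<^sub>7 a = u \<times>\<^sub>7 b"
    then have "(u \<bullet> u) * (a \<bullet> b) = (u \<bullet> u) * (a \<bullet> a)" using ip by metis
    then have "a \<bullet> b \<noteq> 0" using uu B(3)[OF ab(1)] by (auto simp: norm_eq_1)
    then show "a = b" using B(2) ab(1,2) by (auto simp: pairwise_def orthogonal_def)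
  qed
  have fin: "finite B" using B(4) independent_imp_finite by blast
  have "u \<notin> ?C"
  proof
    assume "u \<in> ?C"
    then obtain a where "u = u \<times>\<^sub>7 a" by blast
    then have "u \<bullet> u = 0" using inner_cross7_self(1)[of u a] by metis
    then show False using uu by simp
  qed
  then have "card (insert u ?C) = 4"
    using fin card_image[OF inj] B(5) by simp
  moreover have "pairwise orthogonal (insert u ?C)"
  proof -
    have "orthogonal (u \<times>\<^sub>7 a) (u \<times>\<^sub>7 b)" if "a \<in> B" "b \<in> B" "a \<noteq> b" for a b
      using ip[OF that(1,2)] B(2) that by (auto simp: pairwise_def orthogonal_def)
    then show ?thesis
      by (auto simp: pairwise_insert orthogonal_def pairwise_def)
  qed
  ultimately have span: "span (insert u ?C) = W"
    using u mixed B(1) sW dW fin nz False by (intro orthogonal_set_span) auto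
  have "subspace {w. u \<times>\<^sub>7 w \<in> W\<^sup>\<bottom>}"
    using sV by (auto simp: subspace_def cross7_simps)
  moreover have "insert u ?C \<subseteq> {w. u \<times>\<^sub>7 w \<in> W\<^sup>\<bottom>}"
    using B(1) perp[OF _ u] sV
    by (auto simp: cross7_cross7 subspace_0 subspace_scale subset_iff intro!: subspace_neg)
  ultimately show ?thesis
    using span v span_minimal by blast
qed

section \<open>Minimal surfaces of the 6-sphere in a conformal coordinate\<close>

lemmas dird_inner = dird_bilinear[OF bounded_bilinear_inner]
  and dird_cross7 = dird_bilinear[OF bounded_bilinear_cross7]
  and dird_scaleR = dird_bilinear[OF bounded_bilinear_scaleR]
  and smooth_on_inner = smooth_on_bilinear[OF bounded_bilinear_inner]
  and smooth_on_cross7 = smooth_on_bilinear[OF bounded_bilinear_cross7]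
  and smooth_on_scaleR = smooth_on_bilinear[OF bounded_bilinear_scaleR]
  and smooth_on_mult = smooth_on_bilinear[OF bounded_bilinear_mult]

lemma dird_inner_eq:
  assumes "open S" "smooth_on S f" "smooth_on S g" "\<And>w. w \<in> S \<Longrightarrow> f w \<bullet> g w = k w" "w \<in> S"
  shows "dird v f w \<bullet> g w + f w \<bullet> dird v g w = dird v k w"
  using dird_inner[OF smooth_on_differentiable[OF assms(2,5)] smooth_on_differentiable[OF assms(3,5)], of v]
    dird_cong[OF assms(1,5,4)] by simp

lemma dird_inner_const:
  assumes "open S" "smooth_on S f" "smooth_on S g" "\<And>w. w \<in> S \<Longrightarrow> f w \<bullet> g w = c" "w \<in> S"
  shows "dird v f w \<bullet> g w = - (f w \<bullet> dird v g w)"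
  using dird_inner_eq[OF assms, of v] by simp

lemma dird_diff:
  assumes "f differentiable (at x)" "g differentiable (at x)"
  shows "dird v (\<lambda>x. f x - g x) x = dird v f x - dird v g x"
  by (rule dird_eqI) (intro has_derivative_diff dird_has_derivative assms)

text \<open>The coordinate expression \<open>p\<close> of \<open>\<phi>\<close> on the image \<open>S\<close> of a chart.\<close>

locale minimal_surface =
  fixes S :: "complex set" and p :: "complex \<Rightarrow> real ^ 7"
  assumes open_S: "open S" and smooth_p: "smooth_on S p"
    and unit_p: "w \<in> S \<Longrightarrow> p w \<bullet> p w = 1"
    and immersed: "w \<in> S \<Longrightarrow> dird 1 p w \<noteq> 0"
    and conformal_norm: "w \<in> S \<Longrightarrow> dird \<i> p w \<bullet> dird \<i> p w = dird 1 p w \<bullet> dird 1 p w"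
    and conformal_orth: "w \<in> S \<Longrightarrow> dird 1 p w \<bullet> dird \<i> p w = 0"
    and harmonic: "w \<in> S \<Longrightarrow> \<exists>k. dird 1 (dird 1 p) w + dird \<i> (dird \<i> p) w = k *\<^sub>R p w"
begin

abbreviation "p1 \<equiv> dird 1 p"
abbreviation "p2 \<equiv> dird \<i> p"
abbreviation "p11 \<equiv> dird 1 (dird 1 p)"
abbreviation "p12 \<equiv> dird \<i> (dird 1 p)"
abbreviation "p22 \<equiv> dird \<i> (dird \<i> p)"

text \<open>\<open>E\<close> is the conformal factor of both \<open>\<phi>\<close> and \<open>F\<close>, \<open>h\<close> the mean curvature vector of \<open>F\<close>, and \<open>X = - F\<^sub>y\<close>,
  \<open>Y = F\<^sub>x\<close>. As \<open>F\<^sub>x\<^sub>x \<bullet> h = E + \<alpha>\<close>, \<open>F\<^sub>y\<^sub>y \<bullet> h = E - \<alpha>\<close> and \<open>F\<^sub>x\<^sub>y \<bullet> h = \<beta>\<close>, the functions \<open>\<alpha>\<close> and \<open>\<beta>\<close>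
  are the trace-free part of the second fundamental form of \<open>F\<close> in the direction \<open>h\<close>. They are at the
  same time components of the second fundamental form of \<open>\<phi>\<close> in the direction \<open>N\<close>; see \<open>N_p11\<close> and
  \<open>N_p12\<close>.\<close>

definition "E w = p1 w \<bullet> p1 w"
definition "h w = inverse (E w) *\<^sub>R (p1 w \<times>\<^sub>7 p2 w)"
definition "X w = p w \<times>\<^sub>7 p1 w"
definition "Y w = p w \<times>\<^sub>7 p2 w"
definition "N w = p w \<times>\<^sub>7 h w"
definition "\<alpha> w = (p w \<times>\<^sub>7 p12 w) \<bullet> h w"
definition "\<beta> w = - ((p w \<times>\<^sub>7 p11 w) \<bullet> h w)"

lemma E_pos: "w \<in> S \<Longrightarrow> E w > 0" by (simp add: E_def immersed)

lemma E_nz: "w \<in> S \<Longrightarrow> E w \<noteq> 0" using E_pos by force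

lemma smooth_p1: "smooth_on S p1" and smooth_p2: "smooth_on S p2"
  and smooth_p11: "smooth_on S p11" and smooth_p12: "smooth_on S p12" and smooth_p22: "smooth_on S p22"
  by (intro smooth_on_dird smooth_p)+

lemma smooth_E: "smooth_on S E"
  unfolding E_def by (intro smooth_on_inner open_S smooth_p1 smooth_p2)

lemma smooth_h: "smooth_on S h"
  unfolding h_def by (intro smooth_on_scaleR smooth_on_inverse smooth_on_cross7 open_S smooth_p1 smooth_p2 smooth_E E_nz)

lemma smooth_X: "smooth_on S X" unfolding X_def by (intro smooth_on_cross7 open_S smooth_p smooth_p1 smooth_p2 smooth_p11 smooth_p12)

lemma smooth_Y: "smooth_on S Y" unfolding Y_def by (intro smooth_on_cross7 open_S smooth_p smooth_p1 smooth_p2 smooth_p11 smooth_p12)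

lemma smooth_N: "smooth_on S N" unfolding N_def by (intro smooth_on_cross7 open_S smooth_p smooth_h)

lemma smooth_\<alpha>: "smooth_on S \<alpha>"
  unfolding \<alpha>_def by (intro smooth_on_inner smooth_on_cross7 open_S smooth_p smooth_p1 smooth_p2 smooth_p11 smooth_p12 smooth_h)

lemma smooth_\<beta>: "smooth_on S \<beta>"
  unfolding \<beta>_def by (intro smooth_on_minus smooth_on_inner smooth_on_cross7 open_S smooth_p smooth_p1 smooth_p2 smooth_p11 smooth_p12 smooth_h)

lemmas smooths = smooth_p smooth_p1 smooth_p2 smooth_p11 smooth_p12 smooth_p22 smooth_E smooth_h smooth_X smooth_Y smooth_N smooth_\<alpha> smooth_\<beta>
lemmas diffs = smooths[THEN smooth_on_differentiable]
  and diff_p = smooth_p[THEN smooth_on_differentiable] and diff_p1 = smooth_p1[THEN smooth_on_differentiable]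
  and diff_p2 = smooth_p2[THEN smooth_on_differentiable] and diff_h = smooth_h[THEN smooth_on_differentiable]
  and diff_X = smooth_X[THEN smooth_on_differentiable] and diff_Y = smooth_Y[THEN smooth_on_differentiable]
  and diff_N = smooth_N[THEN smooth_on_differentiable]

lemma p21_eq: "w \<in> S \<Longrightarrow> dird 1 p2 w = p12 w"
  using dird_commute[OF open_S smooth_p] by blast

lemma p_perp: "w \<in> S \<Longrightarrow> p w \<bullet> dird v p w = 0"
  using dird_inner_const[OF open_S smooth_p smooth_p unit_p, of w v] by (simp add: inner_commute)

lemma orthogonal_triple_at: "w \<in> S \<Longrightarrow> orthogonal_triple (p w) (p1 w) (p2 w) (E w)"
  using p_perp conformal_norm conformal_orth unit_p immersed
  by unfold_locales (auto simp: E_def)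

lemma orthogonal_triple_at_defs:
  assumes "w \<in> S"
  shows "orthogonal_triple.h (p1 w) (p2 w) (E w) = h w" "orthogonal_triple.x (p w) (p1 w) = X w"
    "orthogonal_triple.y (p w) (p2 w) = Y w" "orthogonal_triple.n (p w) (p1 w) (p2 w) (E w) = N w"
proof -
  interpret t: orthogonal_triple "p w" "p1 w" "p2 w" "E w" by (rule orthogonal_triple_at[OF assms])
  show "t.h = h w" "t.x = X w" "t.y = Y w" "t.n = N w"
    by (simp_all add: t.h_def t.x_def t.y_def t.n_def h_def X_def Y_def N_def inverse_eq_divide)
qed

lemma p_p11: "w \<in> S \<Longrightarrow> p w \<bullet> p11 w = - E w"
  and p_p12: "w \<in> S \<Longrightarrow> p w \<bullet> p12 w = 0"
  and p_p22: "w \<in> S \<Longrightarrow> p w \<bullet> p22 w = - E w"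
proof -
  assume w: "w \<in> S"
  have "p2 w \<bullet> p1 w = 0" using conformal_orth[OF w] by (simp add: inner_commute)
  then show "p w \<bullet> p11 w = - E w" "p w \<bullet> p12 w = 0" "p w \<bullet> p22 w = - E w"
    using dird_inner_const[OF open_S smooth_p smooth_p1 p_perp w, of 1]
      dird_inner_const[OF open_S smooth_p smooth_p1 p_perp w, of \<i>]
      dird_inner_const[OF open_S smooth_p smooth_p2 p_perp w, of \<i>]
    by (simp_all add: E_def conformal_norm w)
qed

lemma p22_eq: "w \<in> S \<Longrightarrow> p22 w = - p11 w - (2 * E w) *\<^sub>R p w"
proof -
  assume w: "w \<in> S"
  then obtain k where k: "p11 w + p22 w = k *\<^sub>R p w" using harmonic by blast
  have "k = p w \<bullet> (p11 w + p22 w)" using k unit_p[OF w] by simp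
  then have "k = - 2 * E w" using p_p11 p_p22 w by (simp add: inner_add_right)
  moreover have "p22 w = k *\<^sub>R p w - p11 w" using k by (simp add: eq_diff_eq add.commute)
  ultimately show ?thesis by simp
qed

lemma p1_p11: "w \<in> S \<Longrightarrow> p1 w \<bullet> p11 w = dird 1 E w / 2"
  and p1_p12: "w \<in> S \<Longrightarrow> p1 w \<bullet> p12 w = dird \<i> E w / 2"
  and p2_p12: "w \<in> S \<Longrightarrow> p2 w \<bullet> p12 w = dird 1 E w / 2"
  and p2_p11: "w \<in> S \<Longrightarrow> p2 w \<bullet> p11 w = - dird \<i> E w / 2"
proof -
  assume w: "w \<in> S"
  show "p1 w \<bullet> p11 w = dird 1 E w / 2"
    using dird_inner_eq[OF open_S smooth_p1 smooth_p1 _ w, of E 1] by (simp add: E_def inner_commute)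
  show *: "p1 w \<bullet> p12 w = dird \<i> E w / 2"
    using dird_inner_eq[OF open_S smooth_p1 smooth_p1 _ w, of E \<i>] by (simp add: E_def inner_commute)
  show "p2 w \<bullet> p12 w = dird 1 E w / 2"
    using dird_inner_eq[OF open_S smooth_p2 smooth_p2 _ w, of E 1] p21_eq[OF w]
    by (simp add: E_def inner_commute conformal_norm)
  show "p2 w \<bullet> p11 w = - dird \<i> E w / 2"
    using dird_inner_const[OF open_S smooth_p1 smooth_p2 conformal_orth w, of 1] p21_eq[OF w] *
    by (simp add: inner_commute)
qed

lemma cross_p1_p2: "w \<in> S \<Longrightarrow> p1 w \<times>\<^sub>7 p2 w = E w *\<^sub>R h w"
  by (simp add: h_def E_nz)

lemma X_x: "w \<in> S \<Longrightarrow> dird 1 X w = p w \<times>\<^sub>7 p11 w"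
  and X_y: "w \<in> S \<Longrightarrow> dird \<i> X w = p w \<times>\<^sub>7 p12 w - E w *\<^sub>R h w"
  and Y_x: "w \<in> S \<Longrightarrow> dird 1 Y w = p w \<times>\<^sub>7 p12 w + E w *\<^sub>R h w"
  and Y_y: "w \<in> S \<Longrightarrow> dird \<i> Y w = - (p w \<times>\<^sub>7 p11 w)"
proof -
  assume w: "w \<in> S"
  have X: "dird v X w = dird v p w \<times>\<^sub>7 p1 w + p w \<times>\<^sub>7 dird v p1 w" for v
    unfolding X_def[abs_def] by (rule dird_cross7[OF diff_p[OF w] diff_p1[OF w]])
  have Y: "dird v Y w = dird v p w \<times>\<^sub>7 p2 w + p w \<times>\<^sub>7 dird v p2 w" for v
    unfolding Y_def[abs_def] by (rule dird_cross7[OF diff_p[OF w] diff_p2[OF w]])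
  show "dird 1 X w = p w \<times>\<^sub>7 p11 w" "dird \<i> Y w = - (p w \<times>\<^sub>7 p11 w)"
    by (simp_all add: X Y p22_eq[OF w] cross7_simps)
  show "dird 1 Y w = p w \<times>\<^sub>7 p12 w + E w *\<^sub>R h w"
    by (simp add: Y p21_eq w cross_p1_p2[OF w])
  show "dird \<i> X w = p w \<times>\<^sub>7 p12 w - E w *\<^sub>R h w"
    using cross7_antisym[of "p2 w" "p1 w"] by (simp add: X cross_p1_p2[OF w])
qed

context
  fixes w
  assumes w: "w \<in> S"
begin

interpretation t: orthogonal_triple "p w" "p1 w" "p2 w" "E w"
  rewrites "orthogonal_triple.h (p1 w) (p2 w) (E w) = h w" and "orthogonal_triple.x (p w) (p1 w) = X w"
    and "orthogonal_triple.y (p w) (p2 w) = Y w" and "orthogonal_triple.n (p w) (p1 w) (p2 w) (E w) = N w"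
  by (rule orthogonal_triple_at[OF w]) (fact orthogonal_triple_at_defs[OF w])+

lemmas p_p1 = t.ab and p_p2 = t.ad and p1_p2 = t.bd and p1_h = t.bh and p2_h = t.dh
  and p_X = t.ax and p_Y = t.ay and p1_X = t.bx and p2_Y = t.dy and p_N = t.an and h_N = t.hn
  and X_X = t.xx and Y_Y = t.yy and X_Y = t.xy and h_h = t.hh and X_h = t.xh and Y_h = t.yh
  and p1_N = t.bn and p2_N = t.dn and X_N = t.xn and Y_N = t.yn and X_p2 = t.xd and Y_p1 = t.yb

lemma cross_X: "(p w \<times>\<^sub>7 u) \<bullet> X w = u \<bullet> p1 w" and cross_Y: "(p w \<times>\<^sub>7 u) \<bullet> Y w = u \<bullet> p2 w"
  by (simp_all add: X_def Y_def inner_cross7_cross7 unit_p w p_perp)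

lemma N_p11: "N w \<bullet> p11 w = \<beta> w" and N_p12: "N w \<bullet> p12 w = - \<alpha> w"
proof -
  have "N w \<bullet> u = - ((p w \<times>\<^sub>7 u) \<bullet> h w)" for u
  proof -
    have "N w \<bullet> u = h w \<bullet> (u \<times>\<^sub>7 p w)"
      unfolding N_def cross7_triple by (rule cross7_cycle)
    also have "u \<times>\<^sub>7 p w = - (p w \<times>\<^sub>7 u)" by (rule cross7_antisym)
    finally show ?thesis by (simp add: inner_commute)
  qed
  then show "N w \<bullet> p11 w = \<beta> w" "N w \<bullet> p12 w = - \<alpha> w" by (simp_all add: \<alpha>_def \<beta>_def)
qed

end

lemma N_p22: "w \<in> S \<Longrightarrow> N w \<bullet> p22 w = - \<beta> w"
  using p_N N_p11 by (simp add: p22_eq inner_simps inner_commute)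

lemma X_h_x: "w \<in> S \<Longrightarrow> X w \<bullet> dird 1 h w = \<beta> w"
  and X_h_y: "w \<in> S \<Longrightarrow> X w \<bullet> dird \<i> h w = E w - \<alpha> w"
  and Y_h_x: "w \<in> S \<Longrightarrow> Y w \<bullet> dird 1 h w = - (E w + \<alpha> w)"
  and Y_h_y: "w \<in> S \<Longrightarrow> Y w \<bullet> dird \<i> h w = - \<beta> w"
proof -
  assume w: "w \<in> S"
  note X = dird_inner_const[OF open_S smooth_X smooth_h X_h w]
    and Y = dird_inner_const[OF open_S smooth_Y smooth_h Y_h w]
  have hh: "h w \<bullet> h w = 1" using h_h[OF w] .
  show "X w \<bullet> dird 1 h w = \<beta> w" "X w \<bullet> dird \<i> h w = E w - \<alpha> w"
    using X[of 1] X[of \<i>] by (simp_all add: X_x X_y w \<alpha>_def \<beta>_def inner_simps hh)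
  show "Y w \<bullet> dird 1 h w = - (E w + \<alpha> w)" "Y w \<bullet> dird \<i> h w = - \<beta> w"
    using Y[of 1] Y[of \<i>] by (simp_all add: Y_x Y_y w \<alpha>_def \<beta>_def inner_simps hh)
qed

lemma p11_h: "w \<in> S \<Longrightarrow> p11 w \<bullet> h w = - (p1 w \<bullet> dird 1 h w)"
  and p12_h: "w \<in> S \<Longrightarrow> p12 w \<bullet> h w = - (p2 w \<bullet> dird 1 h w)"
  using dird_inner_const[OF open_S smooth_p1 smooth_h p1_h, of w 1]
    dird_inner_const[OF open_S smooth_p2 smooth_h p2_h, of w 1] p21_eq by simp_all

text \<open>Since \<open>N\<close> does not depend on the coordinate, these formulas describe \<open>\<alpha>\<close> and \<open>\<beta>\<close> by first
  derivatives only. This makes their behaviour under a change of chart a matter of the chain rule.\<close>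

lemma p1_N_x: "w \<in> S \<Longrightarrow> p1 w \<bullet> dird 1 N w = - \<beta> w"
  and p1_N_y: "w \<in> S \<Longrightarrow> p1 w \<bullet> dird \<i> N w = \<alpha> w"
  and p2_N_x: "w \<in> S \<Longrightarrow> p2 w \<bullet> dird 1 N w = \<alpha> w"
  and p2_N_y: "w \<in> S \<Longrightarrow> p2 w \<bullet> dird \<i> N w = \<beta> w"
  using dird_inner_const[OF open_S smooth_p1 smooth_N p1_N, of w 1]
    dird_inner_const[OF open_S smooth_p1 smooth_N p1_N, of w \<i>]
    dird_inner_const[OF open_S smooth_p2 smooth_N p2_N, of w 1]
    dird_inner_const[OF open_S smooth_p2 smooth_N p2_N, of w \<i>]
    N_p11 N_p12 N_p22 p21_eq
  by (simp_all add: inner_commute)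

end

section \<open>Parallel mean curvature\<close>

locale parallel_surface = minimal_surface +
  assumes parallel: "w \<in> S \<Longrightarrow> dird v h w \<in> span {X w, Y w}"
begin

lemma h_x: "w \<in> S \<Longrightarrow> E w *\<^sub>R dird 1 h w = \<beta> w *\<^sub>R X w - (E w + \<alpha> w) *\<^sub>R Y w"
  and h_y: "w \<in> S \<Longrightarrow> E w *\<^sub>R dird \<i> h w = (E w - \<alpha> w) *\<^sub>R X w - \<beta> w *\<^sub>R Y w"
proof -
  assume w: "w \<in> S"
  have eq: "E w *\<^sub>R dird v h w = (X w \<bullet> dird v h w) *\<^sub>R X w + (Y w \<bullet> dird v h w) *\<^sub>R Y w" for v
  proof -
    obtain r s where rs: "dird v h w = r *\<^sub>R X w + s *\<^sub>R Y w"
      using parallel[OF w, of v] by (auto simp: span_insert span_singleton algebra_simps)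
    show ?thesis using X_X[OF w] Y_Y[OF w] X_Y[OF w] X_Y[OF w, unfolded inner_commute[of "X w"]]
      by (simp add: rs inner_simps algebra_simps)
  qed
  show "E w *\<^sub>R dird 1 h w = \<beta> w *\<^sub>R X w - (E w + \<alpha> w) *\<^sub>R Y w"
    "E w *\<^sub>R dird \<i> h w = (E w - \<alpha> w) *\<^sub>R X w - \<beta> w *\<^sub>R Y w"
    unfolding eq X_h_x[OF w] X_h_y[OF w] Y_h_x[OF w] Y_h_y[OF w]
    by (simp_all only: scaleR_minus_left diff_conv_add_uminus)
qed

text \<open>The integrability condition \<open>h\<^sub>x\<^sub>y = h\<^sub>y\<^sub>x\<close> for the two formulas above. Its tangential part is the
  equation of Codazzi and its normal part that of Ricci, for the immersion \<open>F\<close>.\<close>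

lemma ricci_codazzi:
  assumes w: "w \<in> S"
  shows "(2 * E w) *\<^sub>R (\<alpha> w *\<^sub>R (p w \<times>\<^sub>7 p11 w) + \<beta> w *\<^sub>R (p w \<times>\<^sub>7 p12 w)) =
    (dird \<i> E w * \<beta> w + dird 1 E w * \<alpha> w - E w * (dird \<i> \<beta> w + dird 1 \<alpha> w)) *\<^sub>R X w +
    (dird 1 E w * \<beta> w - dird \<i> E w * \<alpha> w - E w * (dird 1 \<beta> w - dird \<i> \<alpha> w)) *\<^sub>R Y w"
proof -
  let ?Z = "p w \<times>\<^sub>7 p11 w" and ?V = "p w \<times>\<^sub>7 p12 w"
  have dE: "(\<lambda>w. E w + \<alpha> w) differentiable at w" "(\<lambda>w. E w - \<alpha> w) differentiable at w"
    using diffs w by (auto intro!: derivative_intros)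
  have 1: "dird \<i> (\<lambda>w. E w *\<^sub>R dird 1 h w) w = dird \<i> (\<lambda>w. \<beta> w *\<^sub>R X w - (E w + \<alpha> w) *\<^sub>R Y w) w"
    by (rule dird_cong[OF open_S w]) (simp add: h_x)
  have 2: "dird 1 (\<lambda>w. E w *\<^sub>R dird \<i> h w) w = dird 1 (\<lambda>w. (E w - \<alpha> w) *\<^sub>R X w - \<beta> w *\<^sub>R Y w) w"
    by (rule dird_cong[OF open_S w]) (simp add: h_y)
  note ds = differentiable_bilinear[OF bounded_bilinear_scaleR]
  have 1: "dird \<i> E w *\<^sub>R dird 1 h w + E w *\<^sub>R dird \<i> (dird 1 h) w =
      dird \<i> \<beta> w *\<^sub>R X w + \<beta> w *\<^sub>R (?V - E w *\<^sub>R h w) - (dird \<i> E w + dird \<i> \<alpha> w) *\<^sub>R Y w + (E w + \<alpha> w) *\<^sub>R ?Z"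
    using 1 by (simp add: dird_add dird_diff dird_scaleR ds dE diffs w smooth_on_differentiable[OF smooth_on_dird[OF smooth_h] w]
      X_x X_y Y_x Y_y)
  have 2: "dird 1 E w *\<^sub>R dird \<i> h w + E w *\<^sub>R dird 1 (dird \<i> h) w =
      (dird 1 E w - dird 1 \<alpha> w) *\<^sub>R X w + (E w - \<alpha> w) *\<^sub>R ?Z - dird 1 \<beta> w *\<^sub>R Y w - \<beta> w *\<^sub>R (?V + E w *\<^sub>R h w)"
    using 2 by (simp add: dird_add dird_diff dird_scaleR ds dE diffs w smooth_on_differentiable[OF smooth_on_dird[OF smooth_h] w]
      X_x X_y Y_x Y_y)
  have 3: "dird \<i> (dird 1 h) w = dird 1 (dird \<i> h) w"
    by (rule dird_commute[OF open_S smooth_h w])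
  have 4: "(\<alpha> w *\<^sub>R ?Z + \<beta> w *\<^sub>R ?V) + (\<alpha> w *\<^sub>R ?Z + \<beta> w *\<^sub>R ?V) = dird \<i> E w *\<^sub>R dird 1 h w - dird 1 E w *\<^sub>R dird \<i> h w
     - (dird \<i> \<beta> w - dird 1 E w + dird 1 \<alpha> w) *\<^sub>R X w - (dird 1 \<beta> w - dird \<i> E w - dird \<i> \<alpha> w) *\<^sub>R Y w"
    using arg_cong2[where f = "(-)", OF 1 2] 3 by (simp add: algebra_simps)
  have "(2 * E w) *\<^sub>R (\<alpha> w *\<^sub>R ?Z + \<beta> w *\<^sub>R ?V) = E w *\<^sub>R ((\<alpha> w *\<^sub>R ?Z + \<beta> w *\<^sub>R ?V) + (\<alpha> w *\<^sub>R ?Z + \<beta> w *\<^sub>R ?V))"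
    by (simp add: mult.commute flip: scaleR_2)
  also have "\<dots> = dird \<i> E w *\<^sub>R (E w *\<^sub>R dird 1 h w) - dird 1 E w *\<^sub>R (E w *\<^sub>R dird \<i> h w)
     - (E w * (dird \<i> \<beta> w - dird 1 E w + dird 1 \<alpha> w)) *\<^sub>R X w - (E w * (dird 1 \<beta> w - dird \<i> E w - dird \<i> \<alpha> w)) *\<^sub>R Y w"
    unfolding 4 by (simp add: algebra_simps)
  finally show ?thesis
    unfolding h_x[OF w] h_y[OF w] by (simp add: algebra_simps)
qed

text \<open>These are the Cauchy-Riemann equations of \<open>\<alpha> - \<i> \<beta>\<close>, the coefficient of the Hopf differential of
  \<open>F\<close> with respect to \<open>h\<close>.\<close>

lemma codazzi:
  assumes w: "w \<in> S"
  shows "dird 1 \<alpha> w = - dird \<i> \<beta> w" "dird \<i> \<alpha> w = dird 1 \<beta> w"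
proof -
  note f = X_X[OF w] Y_Y[OF w] X_Y[OF w] X_Y[OF w, unfolded inner_commute[of "X w"]] and
    pp = p1_p11[OF w] p1_p12[OF w] p2_p11[OF w] p2_p12[OF w] and E = E_pos[OF w]
  have "E w * (E w * (dird \<i> \<beta> w + dird 1 \<alpha> w)) = 0"
    using arg_cong[OF ricci_codazzi[OF w], of "\<lambda>u. u \<bullet> X w"] pp
    by (simp add: inner_simps cross_X[OF w] f inner_commute[of _ "p1 w"] algebra_simps)
  then show "dird 1 \<alpha> w = - dird \<i> \<beta> w" using E by simp
  have "E w * (E w * (dird 1 \<beta> w - dird \<i> \<alpha> w)) = 0"
    using arg_cong[OF ricci_codazzi[OF w], of "\<lambda>u. u \<bullet> Y w"] pp
    by (simp add: inner_simps cross_Y[OF w] f inner_commute[of _ "p2 w"] algebra_simps)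
  then show "dird \<i> \<alpha> w = dird 1 \<beta> w" using E by simp
qed

text \<open>Both sides of \<open>ricci_codazzi\<close> are of the form \<open>p \<times>\<^sub>7 _\<close>, and \<open>p \<times>\<^sub>7 u = 0\<close> only for multiples \<open>u\<close> of
  \<open>p\<close>. So the condition turns into one on the second derivatives of \<open>p\<close> itself: where \<open>\<alpha>\<close> and \<open>\<beta>\<close> do not
  both vanish, the image of the second fundamental form of \<open>\<phi>\<close> is at most a line.\<close>

lemma ricci:
  assumes w: "w \<in> S"
  shows "(2 * E w) *\<^sub>R (\<alpha> w *\<^sub>R p11 w + \<beta> w *\<^sub>R p12 w) =
    (dird \<i> E w * \<beta> w + dird 1 E w * \<alpha> w) *\<^sub>R p1 w + (dird 1 E w * \<beta> w - dird \<i> E w * \<alpha> w) *\<^sub>R p2 w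
    - (2 * E w * E w * \<alpha> w) *\<^sub>R p w"
proof -
  define u where "u = (2 * E w) *\<^sub>R (\<alpha> w *\<^sub>R p11 w + \<beta> w *\<^sub>R p12 w) -
    (dird \<i> E w * \<beta> w + dird 1 E w * \<alpha> w) *\<^sub>R p1 w - (dird 1 E w * \<beta> w - dird \<i> E w * \<alpha> w) *\<^sub>R p2 w"
  have "p w \<times>\<^sub>7 u = 0"
    using ricci_codazzi[OF w] codazzi[OF w] by (simp add: u_def cross7_simps X_def Y_def)
  then have "(p w \<bullet> u) *\<^sub>R p w - u = 0"
    using cross7_cross7[of "p w" u] unit_p[OF w] by (simp add: cross7_simps)
  moreover have "p w \<bullet> u = - (2 * E w * E w * \<alpha> w)"
    by (simp add: u_def inner_simps p_p11 p_p12 p_perp w)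
  ultimately have "u = - (2 * E w * E w * \<alpha> w) *\<^sub>R p w" by simp
  then show ?thesis unfolding u_def by (simp add: algebra_simps)
qed

lemma p11_h_eq: "w \<in> S \<Longrightarrow> p11 w \<bullet> h w = - ((E w + \<alpha> w) * (p w \<bullet> h w))"
  and p12_h_eq: "w \<in> S \<Longrightarrow> p12 w \<bullet> h w = - \<beta> w * (p w \<bullet> h w)"
proof -
  assume w: "w \<in> S"
  have "E w * (p1 w \<bullet> dird 1 h w) = E w * ((E w + \<alpha> w) * (p w \<bullet> h w))"
    using arg_cong[OF h_x[OF w], of "\<lambda>u. p1 w \<bullet> u"] p1_X[OF w] Y_p1[OF w]
    by (simp add: inner_simps inner_commute[of "p1 w" "Y w"])
  then show "p11 w \<bullet> h w = - ((E w + \<alpha> w) * (p w \<bullet> h w))"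
    unfolding p11_h[OF w] using E_nz[OF w] by (simp del: distrib_right distrib_left)
  have "E w * (p2 w \<bullet> dird 1 h w) = E w * (\<beta> w * (p w \<bullet> h w))"
    using arg_cong[OF h_x[OF w], of "\<lambda>u. p2 w \<bullet> u"] p2_Y[OF w] X_p2[OF w]
    by (simp add: inner_simps inner_commute[of "p2 w" "X w"])
  then show "p12 w \<bullet> h w = - \<beta> w * (p w \<bullet> h w)"
    using p12_h[OF w] E_nz[OF w] by simp
qed

text \<open>The inner product of \<open>ricci\<close> with \<open>h\<close>. The components \<open>p\<^sub>x\<^sub>x \<bullet> h\<close> and \<open>p\<^sub>x\<^sub>y \<bullet> h\<close> are multiples of \<open>p \<bullet> h\<close>
  because \<open>h\<close> is parallel, and what remains is \<open>(\<alpha>\<^sup>2 + \<beta>\<^sup>2) (p \<bullet> h) = 0\<close>.\<close>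

lemma totally_real_where_not_umbilic:
  assumes w: "w \<in> S" and nz: "\<alpha> w \<noteq> 0 \<or> \<beta> w \<noteq> 0"
  shows "p w \<bullet> h w = 0"
proof -
  have "(2 * E w) * ((\<alpha> w * \<alpha> w + \<beta> w * \<beta> w) * (p w \<bullet> h w)) = 0"
    using arg_cong[OF ricci[OF w], of "\<lambda>u. u \<bullet> h w"] p11_h_eq[OF w] p12_h_eq[OF w] p1_h[OF w] p2_h[OF w]
    by (simp add: inner_simps algebra_simps)
  then show ?thesis using E_pos[OF w] nz by (auto simp: sum_squares_eq_zero_iff)
qed

text \<open>Differentiating \<open>p \<bullet> (p\<^sub>x \<times>\<^sub>7 p\<^sub>y) = 0\<close> expresses the components of \<open>p\<^sub>x\<^sub>y\<close> along \<open>X\<close> and \<open>Y\<close> by those of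
  \<open>p\<^sub>x\<^sub>x\<close>. The components of \<open>ricci\<close> along \<open>X\<close> and \<open>Y\<close> then form a linear system with determinant
  \<open>\<alpha>\<^sup>2 + \<beta>\<^sup>2\<close>.\<close>

lemma second_derivatives_where_not_umbilic:
  assumes c: "\<And>w. w \<in> S \<Longrightarrow> p w \<bullet> h w = 0" and w: "w \<in> S" and nz: "\<alpha> w \<noteq> 0 \<or> \<beta> w \<noteq> 0"
  shows "p11 w \<bullet> X w = 0" "p11 w \<bullet> Y w = 0" "p12 w \<bullet> X w = 0" "p12 w \<bullet> Y w = 0"
proof -
  have c': "p w \<bullet> (p1 w \<times>\<^sub>7 p2 w) = 0" if "w \<in> S" for w
    using c[OF that] by (simp add: cross_p1_p2 that)
  have sm: "smooth_on S (\<lambda>w. p1 w \<times>\<^sub>7 p2 w)" by (intro smooth_on_cross7 open_S smooth_p1 smooth_p2)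
  have D: "dird v p w \<bullet> (p1 w \<times>\<^sub>7 p2 w) = - (p w \<bullet> (dird v p1 w \<times>\<^sub>7 p2 w + p1 w \<times>\<^sub>7 dird v p2 w))" for v
    using dird_inner_const[OF open_S smooth_p sm c' w, of v] dird_cross7[OF diff_p1[OF w] diff_p2[OF w], of v] by simp
  have a: "p w \<bullet> (u \<times>\<^sub>7 p2 w) = - (u \<bullet> Y w)" for u
    unfolding Y_def by (rule cross7_swap)
  have b: "p w \<bullet> (p1 w \<times>\<^sub>7 u) = u \<bullet> X w" for u
    unfolding X_def by (rule cross7_cycle[symmetric])
  have xy: "p12 w \<bullet> X w = p11 w \<bullet> Y w" "p12 w \<bullet> Y w = - (p11 w \<bullet> X w)"
    using D[of 1] D[of \<i>] p_X[OF w]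
    by (simp_all add: inner_add_right a b p21_eq w p22_eq inner_simps)
  have p0: "p1 w \<bullet> X w = 0" "p2 w \<bullet> Y w = 0" "p w \<bullet> X w = 0" "p w \<bullet> Y w = 0" "p2 w \<bullet> X w = 0" "p1 w \<bullet> Y w = 0"
    using p_X[OF w] p_Y[OF w] p1_X[OF w] p2_Y[OF w] X_p2[OF w] Y_p1[OF w] c[OF w] by (simp_all add: inner_commute)
  have "(2 * E w) * (\<alpha> w * (p11 w \<bullet> X w) + \<beta> w * (p11 w \<bullet> Y w)) = 0"
    "(2 * E w) * (\<alpha> w * (p11 w \<bullet> Y w) - \<beta> w * (p11 w \<bullet> X w)) = 0"
    using arg_cong[OF ricci[OF w], of "\<lambda>u. u \<bullet> X w"] arg_cong[OF ricci[OF w], of "\<lambda>u. u \<bullet> Y w"]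
    by (simp_all add: inner_simps xy p0 algebra_simps)
  then have eqs: "\<alpha> w * (p11 w \<bullet> X w) + \<beta> w * (p11 w \<bullet> Y w) = 0" "\<alpha> w * (p11 w \<bullet> Y w) - \<beta> w * (p11 w \<bullet> X w) = 0"
    using E_pos[OF w] by simp_all
  have "(\<alpha> w * \<alpha> w + \<beta> w * \<beta> w) * (p11 w \<bullet> X w) = 0" "(\<alpha> w * \<alpha> w + \<beta> w * \<beta> w) * (p11 w \<bullet> Y w) = 0"
    using eqs by algebra+
  then show "p11 w \<bullet> X w = 0" "p11 w \<bullet> Y w = 0" "p12 w \<bullet> X w = 0" "p12 w \<bullet> Y w = 0"
    using nz xy by (auto simp: sum_squares_eq_zero_iff)
qed

end

section \<open>Surfaces in a coassociative space\<close>

text \<open>By the conditions added here, \<open>p\<close> and its derivatives up to second order stay in the span of \<open>p\<close>,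
  \<open>p\<^sub>x\<close>, \<open>p\<^sub>y\<close>, \<open>N\<close>. Both directions of the theorem arrive at this situation.\<close>

locale coassociative_surface = parallel_surface +
  assumes p_h: "w \<in> S \<Longrightarrow> p w \<bullet> h w = 0"
    and p11_X: "w \<in> S \<Longrightarrow> p11 w \<bullet> X w = 0" and p11_Y: "w \<in> S \<Longrightarrow> p11 w \<bullet> Y w = 0"
    and p12_X: "w \<in> S \<Longrightarrow> p12 w \<bullet> X w = 0" and p12_Y: "w \<in> S \<Longrightarrow> p12 w \<bullet> Y w = 0"
begin

lemma coassociative_triple_at: "w \<in> S \<Longrightarrow> coassociative_triple (p w) (p1 w) (p2 w) (E w)"
  using orthogonal_triple_at orthogonal_triple_at_defs(1) p_h by (simp add: coassociative_triple_def coassociative_triple_axioms_def)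

context
  fixes w
  assumes w: "w \<in> S"
begin

interpretation t: coassociative_triple "p w" "p1 w" "p2 w" "E w"
  rewrites "orthogonal_triple.h (p1 w) (p2 w) (E w) = h w" and "orthogonal_triple.x (p w) (p1 w) = X w"
    and "orthogonal_triple.y (p w) (p2 w) = Y w" and "orthogonal_triple.n (p w) (p1 w) (p2 w) (E w) = N w"
  by (rule coassociative_triple_at[OF w]) (fact orthogonal_triple_at_defs[OF w])+

lemmas cframe = t.frame_inner
lemmas expansion = t.frame_expansion
lemmas coassociative_W = t.coassociative_W and W_def = t.W_def and W_perp_iff = t.W_perp_iff

end

lemma p11_eq:
  assumes w: "w \<in> S"
  shows "p11 w = - E w *\<^sub>R p w + (dird 1 E w / (2 * E w)) *\<^sub>R p1 w - (dird \<i> E w / (2 * E w)) *\<^sub>R p2 w + \<beta> w *\<^sub>R N w"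
  using expansion[OF w, of "p11 w"] p_p11[OF w] p1_p11[OF w] p2_p11[OF w] N_p11[OF w] p11_X[OF w] p11_Y[OF w]
    p11_h_eq[OF w] p_h[OF w]
  by (simp add: inner_commute)

lemma p12_eq:
  assumes w: "w \<in> S"
  shows "p12 w = (dird \<i> E w / (2 * E w)) *\<^sub>R p1 w + (dird 1 E w / (2 * E w)) *\<^sub>R p2 w - \<alpha> w *\<^sub>R N w"
  using expansion[OF w, of "p12 w"] p_p12[OF w] p1_p12[OF w] p2_p12[OF w] N_p12[OF w] p12_X[OF w] p12_Y[OF w]
    p12_h_eq[OF w] p_h[OF w]
  by (simp add: inner_commute)

text \<open>The components along \<open>X\<close> and \<open>Y\<close> vanish because those of \<open>p\<^sub>x\<^sub>x\<close> and \<open>p\<^sub>x\<^sub>y\<close> along \<open>h\<close> do, and the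
  component along \<open>h\<close> vanishes because \<open>h\<close> is parallel.\<close>

lemma N_deriv:
  assumes w: "w \<in> S"
  shows "dird v N w = ((p1 w \<bullet> dird v N w) / E w) *\<^sub>R p1 w + ((p2 w \<bullet> dird v N w) / E w) *\<^sub>R p2 w"
proof -
  have NN: "N w \<bullet> N w = 1" if "w \<in> S" for w using cframe[OF that] by simp
  have X: "dird v X w \<bullet> N w = 0" and Y: "dird v Y w \<bullet> N w = 0"
  proof -
    have u: "(p w \<times>\<^sub>7 u) \<bullet> N w = u \<bullet> h w" for u
      using p_h[OF w] unit_p[OF w] by (simp add: N_def inner_cross7_cross7)
    have 0: "p11 w \<bullet> h w = 0" "p12 w \<bullet> h w = 0" using p11_h_eq[OF w] p12_h_eq[OF w] p_h[OF w] by simp_all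
    have "dird 1 X w \<bullet> N w = 0" "dird \<i> X w \<bullet> N w = 0" "dird 1 Y w \<bullet> N w = 0" "dird \<i> Y w \<bullet> N w = 0"
      using h_N[OF w] by (simp_all add: X_x X_y Y_x Y_y w inner_simps u 0)
    then show "dird v X w \<bullet> N w = 0" "dird v Y w \<bullet> N w = 0"
      using dird_complex[OF diff_X[OF w], of v] dird_complex[OF diff_Y[OF w], of v] by (simp_all add: inner_simps)
  qed
  have h: "dird v h w \<bullet> N w = 0"
  proof -
    have "orthogonal (N w) u" if "u \<in> span {X w, Y w}" for u
      by (rule orthogonal_to_span[OF that]) (use X_N[OF w] Y_N[OF w] in \<open>auto simp: orthogonal_def inner_commute\<close>)
    then have "orthogonal (N w) (dird v h w)" using parallel[OF w] by blast
    then show ?thesis by (simp add: orthogonal_def inner_commute)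
  qed
  have p: "dird v p w \<bullet> N w = 0"
    using dird_complex[OF diff_p[OF w], of v] cframe[OF w] by (simp add: inner_simps)
  have "p w \<bullet> dird v N w = 0" "N w \<bullet> dird v N w = 0" "X w \<bullet> dird v N w = 0" "Y w \<bullet> dird v N w = 0" "h w \<bullet> dird v N w = 0"
    using dird_inner_const[OF open_S smooth_p smooth_N p_N w, of v]
      dird_inner_const[OF open_S smooth_N smooth_N NN w, of v]
      dird_inner_const[OF open_S smooth_X smooth_N X_N w, of v]
      dird_inner_const[OF open_S smooth_Y smooth_N Y_N w, of v]
      dird_inner_const[OF open_S smooth_h smooth_N h_N w, of v] p X Y h by (simp_all add: inner_commute)
  then show ?thesis using expansion[OF w, of "dird v N w"] by (simp add: inner_commute)
qed

lemma N_x: "w \<in> S \<Longrightarrow> dird 1 N w = (\<alpha> w / E w) *\<^sub>R p2 w - (\<beta> w / E w) *\<^sub>R p1 w"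
  and N_y: "w \<in> S \<Longrightarrow> dird \<i> N w = (\<alpha> w / E w) *\<^sub>R p1 w + (\<beta> w / E w) *\<^sub>R p2 w"
  using N_deriv[of w 1] N_deriv[of w \<i>] p1_N_x p1_N_y p2_N_x p2_N_y by simp_all

text \<open>The squared length of the projection of \<open>m\<close> to the span of the orthogonal vectors \<open>p\<close>, \<open>p\<^sub>x\<close>, \<open>p\<^sub>y\<close>,
  \<open>N\<close>. That it is constant for every \<open>m\<close> means that the span is constant.\<close>

definition "projection_sq m w = (m \<bullet> p w)\<^sup>2 + ((m \<bullet> p1 w)\<^sup>2 + (m \<bullet> p2 w)\<^sup>2) / E w + (m \<bullet> N w)\<^sup>2"

lemma smooth_projection_sq: "smooth_on S (projection_sq m)"
  unfolding projection_sq_def power2_eq_square divide_inverse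
  by (intro smooth_on_add smooth_on_mult smooth_on_inner smooth_on_inverse smooth_on_const open_S smooth_p smooth_p1 smooth_p2 smooth_p11 smooth_p12
      smooth_E smooth_N E_nz)

lemma dird_projection_sq:
  assumes w: "w \<in> S"
  shows "dird v (projection_sq m) w = 0"
proof -
  have L: "((\<lambda>w. m \<bullet> f w) has_derivative (\<lambda>v. m \<bullet> dird v f w)) (at w)"
    if "f differentiable (at w)" for f :: "complex \<Rightarrow> real ^ 7"
    by (intro has_derivative_inner_right dird_has_derivative that)
  have D: "dird v (projection_sq m) w = 2 * (m \<bullet> p w) * (m \<bullet> dird v p w)
     + (2 * (m \<bullet> p1 w) * (m \<bullet> dird v p1 w) + 2 * (m \<bullet> p2 w) * (m \<bullet> dird v p2 w)) / E w
     - ((m \<bullet> p1 w)\<^sup>2 + (m \<bullet> p2 w)\<^sup>2) * dird v E w / (E w)\<^sup>2 + 2 * (m \<bullet> N w) * (m \<bullet> dird v N w)" for v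
    unfolding projection_sq_def[abs_def] by (rule dird_eqI)
     (use E_nz[OF w] in \<open>auto intro!: derivative_eq_intros L dird_has_derivative diffs w simp: field_simps power2_eq_square\<close>)
  have 1: "dird 1 (projection_sq m) w = 0"
    unfolding D p21_eq[OF w] unfolding p11_eq[OF w] p12_eq[OF w] N_x[OF w]
    using E_nz[OF w] by (simp add: inner_simps field_simps power2_eq_square)
  have 2: "dird \<i> (projection_sq m) w = 0"
    unfolding D p22_eq[OF w] unfolding p11_eq[OF w] p12_eq[OF w] N_y[OF w]
    using E_nz[OF w] by (simp add: inner_simps field_simps power2_eq_square)
  show ?thesis
    using dird_complex[OF smooth_on_differentiable[OF smooth_projection_sq w], of v m] 1 2 by simp
qed

end

section \<open>Charts of a Riemann surface\<close>

abbreviation dom_of :: "'a chart \<Rightarrow> complex set" where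
  "dom_of c \<equiv> snd c ` fst c"

context riemann_surface
begin

lemma chart_facts:
  assumes "c \<in> A"
  shows "openin X (fst c)" "open (dom_of c)"
    "homeomorphic_map (subtopology X (fst c)) (top_of_set (dom_of c)) (snd c)" "inj_on (snd c) (fst c)"
    "fst c \<subseteq> topspace X"
proof -
  obtain U z where c: "c = (U, z)" by fastforce
  note cA = assms[unfolded c]
  show o: "openin X (fst c)" and "open (dom_of c)"
    and h: "homeomorphic_map (subtopology X (fst c)) (top_of_set (dom_of c)) (snd c)"
    using chart_open[OF cA] chart_image_open[OF cA] chart_homeo[OF cA] by (simp_all add: c)
  show "fst c \<subseteq> topspace X" using o by (rule openin_subset)
  then show "inj_on (snd c) (fst c)"
    using homeomorphic_imp_injective_map[OF h] by (simp add: inf.absorb2)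
qed

lemma chart_at: "p \<in> topspace X \<Longrightarrow> \<exists>c\<in>A. p \<in> fst c"
  unfolding covers[symmetric] by force

lemma open_chart_image:
  assumes "c \<in> A" "openin X V"
  shows "open (snd c ` (fst c \<inter> V))"
proof -
  have "openin (subtopology X (fst c)) (fst c \<inter> V)"
    using assms(2) by (auto simp: openin_subtopology_Int2)
  then have "openin (top_of_set (dom_of c)) (snd c ` (fst c \<inter> V))"
    using homeomorphic_imp_open_map[OF chart_facts(3)[OF assms(1)]] by (auto simp: open_map_def)
  then show ?thesis
    using chart_facts(2)[OF assms(1)] by (metis openin_open_eq)
qed

lemma open_chart_preimage:
  assumes "c \<in> A" "open T"
  shows "openin X {q \<in> fst c. snd c q \<in> T}"
proof -
  have "continuous_map (subtopology X (fst c)) (top_of_set (dom_of c)) (snd c)"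
    by (rule homeomorphic_imp_continuous_map[OF chart_facts(3)[OF assms(1)]])
  moreover have "openin (top_of_set (dom_of c)) (dom_of c \<inter> T)"
    using assms(2) by (simp add: openin_open_Int)
  ultimately have "openin (subtopology X (fst c)) {x \<in> topspace (subtopology X (fst c)). snd c x \<in> dom_of c \<inter> T}"
    by (rule openin_continuous_map_preimage)
  moreover have "{x \<in> topspace (subtopology X (fst c)). snd c x \<in> dom_of c \<inter> T} = {q \<in> fst c. snd c q \<in> T}"
    using chart_facts(5)[OF assms(1)] by auto
  ultimately show ?thesis
    using openin_trans_full[OF _ chart_facts(1)[OF assms(1)]] by metis
qed

lemma inv_chart [simp]: "c \<in> A \<Longrightarrow> p \<in> fst c \<Longrightarrow> inv_into (fst c) (snd c) (snd c p) = p"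
  using chart_facts(4) inv_into_f_f by metis

lemma local_rep_at [simp]: "c \<in> A \<Longrightarrow> p \<in> fst c \<Longrightarrow> local_rep c f (snd c p) = f p"
  by (simp add: local_rep_def)

lemma local_rep_cong:
  "c \<in> A \<Longrightarrow> w \<in> dom_of c \<Longrightarrow> (\<And>p. p \<in> fst c \<Longrightarrow> f p = g (snd c p)) \<Longrightarrow> local_rep c f w = g w"
  by (auto simp: local_rep_def)

lemma smooth_map_on_chart:
  assumes "c \<in> A" "smooth_map_on A (topspace X) f"
  shows "smooth_on (dom_of c) (local_rep c f)"
  using assms chart_facts(5)[OF assms(1)] by (auto simp: smooth_map_on_def inf.absorb1)

lemma smooth_map_onI:
  assumes "\<And>c. c \<in> A \<Longrightarrow> smooth_on (dom_of c) (local_rep c f)"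
  shows "smooth_map_on A V f"
  unfolding smooth_map_on_def by (intro ballI smooth_on_subset[OF assms]) auto

lemma smooth_map_on_differentiable:
  assumes "c \<in> A" "openin X V" "smooth_map_on A V f" "p \<in> V" "p \<in> fst c"
  shows "local_rep c f differentiable (at (snd c p))"
  using assms by (auto simp: smooth_map_on_def intro!: smooth_on_differentiable)

lemma dird_local_rep_cong:
  assumes "c \<in> A" "p \<in> fst c" "openin X V" "p \<in> V" "\<And>q. q \<in> V \<Longrightarrow> q \<in> fst c \<Longrightarrow> f q = g (snd c q)"
  shows "dird v (local_rep c f) (snd c p) = dird v g (snd c p)"
  by (rule dird_cong[OF open_chart_image[OF assms(1,3)]]) (use assms in auto)

abbreviation dir :: "2 \<Rightarrow> complex" where "dir i \<equiv> if i = 1 then 1 else \<i>"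

lemma pd_eq: "pd c i f p = dird (dir i) (local_rep c f) (snd c p)"
  by (simp add: pd_def coord_diff_def dird_def)

lemma pd_cong:
  assumes "c \<in> A" "p \<in> fst c" "\<And>q. q \<in> fst c \<Longrightarrow> f q = g (snd c q)"
  shows "pd c i f p = dird (dir i) g (snd c p)"
  unfolding pd_eq by (rule dird_local_rep_cong[OF assms(1,2) chart_facts(1)[OF assms(1)] assms(2)]) (use assms in auto)

lemma pd_pd:
  assumes "c \<in> A" "p \<in> fst c"
  shows "pd c i (pd c j f) p = dird (dir i) (dird (dir j) (local_rep c f)) (snd c p)"
  by (rule pd_cong[OF assms]) (rule pd_eq)

definition transition :: "'a chart \<Rightarrow> 'a chart \<Rightarrow> 'a \<Rightarrow> complex" where
  "transition c c' p = deriv (snd c' \<circ> inv_into (fst c) (snd c)) (snd c p)"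

lemma transition_deriv:
  assumes c: "c \<in> A" "c' \<in> A" and p: "p \<in> fst c" "p \<in> fst c'"
  shows "((snd c' \<circ> inv_into (fst c) (snd c)) has_field_derivative transition c c' p) (at (snd c p))"
proof -
  have "(snd c' \<circ> inv_into (fst c) (snd c)) holomorphic_on snd c ` (fst c \<inter> fst c')"
    using holomorphic_transitions[of "fst c" "snd c" "fst c'" "snd c'"] c by simp
  moreover have "open (snd c ` (fst c \<inter> fst c'))"
    by (rule open_chart_image[OF c(1) chart_facts(1)[OF c(2)]])
  ultimately show ?thesis
    unfolding transition_def using p by (auto intro!: holomorphic_derivI)
qed

lemma dird_transition:
  assumes c: "c \<in> A" "c' \<in> A" and p: "p \<in> fst c" "p \<in> fst c'"
    and d: "local_rep c' f differentiable (at (snd c' p))"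
  shows "dird v (local_rep c f) (snd c p) = dird (transition c c' p * v) (local_rep c' f) (snd c' p)"
proof -
  let ?\<tau> = "snd c' \<circ> inv_into (fst c) (snd c)"
  have "(?\<tau> has_derivative (\<lambda>v. transition c c' p * v)) (at (snd c p))"
    using transition_deriv[OF c p] by (simp add: has_field_derivative_def)
  moreover have "(local_rep c' f has_derivative (\<lambda>v. dird v (local_rep c' f) (snd c' p))) (at (?\<tau> (snd c p)))"
    using dird_has_derivative[OF d] c p by simp
  ultimately have "((\<lambda>w. local_rep c' f (?\<tau> w)) has_derivative
      (\<lambda>v. dird (transition c c' p * v) (local_rep c' f) (snd c' p))) (at (snd c p))"
    by (rule has_derivative_compose)
  then have "dird v (\<lambda>w. local_rep c' f (?\<tau> w)) (snd c p) = dird (transition c c' p * v) (local_rep c' f) (snd c' p)"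
    by (rule dird_eqI)
  moreover have "dird v (local_rep c f) (snd c p) = dird v (\<lambda>w. local_rep c' f (?\<tau> w)) (snd c p)"
    by (rule dird_local_rep_cong[OF c(1) p(1) chart_facts(1)[OF c(2)] p(2)]) (use c in auto)
  ultimately show ?thesis by simp
qed

lemma transition_nonzero:
  assumes c: "c \<in> A" "c' \<in> A" and p: "p \<in> fst c" "p \<in> fst c'"
  shows "transition c c' p \<noteq> 0"
proof -
  have id: "dird v (local_rep c (snd c)) (snd c p) = v" for v
  proof -
    have "dird v (local_rep c (snd c)) (snd c p) = dird v (\<lambda>w. w) (snd c p)"
      by (rule dird_local_rep_cong[OF c(1) p(1) chart_facts(1)[OF c(1)] p(1)]) simp
    also have "\<dots> = v" by (rule dird_eqI) (rule has_derivative_ident)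
    finally show ?thesis .
  qed
  have "local_rep c' (snd c) differentiable (at (snd c' p))"
    using transition_deriv[OF c(2,1) p(2,1)] by (auto simp: local_rep_def has_field_derivative_def differentiable_def)
  from dird_transition[OF c p this, of 1] id[of 1]
  have "dird (transition c c' p) (local_rep c' (snd c)) (snd c' p) = 1" by simp
  moreover have "dird 0 (local_rep c' (snd c)) (snd c' p) = 0"
    using dird_linear[OF \<open>local_rep c' (snd c) differentiable _\<close>] by (rule linear_0)
  ultimately show ?thesis by auto
qed

lemma dird_transition_real:
  assumes c: "c \<in> A" "c' \<in> A" and p: "p \<in> fst c" "p \<in> fst c'"
    and d: "local_rep c' f differentiable (at (snd c' p))"
  defines "r \<equiv> Re (transition c c' p)" and "s \<equiv> Im (transition c c' p)"
  shows "dird 1 (local_rep c f) (snd c p) = r *\<^sub>R dird 1 (local_rep c' f) (snd c' p) + s *\<^sub>R dird \<i> (local_rep c' f) (snd c' p)"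
    "dird \<i> (local_rep c f) (snd c p) = r *\<^sub>R dird \<i> (local_rep c' f) (snd c' p) - s *\<^sub>R dird 1 (local_rep c' f) (snd c' p)"
  unfolding dird_transition[OF c p d] dird_complex[OF d, of "transition c c' p * 1"]
    dird_complex[OF d, of "transition c c' p * \<i>"] by (simp_all add: r_def s_def)

lemma no_isolated_points: "\<not> openin X {p}"
proof
  assume o: "openin X {p}"
  then obtain c where c: "c \<in> A" "p \<in> fst c" using chart_at openin_subset by blast
  then have "open (snd c ` (fst c \<inter> {p}))" using o by (intro open_chart_image)
  moreover have "snd c ` (fst c \<inter> {p}) = {snd c p}" using c by auto
  ultimately show False using not_open_singleton by metis
qed

text \<open>Sets without accumulation points are small because a Riemann surface has no isolated points.\<close>

lemma exceptional_avoid: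
  assumes D: "X derived_set_of D = {}" and V: "openin X V" "V \<noteq> {}"
  shows "\<not> V \<subseteq> D"
proof
  assume VD: "V \<subseteq> D"
  obtain p where p: "p \<in> V" using V by blast
  then have "p \<in> topspace X" using V openin_subset by blast
  moreover have "p \<notin> X derived_set_of D" using D by simp
  ultimately obtain T where T: "p \<in> T" "openin X T" "\<not> (\<exists>y\<noteq>p. y \<in> D \<and> y \<in> T)"
    by (auto simp: in_derived_set_of)
  then have "T \<inter> V = {p}" using VD p by auto
  then show False using no_isolated_points openin_Int[OF T(2) V(1)] by metis
qed

lemma connected_locally_constant:
  assumes "\<And>p. p \<in> topspace X \<Longrightarrow> \<exists>V. openin X V \<and> p \<in> V \<and> (\<forall>q\<in>V. P q \<longleftrightarrow> P p)"
    and "p \<in> topspace X" "P p" "q \<in> topspace X"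
  shows "P q"
proof -
  let ?Z = "{p \<in> topspace X. P p}" and ?Y = "{p \<in> topspace X. \<not> P p}"
  have "openin X {p \<in> topspace X. Q p}"
    if Q: "\<And>p. p \<in> topspace X \<Longrightarrow> \<exists>V. openin X V \<and> p \<in> V \<and> (\<forall>q\<in>V. Q q \<longleftrightarrow> Q p)" for Q
  proof (rule openin_subopen[THEN iffD2], clarify)
    fix x assume x: "x \<in> topspace X" "Q x"
    obtain V where V: "openin X V" "x \<in> V" "\<forall>q\<in>V. Q q \<longleftrightarrow> Q x" using Q[OF x(1)] by blast
    then have "V \<subseteq> {p \<in> topspace X. Q p}" using x(2) openin_subset[OF V(1)] by auto
    then show "\<exists>T. openin X T \<and> x \<in> T \<and> T \<subseteq> {p \<in> topspace X. Q p}" using V by blast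
  qed
  from this[of P] this[of "\<lambda>p. \<not> P p"] have "openin X ?Z" "openin X ?Y"
    using assms(1) by simp_all
  moreover have "?Y = topspace X - ?Z" by auto
  ultimately have "closedin X ?Z" by (auto simp: closedin_def)
  then have "?Z = {} \<or> ?Z = topspace X"
    using connected \<open>openin X ?Z\<close> connected_space_clopen_in by blast
  then show ?thesis using assms by auto
qed

end

section \<open>The associated immersion\<close>

lemma normal_part_eqI:
  assumes "subspace T" "n \<in> T\<^sup>\<bottom>" "v - n \<in> T"
  shows "normal_part T v = n"
  unfolding normal_part_def
proof (rule the_equality)
  fix m assume m: "m \<in> T\<^sup>\<bottom> \<and> v - m \<in> T"
  have "(v - n) - (v - m) \<in> T" using m assms subspace_diff by blast
  moreover have "m - n \<in> T\<^sup>\<bottom>" using m assms subspace_orthogonal_comp subspace_diff by blast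
  ultimately have "m - n \<in> T \<inter> T\<^sup>\<bottom>" by simp
  then show "m = n" using orthogonal_Int_0[OF assms(1)] by auto
qed (use assms in auto)

lemma normal_part_eq_0_iff:
  fixes v :: "real ^ 'n"
  assumes "subspace T"
  shows "normal_part T v = 0 \<longleftrightarrow> v \<in> T"
proof
  assume "v \<in> T"
  then show "normal_part T v = 0"
    using assms by (intro normal_part_eqI) (auto simp: subspace_0 subspace_orthogonal_comp)
next
  assume z: "normal_part T v = 0"
  obtain a n where an: "v = a + n" "a \<in> T" "n \<in> T\<^sup>\<bottom>"
    using subspace_sum_orthogonal_comp[OF assms] by (metis UNIV_I set_plus_elim)
  then have "normal_part T v = n" by (intro normal_part_eqI) (use assms in auto)
  then show "v \<in> T" using an z by simp
qed

lemma normal_part_plane: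
  assumes "a \<bullet> a = e" "b \<bullet> b = e" "a \<bullet> b = 0" "e > 0"
  shows "normal_part (span {a, b}) v = v - (v \<bullet> a / e) *\<^sub>R a - (v \<bullet> b / e) *\<^sub>R b"
proof (rule normal_part_eqI)
  let ?n = "v - (v \<bullet> a / e) *\<^sub>R a - (v \<bullet> b / e) *\<^sub>R b"
  have "orthogonal ?n u" if "u \<in> span {a, b}" for u
    by (rule orthogonal_to_span[OF that])
      (use assms in \<open>auto simp: orthogonal_def inner_simps inner_commute[of b a]\<close>)
  then show "?n \<in> (span {a, b})\<^sup>\<bottom>" by (auto simp: orthogonal_comp_def orthogonal_commute)
  have "(v \<bullet> a / e) *\<^sub>R a + (v \<bullet> b / e) *\<^sub>R b \<in> span {a, b}"
    by (intro span_add span_scale span_base) auto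
  then show "v - ?n \<in> span {a, b}" by simp
qed simp

lemma matrix_inv_mat:
  fixes e :: real
  assumes "e \<noteq> 0"
  shows "matrix_inv (mat e :: real ^ 'n ^ 'n) $ i $ j = (if i = j then 1 / e else 0)"
proof -
  have mm: "((mat e :: real ^ 'n ^ 'n) ** B) $ i $ j = e * B $ i $ j" for B :: "real ^ 'n ^ 'n" and i j
    by (simp add: matrix_matrix_mult_def mat_def if_distrib[of "\<lambda>x. x * _"] cong: if_cong)
  have "(mat e :: real ^ 'n ^ 'n) ** mat (1/e) = mat 1 \<and> mat (1/e) ** (mat e :: real ^ 'n ^ 'n) = mat 1"
    using assms by (simp add: vec_eq_iff matrix_matrix_mult_def mat_def if_distrib[of "\<lambda>x. x * _"] cong: if_cong)
  then have "(mat e :: real ^ 'n ^ 'n) ** matrix_inv (mat e) = mat 1"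
    unfolding matrix_inv_def by (rule someI2) blast
  then have "e * matrix_inv (mat e :: real ^ 'n ^ 'n) $ i $ j = (mat 1 :: real ^ 'n ^ 'n) $ i $ j"
    using mm by metis
  then show ?thesis using assms by (auto simp: mat_def field_simps)
qed

locale associated_surface = riemann_surface X A for X :: "'a topology" and A :: "'a chart set" +
  fixes \<phi> F :: "'a \<Rightarrow> real ^ 7"
  assumes harm: "harmonic_into_sphere X A \<phi>" and conf: "conformal A \<phi>" and imm: "immersion X A \<phi>"
    and prim: "cross_star_primitive X A \<phi> F"
begin

abbreviation "lr c \<equiv> local_rep c \<phi>"

lemma smooth_\<phi>: "smooth_map_on A (topspace X) \<phi>" using imm by (simp add: immersion_def)

lemma sphere_\<phi>: "p \<in> topspace X \<Longrightarrow> \<phi> p \<bullet> \<phi> p = 1"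
  using harm unfolding harmonic_into_sphere_def by (auto simp: norm_eq_1 image_subset_iff)

lemma minimal_surface:
  assumes c: "c \<in> A"
  shows "minimal_surface (dom_of c) (lr c)"
proof
  show "open (dom_of c)" by (rule chart_facts(2)[OF c])
  show "smooth_on (dom_of c) (lr c)" by (rule smooth_map_on_chart[OF c smooth_\<phi>])
  fix w assume "w \<in> dom_of c"
  then obtain p where p: "p \<in> fst c" "w = snd c p" by auto
  have pX: "p \<in> topspace X" using p chart_facts(5)[OF c] by blast
  show "lr c w \<bullet> lr c w = 1" using sphere_\<phi>[OF pX] c p by simp
  have d: "lr c differentiable (at (snd c p))"
    using smooth_on_differentiable[OF smooth_map_on_chart[OF c smooth_\<phi>]] p by blast
  have "inj (coord_diff c \<phi> p)" using imm c p by (simp add: immersion_def)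
  then have "coord_diff c \<phi> p 1 \<noteq> coord_diff c \<phi> p 0" by (simp add: inj_eq)
  then show "dird 1 (lr c) w \<noteq> 0"
    using linear_0[OF dird_linear[OF d]] p by (simp add: coord_diff_def dird_def)
  have "norm (pd c 1 \<phi> p) = norm (pd c 2 \<phi> p)" "pd c 1 \<phi> p \<bullet> pd c 2 \<phi> p = 0"
    using conf c p unfolding conformal_def by blast+
  then show "dird \<i> (lr c) w \<bullet> dird \<i> (lr c) w = dird 1 (lr c) w \<bullet> dird 1 (lr c) w"
    "dird 1 (lr c) w \<bullet> dird \<i> (lr c) w = 0"
    using p by (simp_all add: pd_eq norm_eq)
  have "\<exists>k. pd c 1 (pd c 1 \<phi>) p + pd c 2 (pd c 2 \<phi>) p = k *\<^sub>R \<phi> p"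
    using harm c p unfolding harmonic_into_sphere_def Let_def by (metis eq_iff_diff_eq_0)
  then show "\<exists>k. dird 1 (dird 1 (lr c)) w + dird \<i> (dird \<i> (lr c)) w = k *\<^sub>R lr c w"
    using c p by (simp add: pd_pd)
qed

abbreviation "cE c \<equiv> minimal_surface.E (lr c)"
abbreviation "ch c \<equiv> minimal_surface.h (lr c)"
abbreviation "cX c \<equiv> minimal_surface.X (lr c)"
abbreviation "cY c \<equiv> minimal_surface.Y (lr c)"
abbreviation "cN c \<equiv> minimal_surface.N (lr c)"
abbreviation "c\<alpha> c \<equiv> minimal_surface.\<alpha> (lr c)"
abbreviation "c\<beta> c \<equiv> minimal_surface.\<beta> (lr c)"

lemma dird_F:
  assumes c: "c \<in> A" and w: "w \<in> dom_of c"
  shows "dird 1 (local_rep c F) w = cY c w" "dird \<i> (local_rep c F) w = - cX c w"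
    "local_rep c F differentiable (at w)"
proof -
  interpret m: minimal_surface "dom_of c" "lr c" by (rule minimal_surface[OF c])
  obtain p where p: "p \<in> fst c" "w = snd c p" using w by auto
  have "pd c 1 F p = \<phi> p \<times>\<^sub>7 pd c 2 \<phi> p" "pd c 2 F p = - (\<phi> p \<times>\<^sub>7 pd c 1 \<phi> p)"
    using prim c p unfolding cross_star_primitive_def by blast+
  then show "dird 1 (local_rep c F) w = cY c w" "dird \<i> (local_rep c F) w = - cX c w"
    using p c by (simp_all add: pd_eq m.X_def m.Y_def)
  have "smooth_map_on A (topspace X) F" using prim by (simp add: cross_star_primitive_def)
  from smooth_on_differentiable[OF smooth_map_on_chart[OF c this] w]
  show "local_rep c F differentiable (at w)" .
qed

lemma tangent_plane_F:
  assumes c: "c \<in> A" and p: "p \<in> fst c"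
  shows "tangent_plane c F p = span {cY c (snd c p), cX c (snd c p)}"
proof -
  let ?Y = "cY c (snd c p)" and ?X = "cX c (snd c p)"
  have w: "snd c p \<in> dom_of c" using p by blast
  have cd: "coord_diff c F p v = Re v *\<^sub>R ?Y - Im v *\<^sub>R ?X" for v
    using dird_complex[OF dird_F(3)[OF c w], of v] dird_F(1,2)[OF c w]
    by (simp add: coord_diff_def dird_def)
  show ?thesis
    unfolding tangent_plane_def
  proof
    show "range (coord_diff c F p) \<subseteq> span {?Y, ?X}"
    proof clarify
      fix v show "coord_diff c F p v \<in> span {?Y, ?X}"
        unfolding cd by (intro span_diff span_scale span_base) auto
    qed
    show "span {?Y, ?X} \<subseteq> range (coord_diff c F p)"
    proof
      fix u assume "u \<in> span {?Y, ?X}"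
      then obtain r s where "u = r *\<^sub>R ?Y + s *\<^sub>R ?X"
        by (auto simp: span_insert span_singleton algebra_simps)
      then have "u = coord_diff c F p (Complex r (- s))" by (simp add: cd)
      then show "u \<in> range (coord_diff c F p)" by blast
    qed
  qed
qed

lemma pd_pd_F:
  assumes c: "c \<in> A" and p: "p \<in> fst c"
  shows "pd c 1 (pd c 1 F) p = dird 1 (cY c) (snd c p)" "pd c 2 (pd c 2 F) p = - dird \<i> (cX c) (snd c p)"
    "pd c 2 (pd c 1 F) p = dird \<i> (cY c) (snd c p)" "pd c 1 (pd c 2 F) p = - dird 1 (cX c) (snd c p)"
proof -
  interpret m: minimal_surface "dom_of c" "lr c" by (rule minimal_surface[OF c])
  have w: "snd c p \<in> dom_of c" using p by blast
  note cong = dird_cong[OF m.open_S w]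
  have neg: "dird v (\<lambda>w. - m.X w) (snd c p) = - dird v m.X (snd c p)" for v
    by (rule dird_bounded_linear[OF bounded_linear_minus[OF bounded_linear_ident] m.diff_X[OF w]])
  show "pd c 1 (pd c 1 F) p = dird 1 (cY c) (snd c p)" "pd c 2 (pd c 1 F) p = dird \<i> (cY c) (snd c p)"
    using cong[of "dird 1 (local_rep c F)" m.Y] dird_F[OF c] by (simp_all add: pd_pd c p)
  show "pd c 2 (pd c 2 F) p = - dird \<i> (cX c) (snd c p)" "pd c 1 (pd c 2 F) p = - dird 1 (cX c) (snd c p)"
    using cong[of "dird \<i> (local_rep c F)" "\<lambda>w. - m.X w"] dird_F[OF c] neg by (simp_all add: pd_pd c p)
qed

lemma first_form_F:
  assumes c: "c \<in> A" and p: "p \<in> fst c"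
  shows "first_form c F p = mat (cE c (snd c p))"
proof -
  interpret m: minimal_surface "dom_of c" "lr c" by (rule minimal_surface[OF c])
  have w: "snd c p \<in> dom_of c" using p by blast
  have "\<forall>i j. first_form c F p $ i $ j = mat (m.E (snd c p)) $ i $ j"
    unfolding forall_2 using m.X_X[OF w] m.Y_Y[OF w] m.X_Y[OF w]
    by (simp add: first_form_def mat_def pd_eq dird_F[OF c w] inner_commute)
  then show ?thesis by (simp add: vec_eq_iff)
qed

lemma normal_part_F:
  assumes c: "c \<in> A" and p: "p \<in> fst c"
  shows "normal_part (tangent_plane c F p) v = v - (v \<bullet> cY c (snd c p) / cE c (snd c p)) *\<^sub>R cY c (snd c p)
    - (v \<bullet> cX c (snd c p) / cE c (snd c p)) *\<^sub>R cX c (snd c p)"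
proof -
  interpret m: minimal_surface "dom_of c" "lr c" by (rule minimal_surface[OF c])
  have w: "snd c p \<in> dom_of c" using p by blast
  show ?thesis
    unfolding tangent_plane_F[OF c p]
    by (rule normal_part_plane) (use m.X_X[OF w] m.Y_Y[OF w] m.X_Y[OF w] m.E_pos[OF w] in \<open>simp_all add: inner_commute\<close>)
qed

text \<open>In the sum of \<open>F\<^sub>x\<^sub>x\<close> and \<open>F\<^sub>y\<^sub>y\<close> the second derivatives of \<open>\<phi>\<close> cancel and \<open>2 \<phi>\<^sub>x \<times>\<^sub>7 \<phi>\<^sub>y\<close> remains, which is
  already normal to \<open>F\<close>.\<close>

lemma mean_curvature_F:
  assumes c: "c \<in> A" and p: "p \<in> fst c"
  shows "mean_curvature c F p = ch c (snd c p)"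
proof -
  interpret m: minimal_surface "dom_of c" "lr c" by (rule minimal_surface[OF c])
  have w: "snd c p \<in> dom_of c" using p by blast
  note E = m.E_pos[OF w]
  have lin: "normal_part (tangent_plane c F p) u + normal_part (tangent_plane c F p) v =
      normal_part (tangent_plane c F p) (u + v)" for u v
    unfolding normal_part_F[OF c p] by (simp add: inner_simps add_divide_distrib algebra_simps)
  have sum: "pd c 1 (pd c 1 F) p + pd c 2 (pd c 2 F) p = (2 * m.E (snd c p)) *\<^sub>R m.h (snd c p)"
    unfolding pd_pd_F[OF c p] m.X_y[OF w] m.Y_x[OF w] by (simp add: algebra_simps flip: scaleR_2)
  have perp: "m.h (snd c p) \<bullet> m.Y (snd c p) = 0" "m.h (snd c p) \<bullet> m.X (snd c p) = 0"
    using m.X_h[OF w] m.Y_h[OF w] by (simp_all add: inner_commute)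
  have "mean_curvature c F p = (1/2) *\<^sub>R ((1 / m.E (snd c p)) *\<^sub>R (second_form c F p $ 1 $ 1 + second_form c F p $ 2 $ 2))"
    using E by (simp add: mean_curvature_def first_form_F[OF c p] matrix_inv_mat sum_2 scaleR_add_right)
  also have "second_form c F p $ 1 $ 1 + second_form c F p $ 2 $ 2 = (2 * m.E (snd c p)) *\<^sub>R m.h (snd c p)"
    unfolding second_form_def vec_lambda_beta unfolding lin sum unfolding normal_part_F[OF c p]
    by (simp add: perp)
  finally show ?thesis using E by simp
qed

lemma second_form_F:
  assumes c: "c \<in> A" and p: "p \<in> fst c"
  shows "second_form c F p $ 1 $ 1 \<bullet> mean_curvature c F p = cE c (snd c p) + c\<alpha> c (snd c p)"
    "second_form c F p $ 2 $ 2 \<bullet> mean_curvature c F p = cE c (snd c p) - c\<alpha> c (snd c p)"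
    "second_form c F p $ 1 $ 2 \<bullet> mean_curvature c F p = c\<beta> c (snd c p)"
    "second_form c F p $ 2 $ 1 \<bullet> mean_curvature c F p = c\<beta> c (snd c p)"
proof -
  interpret m: minimal_surface "dom_of c" "lr c" by (rule minimal_surface[OF c])
  have w: "snd c p \<in> dom_of c" using p by blast
  have perp: "m.Y (snd c p) \<bullet> m.h (snd c p) = 0" "m.X (snd c p) \<bullet> m.h (snd c p) = 0"
    "m.h (snd c p) \<bullet> m.h (snd c p) = 1"
    using m.h_h[OF w] m.X_h[OF w] m.Y_h[OF w] by (simp_all add: inner_commute)
  have II: "second_form c F p $ i $ j \<bullet> mean_curvature c F p = pd c i (pd c j F) p \<bullet> m.h (snd c p)" for i j
    by (simp add: second_form_def mean_curvature_F[OF c p] normal_part_F[OF c p] inner_simps perp)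
  show "second_form c F p $ 1 $ 1 \<bullet> mean_curvature c F p = cE c (snd c p) + c\<alpha> c (snd c p)"
    "second_form c F p $ 2 $ 2 \<bullet> mean_curvature c F p = cE c (snd c p) - c\<alpha> c (snd c p)"
    "second_form c F p $ 1 $ 2 \<bullet> mean_curvature c F p = c\<beta> c (snd c p)"
    "second_form c F p $ 2 $ 1 \<bullet> mean_curvature c F p = c\<beta> c (snd c p)"
    unfolding II pd_pd_F[OF c p] m.X_x[OF w] m.X_y[OF w] m.Y_x[OF w] m.Y_y[OF w]
    by (simp_all add: inner_simps perp m.\<alpha>_def m.\<beta>_def)
qed

text \<open>The points where the second fundamental form in the direction of the mean curvature vector is a
  multiple of the first one; by \<open>umbilic_iff\<close> below, one chart decides.\<close>

definition umbilic :: "'a \<Rightarrow> bool" where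
  "umbilic p \<longleftrightarrow> (\<forall>c\<in>A. p \<in> fst c \<longrightarrow> c\<alpha> c (snd c p) = 0 \<and> c\<beta> c (snd c p) = 0)"

text \<open>The trace of the condition forces \<open>\<lambda> = 1\<close>, since the mean curvature vector has length 1.\<close>

lemma pseudo_umbilical_iff: "pseudo_umbilical X A F \<longleftrightarrow> (\<forall>p\<in>topspace X. umbilic p)"
proof
  assume "pseudo_umbilical X A F"
  then obtain l where l: "\<And>c p i j. c \<in> A \<Longrightarrow> p \<in> fst c \<Longrightarrow>
        second_form c F p $ i $ j \<bullet> mean_curvature c F p = l p * first_form c F p $ i $ j"
    unfolding pseudo_umbilical_def by blast
  have "c\<alpha> c (snd c p) = 0 \<and> c\<beta> c (snd c p) = 0" if c: "c \<in> A" "p \<in> fst c" for c p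
    using l[OF c, of 1 1] l[OF c, of 2 2] l[OF c, of 1 2]
    unfolding second_form_F[OF c] first_form_F[OF c] by (simp add: mat_def)
  then show "\<forall>p\<in>topspace X. umbilic p" by (simp add: umbilic_def)
next
  assume u: "\<forall>p\<in>topspace X. umbilic p"
  have "second_form c F p $ i $ j \<bullet> mean_curvature c F p = 1 * first_form c F p $ i $ j"
    if c: "c \<in> A" "p \<in> fst c" for c p i j
  proof -
    have "umbilic p" using u c chart_facts(5) by blast
    then have z: "c\<alpha> c (snd c p) = 0" "c\<beta> c (snd c p) = 0" using c by (auto simp: umbilic_def)
    have "\<forall>i j. second_form c F p $ i $ j \<bullet> mean_curvature c F p = 1 * first_form c F p $ i $ j"
      unfolding forall_2 second_form_F[OF c] first_form_F[OF c] by (simp add: mat_def z)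
    then show ?thesis by blast
  qed
  moreover have "smooth_map_on A (topspace X) (\<lambda>_. 1 :: real)"
    unfolding smooth_map_on_def local_rep_def comp_def by (auto intro: smooth_on_const)
  ultimately show "pseudo_umbilical X A F"
    unfolding pseudo_umbilical_def by (intro exI[of _ "\<lambda>_. 1"]) blast
qed

lemma parallel_iff: "parallel_mean_curvature A F \<longleftrightarrow> (\<forall>c\<in>A. parallel_surface (dom_of c) (lr c))"
proof -
  have "(\<forall>p\<in>fst c. \<forall>i. normal_part (tangent_plane c F p) (pd c i (mean_curvature c F) p) = 0) \<longleftrightarrow>
      parallel_surface (dom_of c) (lr c)" if c: "c \<in> A" for c
  proof -
    interpret m: minimal_surface "dom_of c" "lr c" by (rule minimal_surface[OF c])
    have "(\<forall>i. normal_part (tangent_plane c F p) (pd c i (mean_curvature c F) p) = 0) \<longleftrightarrow>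
        (\<forall>v. dird v m.h (snd c p) \<in> span {m.X (snd c p), m.Y (snd c p)})" if p: "p \<in> fst c" for p
    proof -
      have w: "snd c p \<in> dom_of c" using p by blast
      have pd: "pd c i (mean_curvature c F) p = dird (dir i) m.h (snd c p)" for i
        by (rule pd_cong[OF c p]) (rule mean_curvature_F[OF c])
      have "(\<forall>i. normal_part (tangent_plane c F p) (pd c i (mean_curvature c F) p) = 0) \<longleftrightarrow>
          dird 1 m.h (snd c p) \<in> span {m.X (snd c p), m.Y (snd c p)} \<and> dird \<i> m.h (snd c p) \<in> span {m.X (snd c p), m.Y (snd c p)}"
        unfolding tangent_plane_F[OF c p] normal_part_eq_0_iff[OF subspace_span] forall_2 pd
        by (simp add: insert_commute)
      also have "\<dots> \<longleftrightarrow> (\<forall>v. dird v m.h (snd c p) \<in> span {m.X (snd c p), m.Y (snd c p)})"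
        using dird_complex[OF m.diff_h[OF w]] by (metis span_add span_scale)
      finally show ?thesis .
    qed
    then show ?thesis
      by (auto simp: parallel_surface_def parallel_surface_axioms_def m.minimal_surface_axioms)
  qed
  then show ?thesis unfolding parallel_mean_curvature_def by blast
qed

end

section \<open>Umbilic points are isolated\<close>

lemma holomorphic_from_Cauchy_Riemann:
  fixes a b :: "complex \<Rightarrow> real"
  assumes "\<And>w. w \<in> S \<Longrightarrow> a differentiable (at w)" "\<And>w. w \<in> S \<Longrightarrow> b differentiable (at w)"
    and "\<And>w. w \<in> S \<Longrightarrow> dird 1 a w = - dird \<i> b w" "\<And>w. w \<in> S \<Longrightarrow> dird \<i> a w = dird 1 b w"
  shows "(\<lambda>w. of_real (a w) - \<i> * of_real (b w)) holomorphic_on S"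
proof (rule holomorphic_onI)
  fix w assume w: "w \<in> S"
  let ?D = "complex_of_real (dird 1 a w) - \<i> * of_real (dird 1 b w)"
  have "((\<lambda>w. of_real (a w) - \<i> * of_real (b w)) has_derivative
      (\<lambda>v. of_real (dird v a w) - \<i> * of_real (dird v b w))) (at w)"
    by (auto intro!: derivative_eq_intros dird_has_derivative assms w)
  moreover have "(\<lambda>v. of_real (dird v a w) - \<i> * of_real (dird v b w)) = (*) ?D"
  proof
    fix v
    have "dird v a w = Re v * dird 1 a w + Im v * dird 1 b w" "dird v b w = Re v * dird 1 b w - Im v * dird 1 a w"
      using dird_complex[OF assms(1)[OF w], of v] dird_complex[OF assms(2)[OF w], of v] assms(3,4)[OF w] by simp_all
    then show "of_real (dird v a w) - \<i> * of_real (dird v b w) = ?D * v"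
      by (simp only:) (simp add: complex_eq_iff mult.commute)
  qed
  ultimately have "((\<lambda>w. of_real (a w) - \<i> * of_real (b w)) has_field_derivative ?D) (at w)"
    unfolding has_field_derivative_def by (simp only:)
  then show "(\<lambda>w. of_real (a w) - \<i> * of_real (b w)) field_differentiable (at w within S)"
    using field_differentiable_at_within field_differentiable_def by blast
qed

context associated_surface
begin

lemma chart_change:
  assumes c: "c \<in> A" "c' \<in> A" and p: "p \<in> fst c" "p \<in> fst c'"
  obtains r s where "r\<^sup>2 + s\<^sup>2 > 0"
    "dird 1 (lr c) (snd c p) = r *\<^sub>R dird 1 (lr c') (snd c' p) + s *\<^sub>R dird \<i> (lr c') (snd c' p)"
    "dird \<i> (lr c) (snd c p) = r *\<^sub>R dird \<i> (lr c') (snd c' p) - s *\<^sub>R dird 1 (lr c') (snd c' p)"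
proof -
  let ?t = "transition c c' p"
  have "lr c' differentiable (at (snd c' p))"
    using smooth_on_differentiable[OF smooth_map_on_chart[OF c(2) smooth_\<phi>]] p by blast
  note change = dird_transition_real[OF c p this]
  have "(Re ?t)\<^sup>2 + (Im ?t)\<^sup>2 > 0"
    using transition_nonzero[OF c p] by (simp add: complex_neq_0)
  then show thesis by (rule that) (use change in simp_all)
qed

lemma conformal_factor_chart_change:
  assumes c: "c \<in> A" "c' \<in> A" and p: "p \<in> fst c" "p \<in> fst c'"
    and rs: "dird 1 (lr c) (snd c p) = r *\<^sub>R dird 1 (lr c') (snd c' p) + s *\<^sub>R dird \<i> (lr c') (snd c' p)"
  shows "cE c (snd c p) = (r\<^sup>2 + s\<^sup>2) * cE c' (snd c' p)"
proof -
  interpret m: minimal_surface "dom_of c" "lr c" by (rule minimal_surface[OF c(1)])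
  interpret m': minimal_surface "dom_of c'" "lr c'" by (rule minimal_surface[OF c(2)])
  have w': "snd c' p \<in> dom_of c'" using p by blast
  have "m.E (snd c p) = m.p1 (snd c p) \<bullet> m.p1 (snd c p)" by (simp add: m.E_def)
  then show ?thesis
    unfolding rs using m'.p_p1[OF w'] m'.p_p2[OF w'] m'.p1_p2[OF w'] m'.conformal_norm[OF w'] m'.conformal_orth[OF w']
      inner_commute[of "m'.p2 (snd c' p)" "m'.p1 (snd c' p)"]
    by (simp add: inner_simps m'.E_def power2_eq_square algebra_simps)
qed

text \<open>A conformal change of coordinates multiplies \<open>\<phi>\<^sub>x \<times>\<^sub>7 \<phi>\<^sub>y\<close> and \<open>E\<close> by the same factor.\<close>

lemma mean_curvature_chart_change:
  assumes c: "c \<in> A" "c' \<in> A" and p: "p \<in> fst c" "p \<in> fst c'"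
  shows "ch c (snd c p) = ch c' (snd c' p)"
proof -
  interpret m: minimal_surface "dom_of c" "lr c" by (rule minimal_surface[OF c(1)])
  interpret m': minimal_surface "dom_of c'" "lr c'" by (rule minimal_surface[OF c(2)])
  have w': "snd c' p \<in> dom_of c'" using p by blast
  obtain r s where rs: "r\<^sup>2 + s\<^sup>2 > 0"
    "m.p1 (snd c p) = r *\<^sub>R m'.p1 (snd c' p) + s *\<^sub>R m'.p2 (snd c' p)"
    "m.p2 (snd c p) = r *\<^sub>R m'.p2 (snd c' p) - s *\<^sub>R m'.p1 (snd c' p)"
    by (rule chart_change[OF c p])
  note E = conformal_factor_chart_change[OF c p rs(2)]
  have a: "m'.p2 (snd c' p) \<times>\<^sub>7 m'.p1 (snd c' p) = - (m'.p1 (snd c' p) \<times>\<^sub>7 m'.p2 (snd c' p))"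
    by (rule cross7_antisym)
  have "m.p1 (snd c p) \<times>\<^sub>7 m.p2 (snd c p) = (r\<^sup>2 + s\<^sup>2) *\<^sub>R (m'.p1 (snd c' p) \<times>\<^sub>7 m'.p2 (snd c' p))"
    unfolding rs(2,3) by (simp add: cross7_simps a algebra_simps power2_eq_square)
  then show ?thesis
    unfolding m.h_def m'.h_def E using rs(1) less_imp_neq[OF rs(1), symmetric] by simp
qed

definition mean_curvature_field :: "'a \<Rightarrow> real ^ 7" where
  "mean_curvature_field p = (let c = SOME c. c \<in> A \<and> p \<in> fst c in ch c (snd c p))"

lemma mean_curvature_field_eq: "c \<in> A \<Longrightarrow> p \<in> fst c \<Longrightarrow> mean_curvature_field p = ch c (snd c p)"
  unfolding mean_curvature_field_def Let_def
  by (rule someI2[of "\<lambda>c. c \<in> A \<and> p \<in> fst c" c]) (auto intro: mean_curvature_chart_change)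

text \<open>If \<open>\<phi>\<close> takes values in a coassociative space, this is its unit normal in the 3-sphere of that space.\<close>

definition \<nu> :: "'a \<Rightarrow> real ^ 7" where
  "\<nu> p = \<phi> p \<times>\<^sub>7 mean_curvature_field p"

lemma \<nu>_eq:
  assumes "c \<in> A" "p \<in> fst c"
  shows "\<nu> p = cN c (snd c p)"
proof -
  interpret m: minimal_surface "dom_of c" "lr c" by (rule minimal_surface[OF assms(1)])
  show ?thesis using assms by (simp add: \<nu>_def m.N_def mean_curvature_field_eq)
qed

lemma local_rep_\<nu>: "c \<in> A \<Longrightarrow> w \<in> dom_of c \<Longrightarrow> local_rep c \<nu> w = cN c w"
  by (rule local_rep_cong) (simp_all add: \<nu>_eq)

lemma dird_\<nu>: "c \<in> A \<Longrightarrow> w \<in> dom_of c \<Longrightarrow> dird v (local_rep c \<nu>) w = dird v (cN c) w"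
  by (rule dird_cong[OF chart_facts(2)]) (assumption | rule local_rep_\<nu>)+

lemma differentiable_\<nu>:
  assumes "c \<in> A" "w \<in> dom_of c"
  shows "local_rep c \<nu> differentiable (at w)"
  by (rule differentiable_cong_open[OF chart_facts(2)[OF assms(1)] assms(2) local_rep_\<nu>[OF assms(1), symmetric]
        minimal_surface.diff_N[OF minimal_surface[OF assms(1)] assms(2)]])

text \<open>The right hand side is the vanishing of a bilinear form that is obtained from two globally defined
  maps; this is independent of the chart.\<close>

lemma shape_zero_iff:
  assumes c: "c \<in> A" and p: "p \<in> fst c"
  shows "c\<alpha> c (snd c p) = 0 \<and> c\<beta> c (snd c p) = 0 \<longleftrightarrow>
    (\<forall>v u. dird v (lr c) (snd c p) \<bullet> dird u (local_rep c \<nu>) (snd c p) = 0)"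
proof -
  interpret m: minimal_surface "dom_of c" "lr c" by (rule minimal_surface[OF c])
  have w: "snd c p \<in> dom_of c" using p by blast
  note k = m.p1_N_x[OF w] m.p1_N_y[OF w] m.p2_N_x[OF w] m.p2_N_y[OF w]
  have eq: "dird v (lr c) (snd c p) \<bullet> dird u (local_rep c \<nu>) (snd c p) =
      Re v * (Im u * m.\<alpha> (snd c p) - Re u * m.\<beta> (snd c p)) + Im v * (Re u * m.\<alpha> (snd c p) + Im u * m.\<beta> (snd c p))" for v u
    unfolding dird_\<nu>[OF c w] dird_complex[OF m.diff_p[OF w], of v] dird_complex[OF m.diff_N[OF w], of u]
    by (simp add: inner_simps k algebra_simps)
  show ?thesis
  proof
    assume "\<forall>v u. dird v (lr c) (snd c p) \<bullet> dird u (local_rep c \<nu>) (snd c p) = 0"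
    then show "m.\<alpha> (snd c p) = 0 \<and> m.\<beta> (snd c p) = 0"
      using eq[of 1 1] eq[of 1 \<i>] by simp
  qed (simp add: eq)
qed

lemma umbilic_iff:
  assumes c: "c \<in> A" and p: "p \<in> fst c"
  shows "umbilic p \<longleftrightarrow> c\<alpha> c (snd c p) = 0 \<and> c\<beta> c (snd c p) = 0"
proof
  assume z: "c\<alpha> c (snd c p) = 0 \<and> c\<beta> c (snd c p) = 0"
  show "umbilic p"
    unfolding umbilic_def
  proof (intro ballI impI)
    fix c' assume c': "c' \<in> A" "p \<in> fst c'"
    have w: "snd c p \<in> dom_of c" using p by blast
    have "dird v (lr c') (snd c' p) \<bullet> dird u (local_rep c' \<nu>) (snd c' p) = 0" for v u
      unfolding dird_transition[OF c'(1) c c'(2) p differentiable_\<nu>[OF c w]]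
        dird_transition[OF c'(1) c c'(2) p smooth_on_differentiable[OF smooth_map_on_chart[OF c smooth_\<phi>] w]]
      using z shape_zero_iff[OF c p] by blast
    then show "c\<alpha> c' (snd c' p) = 0 \<and> c\<beta> c' (snd c' p) = 0" using shape_zero_iff[OF c'] by blast
  qed
qed (use c p in \<open>auto simp: umbilic_def\<close>)

text \<open>The identity theorem for the holomorphic function \<open>\<alpha> - \<i> \<beta>\<close>.\<close>

lemma umbilic_isolated_or_open:
  assumes par: "\<forall>c\<in>A. parallel_surface (dom_of c) (lr c)" and p: "p \<in> topspace X"
  shows "\<exists>V. openin X V \<and> p \<in> V \<and> ((\<forall>q\<in>V. umbilic q) \<or> (\<forall>q\<in>V. umbilic q \<longrightarrow> q = p))"
proof -
  obtain c where c: "c \<in> A" "p \<in> fst c" using chart_at[OF p] by blast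
  interpret m: parallel_surface "dom_of c" "lr c" using par c by blast
  define Q where "Q w = complex_of_real (m.\<alpha> w) - \<i> * of_real (m.\<beta> w)" for w
  have umb: "umbilic q \<longleftrightarrow> Q (snd c q) = 0" if "q \<in> fst c" for q
    using umbilic_iff[OF c(1) that] by (simp add: Q_def complex_eq_iff)
  have hol: "Q holomorphic_on dom_of c"
    unfolding Q_def[abs_def]
    by (rule holomorphic_from_Cauchy_Riemann) (fact m.diffs m.codazzi)+
  obtain e where e: "e > 0" "ball (snd c p) e \<subseteq> dom_of c"
    using m.open_S c(2) openE by blast
  have holb: "Q holomorphic_on ball (snd c p) e" by (rule holomorphic_on_subset[OF hol e(2)])
  have inj: "q = p" if "q \<in> fst c" "snd c q = snd c p" for q
    using inj_onD[OF chart_facts(4)[OF c(1)]] that c by blast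
  have nbhd: "openin X {q \<in> fst c. snd c q \<in> ball (snd c p) r}" for r
    by (rule open_chart_preimage[OF c(1) open_ball])
  show ?thesis
  proof (cases "\<forall>w\<in>ball (snd c p) e. Q w = 0")
    case True
    then show ?thesis using nbhd[of e] e c umb by (intro exI[of _ "{q \<in> fst c. snd c q \<in> ball (snd c p) e}"]) auto
  next
    case False
    then obtain b where b: "b \<in> ball (snd c p) e" "Q b \<noteq> 0" by blast
    have "\<exists>r>0. \<forall>w\<in>ball (snd c p) r - {snd c p}. Q w \<noteq> 0"
    proof (cases "Q (snd c p) = 0")
      case True
      then obtain r where "0 < r" "\<And>w. w \<in> ball (snd c p) r - {snd c p} \<Longrightarrow> Q w \<noteq> 0"
        using isolated_zeros[OF holb open_ball connected_ball _ _ b] e(1) by (metis centre_in_ball)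
      then show ?thesis by blast
    next
      case nz: False
      have "isCont Q (snd c p)"
        using holomorphic_on_imp_continuous_on[OF holb] e(1) by (simp add: continuous_on_eq_continuous_at)
      from continuous_at_avoid[OF this nz] show ?thesis by (auto simp: dist_commute)
    qed
    then obtain r where r: "r > 0" "\<forall>w\<in>ball (snd c p) r - {snd c p}. Q w \<noteq> 0" by blast
    then show ?thesis
      using nbhd[of r] c umb inj
      by (intro exI[of _ "{q \<in> fst c. snd c q \<in> ball (snd c p) r}"]) auto
  qed
qed

text \<open>The points with a neighbourhood of umbilics form a set which is open and, by
  \<open>umbilic_isolated_or_open\<close>, has an open complement.\<close>

lemma umbilics_isolated:
  assumes par: "\<forall>c\<in>A. parallel_surface (dom_of c) (lr c)"
    and p0: "p0 \<in> topspace X" "\<not> umbilic p0"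
  shows "X derived_set_of {p \<in> topspace X. umbilic p} = {}"
proof -
  define Z where "Z p \<longleftrightarrow> (\<exists>V. openin X V \<and> p \<in> V \<and> (\<forall>q\<in>V. umbilic q))" for p
  have punctured: "\<exists>V. openin X V \<and> p \<in> V \<and> (\<forall>q\<in>V. umbilic q \<longrightarrow> q = p)" if "p \<in> topspace X" "\<not> Z p" for p
    using umbilic_isolated_or_open[OF par that(1)] that(2) unfolding Z_def by blast
  have lc: "\<exists>V. openin X V \<and> p \<in> V \<and> (\<forall>q\<in>V. \<not> Z q \<longleftrightarrow> \<not> Z p)" if p: "p \<in> topspace X" for p
  proof (cases "Z p")
    case True
    then show ?thesis unfolding Z_def by blast
  next
    case False
    obtain V where V: "openin X V" "p \<in> V" "\<forall>q\<in>V. umbilic q \<longrightarrow> q = p" using punctured[OF p False] by blast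
    have "\<not> Z q" if q: "q \<in> V" for q
    proof
      assume "Z q"
      then obtain T where T: "openin X T" "q \<in> T" "\<forall>q\<in>T. umbilic q" unfolding Z_def by blast
      then have "T \<inter> V = {p}" using V q by auto
      then show False using no_isolated_points openin_Int[OF T(1) V(1)] by metis
    qed
    then show ?thesis using V False by blast
  qed
  have "\<not> Z p0" using p0 unfolding Z_def by blast
  then have nZ: "\<not> Z p" if "p \<in> topspace X" for p
    using connected_locally_constant[of "\<lambda>p. \<not> Z p", OF lc p0(1) _ that] by blast
  show ?thesis
  proof (rule equals0I)
    fix p assume d: "p \<in> X derived_set_of {p \<in> topspace X. umbilic p}"
    then have p: "p \<in> topspace X" by (simp add: in_derived_set_of)
    then obtain V where "openin X V" "p \<in> V" "\<forall>q\<in>V. umbilic q \<longrightarrow> q = p" using punctured nZ by blast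
    with d show False by (auto simp: in_derived_set_of)
  qed
qed

lemma zero_by_density:
  fixes g :: "complex \<Rightarrow> real"
  assumes D: "X derived_set_of {p \<in> topspace X. umbilic p} = {}"
    and c: "c \<in> A" and cont: "continuous_on (dom_of c) g"
    and g: "\<And>p. p \<in> fst c \<Longrightarrow> \<not> umbilic p \<Longrightarrow> g (snd c p) = 0" and w: "w \<in> dom_of c"
  shows "g w = 0"
proof (rule ccontr)
  assume nz: "g w \<noteq> 0"
  have "{w \<in> dom_of c. g w \<noteq> 0} = dom_of c \<inter> g -` (- {0})" by auto
  then have "open {w \<in> dom_of c. g w \<noteq> 0}"
    using continuous_open_preimage[OF cont chart_facts(2)[OF c], of "- {0}"] by (simp only:) auto
  then have "openin X {q \<in> fst c. snd c q \<in> {w \<in> dom_of c. g w \<noteq> 0}}"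
    by (rule open_chart_preimage[OF c])
  moreover have "{q \<in> fst c. snd c q \<in> {w \<in> dom_of c. g w \<noteq> 0}} \<noteq> {}" using nz w by auto
  moreover have "{q \<in> fst c. snd c q \<in> {w \<in> dom_of c. g w \<noteq> 0}} \<subseteq> {p \<in> topspace X. umbilic p}"
    using g chart_facts(5)[OF c] by auto
  ultimately show False using exceptional_avoid[OF D] by blast
qed

section \<open>The coassociative space\<close>

text \<open>The pointwise statements of \<open>parallel_surface\<close> at points that are not umbilic extend to the umbilics
  by continuity.\<close>

proposition coassociative_surface_if_parallel:
  assumes par: "\<forall>c\<in>A. parallel_surface (dom_of c) (lr c)"
    and D: "X derived_set_of {p \<in> topspace X. umbilic p} = {}" and c: "c \<in> A"
  shows "coassociative_surface (dom_of c) (lr c)"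
proof -
  interpret m: parallel_surface "dom_of c" "lr c" using par c by blast
  note zero = zero_by_density[OF D c smooth_on_continuous]
  note sm = smooth_on_inner[OF m.open_S]
  have c0: "lr c w \<bullet> m.h w = 0" if "w \<in> dom_of c" for w
    by (rule zero[OF sm[OF m.smooth_p m.smooth_h] _ that])
      (use umbilic_iff[OF c] m.totally_real_where_not_umbilic in blast)
  have second: "m.p11 (snd c p) \<bullet> m.X (snd c p) = 0" "m.p11 (snd c p) \<bullet> m.Y (snd c p) = 0"
    "m.p12 (snd c p) \<bullet> m.X (snd c p) = 0" "m.p12 (snd c p) \<bullet> m.Y (snd c p) = 0"
    if "p \<in> fst c" "\<not> umbilic p" for p
    using m.second_derivatives_where_not_umbilic[OF c0, of "snd c p"] umbilic_iff[OF c that(1)] that by auto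
  show ?thesis
  proof
    fix w assume w: "w \<in> dom_of c"
    show "lr c w \<bullet> m.h w = 0" by (rule c0[OF w])
    show "m.p11 w \<bullet> m.X w = 0" "m.p11 w \<bullet> m.Y w = 0" "m.p12 w \<bullet> m.X w = 0" "m.p12 w \<bullet> m.Y w = 0"
      by (rule zero[OF sm _ w], fact m.smooths, fact m.smooths, fact second)+
  qed
qed

lemma projection_sq_chart_change:
  assumes c: "c \<in> A" "c' \<in> A" and p: "p \<in> fst c" "p \<in> fst c'"
    and m: "coassociative_surface (dom_of c) (lr c)" "coassociative_surface (dom_of c') (lr c')"
  shows "coassociative_surface.projection_sq (lr c) n (snd c p) = coassociative_surface.projection_sq (lr c') n (snd c' p)"
proof -
  interpret m: coassociative_surface "dom_of c" "lr c" by (rule m)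
  interpret m': coassociative_surface "dom_of c'" "lr c'" by (rule m)
  have w': "snd c' p \<in> dom_of c'" using p by blast
  obtain r s where rs: "r\<^sup>2 + s\<^sup>2 > 0"
    "m.p1 (snd c p) = r *\<^sub>R m'.p1 (snd c' p) + s *\<^sub>R m'.p2 (snd c' p)"
    "m.p2 (snd c p) = r *\<^sub>R m'.p2 (snd c' p) - s *\<^sub>R m'.p1 (snd c' p)"
    by (rule chart_change[OF c p])
  note E = conformal_factor_chart_change[OF c p rs(2)]
  have "(n \<bullet> m.p1 (snd c p))\<^sup>2 + (n \<bullet> m.p2 (snd c p))\<^sup>2
      = (r\<^sup>2 + s\<^sup>2) * ((n \<bullet> m'.p1 (snd c' p))\<^sup>2 + (n \<bullet> m'.p2 (snd c' p))\<^sup>2)"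
    unfolding rs(2,3) by (simp add: inner_simps power2_eq_square algebra_simps)
  moreover have "m.N (snd c p) = m'.N (snd c' p)" using \<nu>_eq c p by metis
  ultimately show ?thesis
    unfolding m.projection_sq_def m'.projection_sq_def E using rs(1) c p by auto
qed

text \<open>The space \<open>W\<close> is the span of \<open>\<phi>\<close>, \<open>\<phi>\<^sub>x\<close>, \<open>\<phi>\<^sub>y\<close>, \<open>\<nu>\<close> at one point. A vector orthogonal to it has projection 0
  to that span near every point, since the length of the projection is locally constant and does not
  depend on the chart.\<close>

proposition contained_in_coassociative:
  assumes cs: "\<And>c. c \<in> A \<Longrightarrow> coassociative_surface (dom_of c) (lr c)"
  shows "\<exists>W. coassociative W \<and> \<phi> ` topspace X \<subseteq> W"
proof -
  obtain p0 where p0: "p0 \<in> topspace X" using nonempty by blast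
  obtain c0 where c0: "c0 \<in> A" "p0 \<in> fst c0" using chart_at[OF p0] by blast
  interpret m0: coassociative_surface "dom_of c0" "lr c0" by (rule cs[OF c0(1)])
  have w0: "snd c0 p0 \<in> dom_of c0" using c0 by blast
  define W where "W = coassociative_triple.W (lr c0 (snd c0 p0)) (m0.p1 (snd c0 p0)) (m0.p2 (snd c0 p0)) (m0.E (snd c0 p0))"
  have W: "coassociative W" unfolding W_def by (rule m0.coassociative_W[OF w0])
  have "n \<bullet> \<phi> p = 0" if n: "n \<in> W\<^sup>\<bottom>" and p: "p \<in> topspace X" for n p
  proof -
    define P where "P p \<longleftrightarrow> (\<forall>c\<in>A. p \<in> fst c \<longrightarrow> coassociative_surface.projection_sq (lr c) n (snd c p) = 0)" for p
    have P: "P q \<longleftrightarrow> coassociative_surface.projection_sq (lr c) n (snd c q) = 0" if "c \<in> A" "q \<in> fst c" for c q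
      using that projection_sq_chart_change[OF _ that(1) _ that(2) cs cs] unfolding P_def by metis
    have "\<exists>V. openin X V \<and> p \<in> V \<and> (\<forall>q\<in>V. P q \<longleftrightarrow> P p)" if p: "p \<in> topspace X" for p
    proof -
      obtain c where c: "c \<in> A" "p \<in> fst c" using chart_at[OF p] by blast
      interpret m: coassociative_surface "dom_of c" "lr c" by (rule cs[OF c(1)])
      obtain e where e: "e > 0" "ball (snd c p) e \<subseteq> dom_of c"
        using m.open_S c(2) openE by blast
      have "m.projection_sq n w = m.projection_sq n (snd c p)" if w: "w \<in> ball (snd c p) e" for w
      proof -
        have "(m.projection_sq n has_derivative (\<lambda>v. 0)) (at w within ball (snd c p) e)" if w: "w \<in> ball (snd c p) e" for w
        proof -
          have "w \<in> dom_of c" using w e by blast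
          from dird_has_derivative[OF smooth_on_differentiable[OF m.smooth_projection_sq[of n] this]] m.dird_projection_sq[OF this, of _ n]
          show ?thesis using has_derivative_at_withinI by simp
        qed
        from has_derivative_zero_constant[OF convex_ball this] obtain k where "\<And>w. w \<in> ball (snd c p) e \<Longrightarrow> m.projection_sq n w = k"
          by blast
        then show ?thesis using w e by simp
      qed
      then have "P q \<longleftrightarrow> P p" if "q \<in> fst c" "snd c q \<in> ball (snd c p) e" for q
        using P[OF c] P[OF c(1) that(1)] that(2) by presburger
      then have "\<forall>q\<in>{q \<in> fst c. snd c q \<in> ball (snd c p) e}. P q \<longleftrightarrow> P p" by blast
      moreover have "p \<in> {q \<in> fst c. snd c q \<in> ball (snd c p) e}" using c e(1) by simp
      ultimately show ?thesis
        using open_chart_preimage[OF c(1) open_ball, of "snd c p" e] by blast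
    qed
    moreover have "P p0"
      using n unfolding P[OF c0] W_def m0.W_perp_iff[OF w0] by (simp add: m0.projection_sq_def)
    ultimately have "P p" using connected_locally_constant[of P p0 p] p0 p by blast
    moreover obtain c where c: "c \<in> A" "p \<in> fst c" using chart_at[OF p] by blast
    interpret m: coassociative_surface "dom_of c" "lr c" by (rule cs[OF c(1)])
    have "m.E (snd c p) > 0" using m.E_pos c by blast
    ultimately have "(n \<bullet> \<phi> p)\<^sup>2 \<le> 0"
      using P[OF c] c unfolding m.projection_sq_def
      by (smt (verit) divide_nonneg_nonneg local_rep_at zero_le_power2)
    then show ?thesis by simp
  qed
  then have "\<phi> p \<in> W\<^sup>\<bottom>\<^sup>\<bottom>" if "p \<in> topspace X" for p
    using that by (simp add: orthogonal_comp_def orthogonal_def)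
  then have "\<phi> ` topspace X \<subseteq> W"
    using orthogonal_comp_self[of W] W by (auto simp: coassociative_def)
  then show ?thesis using W by blast
qed

text \<open>The derivatives of \<open>\<phi>\<close> lie in \<open>W\<close>, so that \<open>X\<close>, \<open>Y\<close> and \<open>h\<close> lie in \<open>W\<^sup>\<bottom>\<close> by \<open>coassociative_cross\<close>. The
  derivative of \<open>h\<close> lies in this 3-dimensional space as well, and it is orthogonal to \<open>h\<close>; so it is a
  combination of \<open>X\<close> and \<open>Y\<close>.\<close>

proposition coassociative_surface_if_contained:
  assumes W: "coassociative W" and sub: "\<phi> ` topspace X \<subseteq> W" and c: "c \<in> A"
  shows "coassociative_surface (dom_of c) (lr c)"
proof -
  interpret m: minimal_surface "dom_of c" "lr c" by (rule minimal_surface[OF c])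
  have sW: "subspace W" and cl: "\<And>a b. a \<in> W\<^sup>\<bottom> \<Longrightarrow> b \<in> W\<^sup>\<bottom> \<Longrightarrow> a \<times>\<^sub>7 b \<in> W\<^sup>\<bottom>"
    using W by (auto simp: coassociative_def associative_plane_def)
  have perp: "a \<bullet> u = 0" "u \<bullet> a = 0" if "a \<in> W\<^sup>\<bottom>" "u \<in> W" for a u
    using that by (auto simp: orthogonal_comp_def orthogonal_def inner_commute)
  have in_W: "u \<in> W" if "\<And>a. a \<in> W\<^sup>\<bottom> \<Longrightarrow> a \<bullet> u = 0" for u
  proof -
    have "u \<in> W\<^sup>\<bottom>\<^sup>\<bottom>" using that by (simp add: orthogonal_comp_def orthogonal_def)
    then show ?thesis using orthogonal_comp_self[OF sW] by simp
  qed
  have deriv_W: "dird v f w \<in> W" if "smooth_on (dom_of c) f" "\<And>w. w \<in> dom_of c \<Longrightarrow> f w \<in> W" "w \<in> dom_of c" for f v w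
    using dird_inner_const[OF m.open_S smooth_on_const that(1) _ that(3), of _ 0 v] perp(1) that(2)
    by (intro in_W) simp
  have p_W: "lr c w \<in> W" if "w \<in> dom_of c" for w
  proof -
    obtain q where "q \<in> fst c" "w = snd c q" using \<open>w \<in> dom_of c\<close> by blast
    then show ?thesis using sub c chart_facts(5)[OF c] by (simp add: subset_iff image_subset_iff)
  qed
  have p1_W: "dird v (lr c) w \<in> W" if "w \<in> dom_of c" for v w
    by (rule deriv_W[OF m.smooth_p p_W that])
  have p2_W: "dird u (dird v (lr c)) w \<in> W" if "w \<in> dom_of c" for u v w
    by (rule deriv_W[OF smooth_on_dird[OF m.smooth_p] p1_W that])
  have XY: "m.X w \<in> W\<^sup>\<bottom>" "m.Y w \<in> W\<^sup>\<bottom>" if "w \<in> dom_of c" for w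
    unfolding m.X_def m.Y_def by (simp_all add: coassociative_cross[OF W] p_W p1_W that)
  have h: "m.h w \<in> W\<^sup>\<bottom>" if "w \<in> dom_of c" for w
    unfolding m.h_def by (intro subspace_scale subspace_orthogonal_comp coassociative_cross[OF W] p1_W that)
  have dh: "dird v m.h w \<bullet> u = 0" if "w \<in> dom_of c" "u \<in> W" for v w u
    using dird_inner_const[OF m.open_S m.smooth_h smooth_on_const, of u 0 w v] perp(1)[OF h that(2)] that(1)
    by simp
  have N: "m.N w \<in> W" if "w \<in> dom_of c" for w
  proof (rule in_W)
    fix a assume a: "a \<in> W\<^sup>\<bottom>"
    have "a \<bullet> m.N w = lr c w \<bullet> (m.h w \<times>\<^sub>7 a)" unfolding m.N_def by (rule cross7_cycle)
    then show "a \<bullet> m.N w = 0" using perp(2)[OF cl[OF h[OF that] a] p_W[OF that]] by simp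
  qed
  show ?thesis
  proof
    fix w assume w: "w \<in> dom_of c"
    show c0: "lr c w \<bullet> m.h w = 0" using perp h p_W w by blast
    show "m.p11 w \<bullet> m.X w = 0" "m.p11 w \<bullet> m.Y w = 0" "m.p12 w \<bullet> m.X w = 0" "m.p12 w \<bullet> m.Y w = 0"
      by (rule perp(2)[OF XY(1)[OF w] p2_W[OF w]] perp(2)[OF XY(2)[OF w] p2_W[OF w]])+
    interpret t: coassociative_triple "lr c w" "m.p1 w" "m.p2 w" "m.E w"
      rewrites "orthogonal_triple.h (m.p1 w) (m.p2 w) (m.E w) = m.h w"
        and "orthogonal_triple.x (lr c w) (m.p1 w) = m.X w" and "orthogonal_triple.y (lr c w) (m.p2 w) = m.Y w"
        and "orthogonal_triple.n (lr c w) (m.p1 w) (m.p2 w) (m.E w) = m.N w"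
      using m.orthogonal_triple_at[OF w] m.orthogonal_triple_at_defs[OF w] c0
      by (simp_all add: coassociative_triple_def coassociative_triple_axioms_def)
    fix v
    have hh: "dird v m.h w \<bullet> m.h w = 0"
      using dird_inner_const[OF m.open_S m.smooth_h m.smooth_h m.h_h w, of v] by (simp add: inner_commute)
    have "dird v m.h w = (dird v m.h w \<bullet> m.X w / m.E w) *\<^sub>R m.X w + (dird v m.h w \<bullet> m.Y w / m.E w) *\<^sub>R m.Y w"
      using t.frame_expansion[of "dird v m.h w"] dh[OF w p_W[OF w]] dh[OF w p1_W[OF w]] dh[OF w N[OF w]] hh
      by simp
    also have "\<dots> \<in> span {m.X w, m.Y w}" by (intro span_add span_scale span_base) auto
    finally show "dird v m.h w \<in> span {m.X w, m.Y w}" .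
  qed
qed

end

section \<open>Line bundles in the trivial Hermitian bundle\<close>

definition cpx :: "real ^ 'n \<Rightarrow> complex ^ 'n" where
  "cpx v = (\<chi> i. complex_of_real (v $ i))"

lemma cpx_nth [simp]: "cpx v $ i = complex_of_real (v $ i)"
  by (simp add: cpx_def)

lemma bounded_linear_cpx: "bounded_linear (cpx :: real ^ 'n \<Rightarrow> complex ^ 'n)"
  unfolding linear_conv_bounded_linear[symmetric]
  by (rule linearI) (simp_all add: vec_eq_iff complex_eq_iff)

lemma herm_add_left: "herm (u + v) w = herm u w + herm v w"
  and herm_add_right: "herm u (v + w) = herm u v + herm u w"
  and herm_diff_left: "herm (u - v) w = herm u w - herm v w"
  and herm_diff_right: "herm u (v - w) = herm u v - herm u w"
  and herm_scale_left: "herm (k *s u) v = k * herm u v"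
  and herm_scale_right: "herm u (k *s v) = cnj k * herm u v"
  and herm_zero_left: "herm 0 v = 0"
  and herm_zero_right: "herm u 0 = 0"
  by (simp_all add: herm_def sum.distrib sum_subtractf sum_distrib_left algebra_simps)

lemmas herm_simps = herm_add_left herm_add_right herm_diff_left herm_diff_right herm_scale_left
  herm_scale_right herm_zero_left herm_zero_right

lemma herm_cpx: "herm (cpx u) (cpx v) = of_real (u \<bullet> v)"
  by (simp add: herm_def inner_vec_def)

lemma herm_self_eq_0_iff [simp]: "herm u u = 0 \<longleftrightarrow> u = 0"
proof -
  have "herm u u = of_real (\<Sum>i\<in>UNIV. (norm (u $ i))\<^sup>2)"
    unfolding herm_def of_real_sum by (rule sum.cong) (simp_all add: complex_norm_square[symmetric])
  then have "herm u u = 0 \<longleftrightarrow> (\<Sum>i\<in>UNIV. (norm (u $ i))\<^sup>2) = 0" by (simp only: of_real_eq_0_iff)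
  also have "\<dots> \<longleftrightarrow> (\<forall>i. u $ i = 0)" by (subst sum_nonneg_eq_0_iff) auto
  finally show ?thesis by (simp add: vec_eq_iff)
qed

lemma bounded_bilinear_herm: "bounded_bilinear (herm :: complex ^ 'n \<Rightarrow> complex ^ 'n \<Rightarrow> complex)"
proof -
  have s: "r *\<^sub>R u = complex_of_real r *s u" for r and u :: "complex ^ 'n"
    by (simp add: vec_eq_iff complex_eq_iff)
  have "bilinear (herm :: complex ^ 'n \<Rightarrow> complex ^ 'n \<Rightarrow> complex)"
    unfolding bilinear_def linear_iff by (simp add: herm_simps s scaleR_conv_of_real)
  then show ?thesis by (simp add: bilinear_conv_bounded_bilinear)
qed

lemma bounded_bilinear_scale: "bounded_bilinear ((*s) :: complex \<Rightarrow> complex ^ 'n \<Rightarrow> complex ^ 'n)"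
proof -
  have "bilinear ((*s) :: complex \<Rightarrow> complex ^ 'n \<Rightarrow> complex ^ 'n)"
    unfolding bilinear_def linear_iff by (simp add: vec_eq_iff algebra_simps)
  then show ?thesis by (simp add: bilinear_conv_bounded_bilinear)
qed

lemma herm_perp_eqI:
  assumes "u \<noteq> 0" "herm n u = 0" "v - n \<in> vec.span {u}"
  shows "herm_perp (vec.span {u}) v = n"
  unfolding herm_perp_def
proof (rule the_equality)
  show "(\<forall>x\<in>vec.span {u}. herm n x = 0) \<and> v - n \<in> vec.span {u}"
    using assms by (auto simp: vec.span_singleton herm_simps)
  fix m assume m: "(\<forall>x\<in>vec.span {u}. herm m x = 0) \<and> v - m \<in> vec.span {u}"
  then have "herm m u = 0" using vec.span_base by blast
  obtain k where k: "(v - n) - (v - m) = k *s u"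
    using vec.span_diff[of "v - n" "{u}" "v - m"] assms m by (auto simp: vec.span_singleton)
  have "k * herm u u = herm ((v - n) - (v - m)) u" unfolding k by (simp add: herm_simps)
  also have "\<dots> = 0" using \<open>herm m u = 0\<close> assms(2) by (simp add: herm_simps)
  finally have "k = 0" using assms(1) by simp
  then show "m = n" using k by simp
qed

lemma herm_perp_shift:
  assumes "u \<noteq> 0" "herm n u = 0"
  shows "herm_perp (vec.span {u}) (r *s u + n) = n"
  by (rule herm_perp_eqI) (use assms in \<open>auto intro: vec.span_scale vec.span_base\<close>)

lemma herm_perp_span: "u \<noteq> 0 \<Longrightarrow> herm_perp (vec.span {u}) v = v - (herm v u / herm u u) *s u"
  by (rule herm_perp_eqI) (auto simp: herm_simps vec.span_singleton)

lemma herm_perp_zero: "herm_perp {0} v = v"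
  unfolding herm_perp_def by (rule the_equality) (auto simp: herm_simps)

lemma span_scale_eq: "k \<noteq> 0 \<Longrightarrow> vec.span {k *s u} = vec.span {u :: complex ^ 'n}"
  using vec.span_image_scale[of "{u}" "\<lambda>_. k"] by simp

text \<open>The operator \<open>\<partial>/\<partial>z\<close>.\<close>

definition dz :: "(complex \<Rightarrow> complex ^ 'n) \<Rightarrow> complex \<Rightarrow> complex ^ 'n" where
  "dz f w = (1/2) *s (dird 1 f w - \<i> *s dird \<i> f w)"

lemma dz_scale:
  assumes "k differentiable (at w)" "s differentiable (at w)"
  shows "dz (\<lambda>w. k w *s s w) w = ((1/2) * (dird 1 k w - \<i> * dird \<i> k w)) *s s w + k w *s dz s w"
  unfolding dz_def dird_bilinear[OF bounded_bilinear_scale assms] by (simp add: vec_eq_iff algebra_simps)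

context riemann_surface
begin

lemma pd_z_eq: "pd_z c v p = dz (local_rep c v) (snd c p)"
  by (simp add: pd_z_def dz_def pd_eq)

text \<open>A section of \<open>L\<close> is locally \<open>k s\<close>, and the only part of \<open>\<partial>(k s)/\<partial>z\<close> that is orthogonal to \<open>s\<close> is \<open>k t\<close>. It
  is enough to know \<open>L\<close> near the point, which matters when \<open>L\<close> is only known off an exceptional set.\<close>

lemma A'_image_line_subset:
  assumes c: "c \<in> A" "p \<in> fst c" and V: "openin X V" "p \<in> V"
    and L: "\<And>q. q \<in> V \<Longrightarrow> q \<in> fst c \<Longrightarrow> L q = vec.span {s (snd c q)} \<and> s (snd c q) \<noteq> 0"
    and ds: "s differentiable (at (snd c p))"
    and dz: "dz s (snd c p) = l *s s (snd c p) + t" and t: "herm t (s (snd c p)) = 0"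
  shows "A'_image X A c L p \<subseteq> vec.span {t}"
proof
  fix x assume "x \<in> A'_image X A c L p"
  then obtain v where v: "local_section X A L p v" "x = herm_perp (L p) (pd_z c v p)"
    by (auto simp: A'_image_def)
  then obtain V' where V': "openin X V'" "p \<in> V'" "smooth_map_on A V' v" "\<And>q. q \<in> V' \<Longrightarrow> v q \<in> L q"
    by (auto simp: local_section_def)
  define k where "k w = herm (local_rep c v w) (s w) * inverse (herm (s w) (s w))" for w
  let ?w = "snd c p"
  have s0: "s ?w \<noteq> 0" using L V c by blast
  have dv: "local_rep c v differentiable (at ?w)"
    by (rule smooth_map_on_differentiable[OF c(1) V'(1,3,2) c(2)])
  have dk: "k differentiable (at ?w)"
    unfolding k_def[abs_def] using s0
    by (intro differentiable_bilinear[OF bounded_bilinear_mult] differentiable_bilinear[OF bounded_bilinear_herm]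
        differentiable_inverse dv ds) simp
  have vk: "v q = k (snd c q) *s s (snd c q)" if "q \<in> V \<inter> V'" "q \<in> fst c" for q
  proof -
    have "v q \<in> vec.span {s (snd c q)}" using L[of q] V'(4)[of q] that by simp
    then obtain r where "v q = r *s s (snd c q)" by (auto simp: vec.span_singleton)
    then show ?thesis using L[of q] that c by (simp add: k_def herm_simps)
  qed
  have "dird u (local_rep c v) ?w = dird u (\<lambda>w. k w *s s w) ?w" for u
    by (rule dird_local_rep_cong[OF c openin_Int[OF V(1) V'(1)]]) (use V V' vk in auto)
  then have "pd_z c v p = dz (\<lambda>w. k w *s s w) ?w" by (simp add: pd_z_eq dz_def)
  also have "\<dots> = ((1/2) * (dird 1 k ?w - \<i> * dird \<i> k ?w) + k ?w * l) *s s ?w + k ?w *s t"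
    unfolding dz_scale[OF dk ds] dz by (simp add: vec_eq_iff algebra_simps)
  finally have "herm_perp (vec.span {s ?w}) (pd_z c v p) = k ?w *s t"
    using t s0 by (simp only:) (intro herm_perp_shift; simp add: herm_simps)
  then have "x = k ?w *s t" using v(2) L[OF V(2) c(2)] by simp
  then show "x \<in> vec.span {t}" by (auto intro: vec.span_scale vec.span_base)
qed

text \<open>A line bundle given by a nowhere vanishing smooth section in each chart; the sections in different
  charts need not agree.\<close>

definition line_bundle :: "('a \<Rightarrow> (complex ^ 'n) set) \<Rightarrow> ('a chart \<Rightarrow> complex \<Rightarrow> complex ^ 'n) \<Rightarrow> bool" where
  "line_bundle L s \<longleftrightarrow> (\<forall>c\<in>A. smooth_on (dom_of c) (s c) \<and>
     (\<forall>p\<in>fst c. s c (snd c p) \<noteq> 0 \<and> L p = vec.span {s c (snd c p)}))"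

text \<open>A section with a prescribed value at one point is obtained by projecting that value to all fibres.
  The projection involves no chart, and so it is smooth in every chart without any consideration of
  transition maps.\<close>

lemma line_bundle_section:
  assumes L: "line_bundle L s"
  defines "v \<equiv> \<lambda>a q. a - herm_perp (L q) a"
  shows "smooth_map_on A V (v a)" "q \<in> topspace X \<Longrightarrow> v a q \<in> L q" "q \<in> topspace X \<Longrightarrow> a \<in> L q \<Longrightarrow> v a q = a"
proof -
  have eq: "v a q = (herm a (s c (snd c q)) * inverse (herm (s c (snd c q)) (s c (snd c q)))) *s s c (snd c q)"
    if "c \<in> A" "q \<in> fst c" for c q
    using L that by (simp add: line_bundle_def v_def herm_perp_span divide_inverse)
  show "smooth_map_on A V (v a)"
  proof (rule smooth_map_onI)
    fix c assume c: "c \<in> A"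
    have sm: "smooth_on (dom_of c) (s c)" and nz: "\<And>w. w \<in> dom_of c \<Longrightarrow> s c w \<noteq> 0"
      using L c by (auto simp: line_bundle_def)
    have "smooth_on (dom_of c) (\<lambda>w. (herm a (s c w) * inverse (herm (s c w) (s c w))) *s s c w)"
      by (intro smooth_on_bilinear[OF bounded_bilinear_scale] smooth_on_bilinear[OF bounded_bilinear_mult]
          smooth_on_bilinear[OF bounded_bilinear_herm] smooth_on_inverse smooth_on_const sm chart_facts(2)[OF c])
        (simp add: nz)
    then show "smooth_on (dom_of c) (local_rep c (v a))"
      by (rule smooth_on_cong[OF chart_facts(2)[OF c], rotated]) (auto simp: eq[OF c] c)
  qed
  assume q: "q \<in> topspace X"
  obtain c where c: "c \<in> A" "q \<in> fst c" using chart_at[OF q] by blast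
  then have Lq: "L q = vec.span {s c (snd c q)}" "s c (snd c q) \<noteq> 0" using L by (auto simp: line_bundle_def)
  show "v a q \<in> L q" unfolding eq[OF c] Lq by (intro vec.span_scale vec.span_base) simp
  assume "a \<in> L q"
  then show "v a q = a" unfolding eq[OF c] Lq using Lq(2) by (auto simp: vec.span_singleton herm_simps)
qed

lemma line_bundle_subbundle:
  assumes L: "line_bundle L s"
  shows "subbundle X A 1 L"
  unfolding subbundle_def
proof
  fix p assume p: "p \<in> topspace X"
  obtain c where c: "c \<in> A" "p \<in> fst c" using chart_at[OF p] by blast
  define a where "a = s c (snd c p)"
  define v where "v q = a - herm_perp (L q) a" for q
  note sec = line_bundle_section[OF L, of _ a, folded v_def]
  have Lp: "L p = vec.span {a}" "a \<noteq> 0" using L c by (auto simp: line_bundle_def a_def)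
  have vp: "v p = a" using sec(3)[OF p] Lp vec.span_base by blast
  define V where "V = {q \<in> fst c. snd c q \<in> {w \<in> dom_of c. local_rep c v w \<noteq> 0}}"
  have sm: "smooth_map_on A T v" for T unfolding v_def[abs_def] by (rule line_bundle_section(1)[OF L])
  have "continuous_on (dom_of c) (local_rep c v)"
    using smooth_on_continuous[OF smooth_map_on_chart[OF c(1) sm]] .
  from continuous_open_preimage[OF this chart_facts(2)[OF c(1)], of "- {0}"]
  have "open (dom_of c \<inter> local_rep c v -` (- {0}))" by auto
  moreover have "dom_of c \<inter> local_rep c v -` (- {0}) = {w \<in> dom_of c. local_rep c v w \<noteq> 0}" by auto
  ultimately have "openin X V"
    unfolding V_def by (metis open_chart_preimage[OF c(1)])
  moreover have "p \<in> V" using c vp Lp by (simp add: V_def)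
  ultimately have V: "openin X V" "p \<in> V" by blast+
  have line: "L q = vec.span {v q} \<and> vec.dim (L q) = 1" if q: "q \<in> V" for q
  proof -
    have qc: "q \<in> fst c" and "local_rep c v (snd c q) \<noteq> 0" using q by (simp_all add: V_def)
    then have vq: "v q \<noteq> 0" using c by simp
    have "q \<in> topspace X" using chart_facts(5)[OF c(1)] qc by blast
    then have "v q \<in> L q" using line_bundle_section(2)[OF L] by (simp add: v_def)
    moreover have Lq: "L q = vec.span {s c (snd c q)}" using L c qc by (simp add: line_bundle_def)
    ultimately obtain k where k: "v q = k *s s c (snd c q)" by (auto simp: vec.span_singleton)
    then have "k \<noteq> 0" using vq by auto
    then have "L q = vec.span {v q}" by (simp add: Lq k span_scale_eq)
    moreover have "vec.dim (vec.span {v q}) = 1"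
      using vq by (subst vec.dim_span) (simp add: vec.dim_eq_card_independent vec.dependent_single)
    ultimately show ?thesis by simp
  qed
  show "\<exists>V s. openin X V \<and> p \<in> V \<and> (\<forall>i<1::nat. smooth_map_on A V (s i)) \<and>
      (\<forall>q\<in>V. L q = vec.span ((\<lambda>i. s i q) ` {..<1}) \<and> vec.dim (L q) = 1)"
  proof (intro exI[of _ V] exI[of _ "\<lambda>_::nat. v"] conjI ballI allI impI)
    fix q assume q: "q \<in> V"
    have img: "(\<lambda>i::nat. v q) ` {..<1} = {v q}" by auto
    show "L q = vec.span ((\<lambda>i::nat. v q) ` {..<1})" unfolding img using line[OF q] by blast
    show "vec.dim (L q) = 1" using line[OF q] by blast
  qed (use V sm in auto)
qed

lemma A'_image_line:
  assumes c: "c \<in> A" "p \<in> fst c" and L: "line_bundle L s"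
    and dz: "dz (s c) (snd c p) = l *s s c (snd c p) + t" and t: "herm t (s c (snd c p)) = 0"
  shows "A'_image X A c L p = vec.span {t}"
proof
  have sm: "smooth_on (dom_of c) (s c)" and nz: "s c (snd c p) \<noteq> 0" and Lp: "L p = vec.span {s c (snd c p)}"
    using L c by (auto simp: line_bundle_def)
  have ds: "s c differentiable (at (snd c p))" using smooth_on_differentiable[OF sm] c by blast
  have p: "p \<in> topspace X" using chart_facts(5)[OF c(1)] c by blast
  show "A'_image X A c L p \<subseteq> vec.span {t}"
    by (rule A'_image_line_subset[OF c chart_facts(1)[OF c(1)] c(2) _ ds dz t]) (use L c in \<open>auto simp: line_bundle_def\<close>)
  show "vec.span {t} \<subseteq> A'_image X A c L p"
  proof
    fix x assume "x \<in> vec.span {t}"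
    then obtain r where r: "x = r *s t" by (auto simp: vec.span_singleton)
    define v where "v q = r *s s c (snd c p) - herm_perp (L q) (r *s s c (snd c p))" for q
    note sec = line_bundle_section[OF L, of _ "r *s s c (snd c p)", folded v_def]
    define k where "k w = herm (local_rep c v w) (s c w) * inverse (herm (s c w) (s c w))" for w
    have sec1: "smooth_map_on A (topspace X) v" unfolding v_def[abs_def] by (rule line_bundle_section(1)[OF L])
    have loc: "local_section X A L p v"
      unfolding local_section_def using sec1 sec(2) p by blast
    have vp: "v p = r *s s c (snd c p)"
      by (rule sec(3)[OF p]) (auto simp: Lp intro: vec.span_scale vec.span_base)
    have vk: "v q = k (snd c q) *s s c (snd c q)" if "q \<in> fst c" for q
    proof -
      have "q \<in> topspace X" using chart_facts(5)[OF c(1)] that by blast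
      moreover have Lq: "L q = vec.span {s c (snd c q)}" "s c (snd c q) \<noteq> 0"
        using L c that by (auto simp: line_bundle_def)
      ultimately obtain r' where "v q = r' *s s c (snd c q)" using sec(2)[of q] by (auto simp: vec.span_singleton)
      then show ?thesis using Lq(2) that c by (simp add: k_def herm_simps)
    qed
    have kp: "k (snd c p) = r" using vp nz c by (simp add: k_def herm_simps)
    have dk: "k differentiable (at (snd c p))"
      unfolding k_def[abs_def] using nz smooth_map_on_differentiable[OF c(1) openin_topspace sec1 p c(2)]
      by (intro differentiable_bilinear[OF bounded_bilinear_mult] differentiable_bilinear[OF bounded_bilinear_herm]
          differentiable_inverse ds) simp_all
    have "dird u (local_rep c v) (snd c p) = dird u (\<lambda>w. k w *s s c w) (snd c p)" for u
      by (rule dird_local_rep_cong[OF c chart_facts(1)[OF c(1)] c(2)]) (rule vk)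
    then have "pd_z c v p = dz (\<lambda>w. k w *s s c w) (snd c p)" by (simp add: pd_z_eq dz_def)
    also have "\<dots> = ((1/2) * (dird 1 k (snd c p) - \<i> * dird \<i> k (snd c p)) + r * l) *s s c (snd c p) + r *s t"
      unfolding dz_scale[OF dk ds] dz kp by (simp add: vec_eq_iff algebra_simps)
    finally have "herm_perp (L p) (pd_z c v p) = x"
      unfolding Lp r using t nz by (simp only:) (intro herm_perp_shift; simp add: herm_simps)
    then show "x \<in> A'_image X A c L p" unfolding A'_image_def using loc by blast
  qed
qed

lemma image_bundle_line:
  assumes L: "line_bundle L s" "line_bundle L' s'" and D: "X derived_set_of D = {}"
    and dz: "\<And>c p. c \<in> A \<Longrightarrow> p \<in> fst c \<Longrightarrow>
      \<exists>l m. dz (s c) (snd c p) = l *s s c (snd c p) + m *s s' c (snd c p) \<and> (p \<notin> D \<longrightarrow> m \<noteq> 0)"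
    and orth: "\<And>c p. c \<in> A \<Longrightarrow> p \<in> fst c \<Longrightarrow> herm (s' c (snd c p)) (s c (snd c p)) = 0"
  shows "image_bundle X A L L'"
proof -
  have "A'_image X A c L p = L' p" if c: "c \<in> A" "p \<in> fst c" and p: "p \<notin> D" for c p
  proof -
    obtain l m where lm: "dz (s c) (snd c p) = l *s s c (snd c p) + m *s s' c (snd c p)" "m \<noteq> 0"
      using dz[OF c] p by blast
    have "A'_image X A c L p = vec.span {m *s s' c (snd c p)}"
      by (rule A'_image_line[OF c L(1) lm(1)]) (simp add: herm_simps orth[OF c])
    also have "\<dots> = vec.span {s' c (snd c p)}"
      using lm(2) vec.span_image_scale[of "{s' c (snd c p)}" "\<lambda>_. m"] by simp
    finally show ?thesis using L(2) c by (simp add: line_bundle_def)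
  qed
  then have "{p \<in> topspace X. \<exists>c\<in>A. p \<in> fst c \<and> A'_image X A c L p \<noteq> L' p} \<subseteq> D" by blast
  from derived_set_of_mono[OF this, of X] D
  have "X derived_set_of {p \<in> topspace X. \<exists>c\<in>A. p \<in> fst c \<and> A'_image X A c L p \<noteq> L' p} = {}" by simp
  then show ?thesis
    unfolding image_bundle_def using line_bundle_subbundle[OF L(2)] by blast
qed

text \<open>The rank of the image bundle is constant, so it is zero everywhere as soon as it is zero at one
  point that is not exceptional.\<close>

lemma image_bundle_zero:
  assumes L: "image_bundle X A L L'" and D: "X derived_set_of D = {}"
    and z: "\<And>c p. c \<in> A \<Longrightarrow> p \<in> fst c \<Longrightarrow> p \<notin> D \<Longrightarrow> A'_image X A c L p \<subseteq> {0}" and q: "q \<in> topspace X"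
  shows "L' q = {0}"
proof -
  let ?E = "{p \<in> topspace X. \<exists>c\<in>A. p \<in> fst c \<and> A'_image X A c L p \<noteq> L' p}"
  obtain k where k: "subbundle X A k L'" and E: "X derived_set_of ?E = {}"
    using L unfolding image_bundle_def by blast
  have "X derived_set_of (D \<union> ?E) = {}" using D E by (simp add: derived_set_of_Un)
  then have "\<not> topspace X \<subseteq> D \<union> ?E" by (rule exceptional_avoid) (use nonempty in auto)
  then obtain p where p: "p \<in> topspace X" "p \<notin> D" "p \<notin> ?E" by blast
  obtain c where c: "c \<in> A" "p \<in> fst c" using chart_at[OF p(1)] by blast
  have "L' p \<subseteq> {0}" using z[OF c p(2)] p c by blast
  then have "vec.dim (L' p) = 0" by (simp add: vec.dim_eq_0)
  then have "k = 0" using k p(1) unfolding subbundle_def by metis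
  then show ?thesis using k q unfolding subbundle_def by fastforce
qed

lemma A'_image_of_zero:
  assumes c: "c \<in> A" "p \<in> fst c" and z: "\<And>q. q \<in> topspace X \<Longrightarrow> L q = {0}"
  shows "A'_image X A c L p \<subseteq> {0}"
proof
  fix x assume "x \<in> A'_image X A c L p"
  then obtain v where v: "local_section X A L p v" "x = herm_perp (L p) (pd_z c v p)"
    by (auto simp: A'_image_def)
  then obtain V where V: "openin X V" "p \<in> V" "\<And>q. q \<in> V \<Longrightarrow> v q \<in> L q"
    by (auto simp: local_section_def)
  have "dird u (local_rep c v) (snd c p) = dird u (\<lambda>_. 0) (snd c p)" for u
    by (rule dird_local_rep_cong[OF c V(1,2)]) (use V z openin_subset[OF V(1)] in blast)
  then have "pd_z c v p = 0" by (simp add: pd_z_eq dz_def)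
  moreover have "L p = {0}" using z c chart_facts(5)[OF c(1)] by blast
  ultimately show "x \<in> {0}" using v by (simp add: herm_perp_zero)
qed

end

section \<open>The harmonic sequence\<close>

lemma dird_cpx: "f differentiable (at w) \<Longrightarrow> dird v (\<lambda>w. cpx (f w)) w = cpx (dird v f w)"
  by (rule dird_bounded_linear[OF bounded_linear_cpx])

lemma differentiable_cpx: "f differentiable (at w) \<Longrightarrow> (\<lambda>w. cpx (f w)) differentiable (at w)"
  by (rule differentiable_bounded_linear[OF bounded_linear_cpx])

lemma bounded_linear_scale_cpx: "bounded_linear (\<lambda>v. k *s cpx v)"
  using bounded_linear_compose[OF bounded_bilinear.bounded_linear_right[OF bounded_bilinear_scale] bounded_linear_cpx] .

context minimal_surface
begin

text \<open>Up to constant factors these are \<open>\<phi>\<close>, \<open>\<phi>\<^sub>z\<close>, \<open>N\<close> and the conjugate of \<open>\<phi>\<^sub>z\<close>. The formulas for \<open>dz\<close> below are the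
  Frenet equations of \<open>\<phi>\<close>: each derivative is a combination of the section itself and of its cyclic
  successor.\<close>

definition "s0 w = cpx (p w)"
definition "s1 w = cpx (p1 w) - \<i> *s cpx (p2 w)"
definition "s2 w = cpx (N w)"
definition "s3 w = cpx (p1 w) + \<i> *s cpx (p2 w)"

lemma smooth_s: "smooth_on S s0" "smooth_on S s1" "smooth_on S s2" "smooth_on S s3"
  unfolding s0_def s1_def s2_def s3_def
  by (intro smooth_on_diff smooth_on_add smooth_on_linear[OF bounded_linear_cpx]
      smooth_on_linear[OF bounded_linear_scale_cpx] open_S smooths)+

lemma s_orth:
  assumes w: "w \<in> S"
  shows "herm (s1 w) (s0 w) = 0" "herm (s2 w) (s1 w) = 0" "herm (s3 w) (s2 w) = 0" "herm (s0 w) (s3 w) = 0"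
    "herm (s0 w) (s1 w) = 0" "herm (s0 w) (s2 w) = 0"
  using p_p1[OF w] p_p2[OF w] p_N[OF w] p1_N[OF w] p2_N[OF w]
  by (simp_all add: s0_def s1_def s2_def s3_def herm_simps herm_cpx inner_commute)

lemma s_nonzero:
  assumes w: "w \<in> S"
  shows "s0 w \<noteq> 0" "s1 w \<noteq> 0" "s3 w \<noteq> 0"
proof -
  have "p w \<noteq> 0" using unit_p[OF w] by auto
  then show "s0 w \<noteq> 0" by (simp add: s0_def vec_eq_iff)
  obtain i where "p1 w $ i \<noteq> 0" using immersed[OF w] by (auto simp: vec_eq_iff)
  then have "Re (s1 w $ i) \<noteq> 0" "Re (s3 w $ i) \<noteq> 0" by (simp_all add: s1_def s3_def)
  then show "s1 w \<noteq> 0" "s3 w \<noteq> 0" by auto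
qed

lemma dird_s:
  assumes w: "w \<in> S"
  shows "dird v s0 w = cpx (dird v p w)" "dird v s1 w = cpx (dird v p1 w) - \<i> *s cpx (dird v p2 w)"
    "dird v s2 w = cpx (dird v N w)" "dird v s3 w = cpx (dird v p1 w) + \<i> *s cpx (dird v p2 w)"
  unfolding s0_def[abs_def] s1_def[abs_def] s2_def[abs_def] s3_def[abs_def]
  by (simp_all add: dird_cpx dird_diff dird_add diffs w differentiable_cpx
      dird_bounded_linear[OF bounded_linear_scale_cpx] differentiable_bounded_linear[OF bounded_linear_scale_cpx])

lemma dz_s0: "w \<in> S \<Longrightarrow> dz s0 w = (1/2) *s s1 w"
  by (simp add: dz_def dird_s s1_def)

lemma dz_s3: "w \<in> S \<Longrightarrow> dz s3 w = (- of_real (E w)) *s s0 w"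
  by (simp add: dz_def dird_s p21_eq p22_eq s0_def vec_eq_iff complex_eq_iff field_simps)

end

context coassociative_surface
begin

lemma s2_nonzero: "w \<in> S \<Longrightarrow> s2 w \<noteq> 0"
proof -
  assume w: "w \<in> S"
  have "N w \<bullet> N w = 1" using cframe[OF w] by simp
  then have "N w \<noteq> 0" by auto
  then show ?thesis by (simp add: s2_def vec_eq_iff)
qed

lemma dz_s1:
  assumes w: "w \<in> S"
  shows "dz s1 w = Complex (dird 1 E w / (2 * E w)) (- dird \<i> E w / (2 * E w)) *s s1 w
    + Complex (\<beta> w) (\<alpha> w) *s s2 w"
proof -
  have "dz s1 w $ i = Complex (p11 w $ i + E w * p w $ i) (- p12 w $ i)" for i
    using w by (simp add: dz_def dird_s p21_eq p22_eq complex_eq_iff field_simps)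
  then show ?thesis
    unfolding p11_eq[OF w] p12_eq[OF w] vec_eq_iff
    by (simp add: s1_def s2_def complex_eq_iff algebra_simps)
qed

lemma dz_s2:
  assumes w: "w \<in> S"
  shows "dz s2 w = (- Complex (\<beta> w) (\<alpha> w) / of_real (2 * E w)) *s s3 w"
  unfolding dz_def dird_s[OF w] N_x[OF w] N_y[OF w]
  using E_pos[OF w] by (simp add: s3_def vec_eq_iff complex_eq_iff field_simps)

end

context associated_surface
begin

definition frame_sec :: "nat \<Rightarrow> 'a chart \<Rightarrow> complex \<Rightarrow> complex ^ 7" where
  "frame_sec j c = (if j mod 4 = 0 then minimal_surface.s0 (lr c) else if j mod 4 = 1 then minimal_surface.s1 (lr c)
     else if j mod 4 = 2 then minimal_surface.s2 (lr c) else minimal_surface.s3 (lr c))"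

text \<open>The terms of index divisible by 4 are singled out because the definition of a harmonic sequence
  fixes the first term also outside \<open>topspace X\<close>.\<close>

definition sequence_of_frame :: "nat \<Rightarrow> 'a \<Rightarrow> (complex ^ 7) set" where
  "sequence_of_frame j = (if j mod 4 = 0 then spanned_line \<phi>
     else (\<lambda>p. let c = SOME c. c \<in> A \<and> p \<in> fst c in vec.span {frame_sec j c (snd c p)}))"

lemma frame_sec_chart_change:
  assumes c: "c \<in> A" "c' \<in> A" and p: "p \<in> fst c" "p \<in> fst c'"
  shows "vec.span {frame_sec j c (snd c p)} = vec.span {frame_sec j c' (snd c' p)}"
proof -
  interpret m: minimal_surface "dom_of c" "lr c" by (rule minimal_surface[OF c(1)])
  interpret m': minimal_surface "dom_of c'" "lr c'" by (rule minimal_surface[OF c(2)])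
  obtain r s where rs: "r\<^sup>2 + s\<^sup>2 > 0"
    "m.p1 (snd c p) = r *\<^sub>R m'.p1 (snd c' p) + s *\<^sub>R m'.p2 (snd c' p)"
    "m.p2 (snd c p) = r *\<^sub>R m'.p2 (snd c' p) - s *\<^sub>R m'.p1 (snd c' p)"
    by (rule chart_change[OF c p])
  have nz: "Complex r s \<noteq> 0" "Complex r (- s) \<noteq> 0" using rs(1) by (auto simp: complex_eq_iff)
  have "m.s0 (snd c p) = m'.s0 (snd c' p)" using c p by (simp add: m.s0_def m'.s0_def)
  moreover have "m.s2 (snd c p) = m'.s2 (snd c' p)" using \<nu>_eq c p by (metis m.s2_def m'.s2_def)
  moreover have "m.s1 (snd c p) = Complex r s *s m'.s1 (snd c' p)"
    unfolding m.s1_def m'.s1_def rs(2,3) by (simp add: vec_eq_iff complex_eq_iff)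
  moreover have "m.s3 (snd c p) = Complex r (- s) *s m'.s3 (snd c' p)"
    unfolding m.s3_def m'.s3_def rs(2,3) by (simp add: vec_eq_iff complex_eq_iff)
  ultimately show ?thesis
    by (simp add: frame_sec_def span_scale_eq[OF nz(1), of "m'.s1 _"] span_scale_eq[OF nz(2), of "m'.s3 _"])
qed

lemma sequence_of_frame_eq:
  assumes "c \<in> A" "p \<in> fst c"
  shows "sequence_of_frame j p = vec.span {frame_sec j c (snd c p)}"
proof (cases "j mod 4 = 0")
  case True
  interpret m: minimal_surface "dom_of c" "lr c" by (rule minimal_surface[OF assms(1)])
  show ?thesis using True assms by (simp add: sequence_of_frame_def frame_sec_def spanned_line_def m.s0_def cpx_def)
next
  case False
  then show ?thesis
    unfolding sequence_of_frame_def Let_def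
    by simp (rule someI2[of "\<lambda>c. c \<in> A \<and> p \<in> fst c" c], use assms in simp, rule frame_sec_chart_change, use assms in simp_all)
qed

lemma line_bundle_sequence_of_frame:
  assumes "\<And>c. c \<in> A \<Longrightarrow> coassociative_surface (dom_of c) (lr c)"
  shows "line_bundle (sequence_of_frame j) (frame_sec j)"
  unfolding line_bundle_def
proof (intro ballI conjI)
  fix c p assume c: "c \<in> A"
  interpret m: coassociative_surface "dom_of c" "lr c" by (rule assms[OF c])
  show "smooth_on (dom_of c) (frame_sec j c)" using m.smooth_s by (simp add: frame_sec_def)
  assume p: "p \<in> fst c"
  then show "frame_sec j c (snd c p) \<noteq> 0" using m.s_nonzero m.s2_nonzero by (simp add: frame_sec_def)
  show "sequence_of_frame j p = vec.span {frame_sec j c (snd c p)}" by (rule sequence_of_frame_eq[OF c p])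
qed

text \<open>The coefficients of the Frenet equations that take one term of the sequence to the next are nonzero
  multiples of a constant, of \<open>E\<close>, or of \<open>\<beta> + \<i> \<alpha>\<close>, and the last one vanishes at umbilics only.\<close>

proposition harmonic_sequence_of_frame:
  assumes cs: "\<And>c. c \<in> A \<Longrightarrow> coassociative_surface (dom_of c) (lr c)"
    and D: "X derived_set_of {p \<in> topspace X. umbilic p} = {}"
  shows "harmonic_sequence X A \<phi> sequence_of_frame"
  unfolding harmonic_sequence_def
proof (intro conjI allI)
  show "sequence_of_frame 0 = spanned_line \<phi>" by (simp add: sequence_of_frame_def)
  fix j
  show "image_bundle X A (sequence_of_frame j) (sequence_of_frame (Suc j))"
  proof (rule image_bundle_line[OF line_bundle_sequence_of_frame[OF cs] line_bundle_sequence_of_frame[OF cs] D])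
    fix c p assume c: "c \<in> A" "p \<in> fst c"
    interpret m: coassociative_surface "dom_of c" "lr c" by (rule cs[OF c(1)])
    have w: "snd c p \<in> dom_of c" using c by blast
    have p: "p \<in> topspace X" using c chart_facts(5) by blast
    have cases: "j mod 4 = 0 \<and> Suc j mod 4 = 1 \<or> j mod 4 = 1 \<and> Suc j mod 4 = 2 \<or>
        j mod 4 = 2 \<and> Suc j mod 4 = 3 \<or> j mod 4 = 3 \<and> Suc j mod 4 = 0"
      by presburger
    show "herm (frame_sec (Suc j) c (snd c p)) (frame_sec j c (snd c p)) = 0"
      using cases m.s_orth[OF w] by (auto simp: frame_sec_def)
    have nz: "Complex (m.\<beta> (snd c p)) (m.\<alpha> (snd c p)) \<noteq> 0" if "p \<notin> {p \<in> topspace X. umbilic p}"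
      using that p umbilic_iff[OF c] by (auto simp: complex_eq_iff)
    have E: "m.E (snd c p) \<noteq> 0" by (rule m.E_nz[OF w])
    consider "j mod 4 = 0" "Suc j mod 4 = 1" | "j mod 4 = 1" "Suc j mod 4 = 2"
      | "j mod 4 = 2" "Suc j mod 4 = 3" | "j mod 4 = 3" "Suc j mod 4 = 0" using cases by metis
    then show "\<exists>l m. dz (frame_sec j c) (snd c p) = l *s frame_sec j c (snd c p) + m *s frame_sec (Suc j) c (snd c p) \<and>
        (p \<notin> {p \<in> topspace X. umbilic p} \<longrightarrow> m \<noteq> 0)"
    proof cases
      case 1
      then have e: "frame_sec j c = m.s0" "frame_sec (Suc j) c = m.s1" by (simp_all add: frame_sec_def)
      have a: "dz m.s0 (snd c p) = 0 *s m.s0 (snd c p) + (1/2 :: complex) *s m.s1 (snd c p)"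
        using m.dz_s0[OF w] by simp
      have b: "(1/2 :: complex) \<noteq> 0" if "p \<notin> {p \<in> topspace X. umbilic p}"
        by simp
      show ?thesis unfolding e by (rule exI, rule exI, rule conjI, rule a, rule impI, erule b)
    next
      case 2
      then have e: "frame_sec j c = m.s1" "frame_sec (Suc j) c = m.s2" by (simp_all add: frame_sec_def)
      have a: "dz m.s1 (snd c p) = Complex (dird 1 m.E (snd c p) / (2 * m.E (snd c p))) (- dird \<i> m.E (snd c p) / (2 * m.E (snd c p))) *s m.s1 (snd c p) + Complex (m.\<beta> (snd c p)) (m.\<alpha> (snd c p)) *s m.s2 (snd c p)"
        using m.dz_s1[OF w] by simp
      have b: "Complex (m.\<beta> (snd c p)) (m.\<alpha> (snd c p)) \<noteq> 0" if "p \<notin> {p \<in> topspace X. umbilic p}"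
        by (rule nz[OF that])
      show ?thesis unfolding e by (rule exI, rule exI, rule conjI, rule a, rule impI, erule b)
    next
      case 3
      then have e: "frame_sec j c = m.s2" "frame_sec (Suc j) c = m.s3" by (simp_all add: frame_sec_def)
      have a: "dz m.s2 (snd c p) = 0 *s m.s2 (snd c p) + (- Complex (m.\<beta> (snd c p)) (m.\<alpha> (snd c p)) / of_real (2 * m.E (snd c p))) *s m.s3 (snd c p)"
        using m.dz_s2[OF w] by simp
      have b: "(- Complex (m.\<beta> (snd c p)) (m.\<alpha> (snd c p)) / of_real (2 * m.E (snd c p))) \<noteq> 0" if "p \<notin> {p \<in> topspace X. umbilic p}"
        using nz[OF that] E by simp
      show ?thesis unfolding e by (rule exI, rule exI, rule conjI, rule a, rule impI, erule b)
    next
      case 4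
      then have e: "frame_sec j c = m.s3" "frame_sec (Suc j) c = m.s0" by (simp_all add: frame_sec_def)
      have a: "dz m.s3 (snd c p) = 0 *s m.s3 (snd c p) + (- complex_of_real (m.E (snd c p))) *s m.s0 (snd c p)"
        using m.dz_s3[OF w] by simp
      have b: "(- complex_of_real (m.E (snd c p))) \<noteq> 0" if "p \<notin> {p \<in> topspace X. umbilic p}"
        using E by simp
      show ?thesis unfolding e by (rule exI, rule exI, rule conjI, rule a, rule impI, erule b)
    qed
  qed
qed

proposition isotropy_order_3:
  assumes cs: "\<And>c. c \<in> A \<Longrightarrow> coassociative_surface (dom_of c) (lr c)"
    and D: "X derived_set_of {p \<in> topspace X. umbilic p} = {}"
  shows "isotropy_order X A \<phi> 3"
proof -
  have orth: "bundle_orthogonal X (sequence_of_frame 0) (sequence_of_frame j)" if "0 < j" "j \<le> 3" for j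
    unfolding bundle_orthogonal_def
  proof (intro ballI)
    fix p u v assume p: "p \<in> topspace X" and u: "u \<in> sequence_of_frame 0 p" and v: "v \<in> sequence_of_frame j p"
    obtain c where c: "c \<in> A" "p \<in> fst c" using chart_at[OF p] by blast
    interpret m: coassociative_surface "dom_of c" "lr c" by (rule cs[OF c(1)])
    have w: "snd c p \<in> dom_of c" using c by blast
    have "j = 1 \<or> j = 2 \<or> j = 3" using that by auto
    then have "herm (frame_sec 0 c (snd c p)) (frame_sec j c (snd c p)) = 0"
      using m.s_orth[OF w] by (auto simp: frame_sec_def)
    then show "herm u v = 0"
      using u v by (auto simp: sequence_of_frame_eq[OF c] vec.span_singleton herm_simps)
  qed
  have "\<not> bundle_orthogonal X (sequence_of_frame 0) (sequence_of_frame (3 + 1))"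
  proof
    assume o: "bundle_orthogonal X (sequence_of_frame 0) (sequence_of_frame (3 + 1))"
    obtain p where p: "p \<in> topspace X" using nonempty by blast
    obtain c where c: "c \<in> A" "p \<in> fst c" using chart_at[OF p] by blast
    interpret m: coassociative_surface "dom_of c" "lr c" by (rule cs[OF c(1)])
    have "m.s0 (snd c p) \<in> sequence_of_frame 0 p" "m.s0 (snd c p) \<in> sequence_of_frame (3 + 1) p"
      unfolding sequence_of_frame_eq[OF c] by (simp_all add: frame_sec_def vec.span_base)
    then have "herm (m.s0 (snd c p)) (m.s0 (snd c p)) = 0" using o p unfolding bundle_orthogonal_def by blast
    then show False using m.s_nonzero(1) c by simp
  qed
  then show ?thesis
    unfolding isotropy_order_def using harmonic_sequence_of_frame[OF cs D] orth by (intro conjI exI[of _ sequence_of_frame]) auto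
qed

text \<open>If all points were umbilic, \<open>\<phi>\<^sub>z\<^sub>z\<close> would be a multiple of \<open>\<phi>\<^sub>z\<close>. The harmonic sequence would then end with
  \<open>\<phi>\<^sub>1\<close>, and \<open>\<phi>\<^sub>4 = 0\<close> would be orthogonal to \<open>\<phi>\<close>.\<close>

proposition not_all_umbilic:
  assumes cs: "\<And>c. c \<in> A \<Longrightarrow> coassociative_surface (dom_of c) (lr c)"
    and iso: "isotropy_order X A \<phi> 3"
  shows "\<exists>p\<in>topspace X. \<not> umbilic p"
proof (rule ccontr)
  assume "\<not> ?thesis"
  then have umb: "umbilic p" if "p \<in> topspace X" for p using that by blast
  obtain \<Phi> where \<Phi>: "\<Phi> 0 = spanned_line \<phi>" "\<And>j. image_bundle X A (\<Phi> j) (\<Phi> (Suc j))"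
    and no: "\<not> bundle_orthogonal X (\<Phi> 0) (\<Phi> (3 + 1))"
    using iso unfolding isotropy_order_def harmonic_sequence_def by blast
  have \<Phi>0: "\<Phi> 0 = sequence_of_frame 0" by (simp add: \<Phi> sequence_of_frame_def)
  define D where "D = {p \<in> topspace X. \<exists>c\<in>A. p \<in> fst c \<and> A'_image X A c (\<Phi> 0) p \<noteq> \<Phi> 1 p}"
  have D: "X derived_set_of D = {}" using \<Phi>(2)[of 0] unfolding image_bundle_def D_def by simp
  have "closedin X D" using D by (simp add: closedin_contains_derived_set D_def)
  then have oD: "openin X (topspace X - D)" by blast
  \<comment> \<open>a given harmonic sequence has its expected first term only off an exceptional set\<close>
  have \<Phi>1: "\<Phi> 1 q = vec.span {minimal_surface.s1 (lr c) (snd c q)}" if c: "c \<in> A" "q \<in> fst c" and q: "q \<notin> D" for c q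
  proof -
    interpret m: coassociative_surface "dom_of c" "lr c" by (rule cs[OF c(1)])
    have w: "snd c q \<in> dom_of c" using c by blast
    have "q \<in> topspace X" using c chart_facts(5) by blast
    then have "\<Phi> 1 q = A'_image X A c (sequence_of_frame 0) q" using q c \<Phi>0 unfolding D_def by auto
    also have "\<dots> = vec.span {(1/2) *s m.s1 (snd c q)}"
      by (rule A'_image_line[OF c line_bundle_sequence_of_frame[OF cs], of _ 0])
        (simp_all add: frame_sec_def m.dz_s0[OF w] herm_simps m.s_orth[OF w])
    finally show ?thesis by (simp add: span_scale_eq)
  qed
  have A1: "A'_image X A c (\<Phi> 1) p \<subseteq> {0}" if c: "c \<in> A" "p \<in> fst c" and p: "p \<notin> D" for c p
  proof -
    interpret m: coassociative_surface "dom_of c" "lr c" by (rule cs[OF c(1)])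
    have w: "snd c p \<in> dom_of c" using c by blast
    have pX: "p \<in> topspace X" using c chart_facts(5) by blast
    have "m.\<alpha> (snd c p) = 0" "m.\<beta> (snd c p) = 0" using umb[OF pX] umbilic_iff[OF c] by auto
    then have dz: "dz m.s1 (snd c p) = Complex (dird 1 m.E (snd c p) / (2 * m.E (snd c p)))
        (- dird \<i> m.E (snd c p) / (2 * m.E (snd c p))) *s m.s1 (snd c p) + 0"
      using m.dz_s1[OF w] by (simp add: complex_eq_iff flip: zero_complex.code)
    have "A'_image X A c (\<Phi> 1) p \<subseteq> vec.span {0}"
      by (rule A'_image_line_subset[OF c oD _ _ smooth_on_differentiable[OF m.smooth_s(2) w] dz])
        (use pX p \<Phi>1[OF c(1)] m.s_nonzero(2) in \<open>auto simp: herm_simps\<close>)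
    then show ?thesis by simp
  qed
  have \<Phi>2: "\<Phi> (Suc 1) q = {0}" if "q \<in> topspace X" for q
    by (rule image_bundle_zero[OF \<Phi>(2) D A1 that])
  have \<Phi>3: "\<Phi> (Suc (Suc 1)) q = {0}" if "q \<in> topspace X" for q
    by (rule image_bundle_zero[OF \<Phi>(2) D A'_image_of_zero[OF _ _ \<Phi>2] that])
  have "\<Phi> (Suc (Suc (Suc 1))) q = {0}" if "q \<in> topspace X" for q
    by (rule image_bundle_zero[OF \<Phi>(2) D A'_image_of_zero[OF _ _ \<Phi>3] that])
  then have "bundle_orthogonal X (\<Phi> 0) (\<Phi> (3 + 1))"
    by (simp add: bundle_orthogonal_def herm_simps eval_nat_numeral)
  then show False using no by blast
qed

end

theorem theorem3:
  fixes X :: "'a topology" and A :: "'a chart set"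
    and \<phi> F :: "'a \<Rightarrow> real ^ 7"
  assumes "riemann_surface X A"
    and "harmonic_into_sphere X A \<phi>" and "conformal A \<phi>" and "immersion X A \<phi>"
    and "cross_star_primitive X A \<phi> F"
  shows "parallel_mean_curvature A F \<and> \<not> pseudo_umbilical X A F \<longleftrightarrow>
    (\<exists>W. coassociative W \<and> superconformal_in X A \<phi> W)"
proof -
  interpret associated_surface X A \<phi> F
    using assms by (simp add: associated_surface_def associated_surface_axioms_def)
  show ?thesis
  proof
    assume pmc: "parallel_mean_curvature A F \<and> \<not> pseudo_umbilical X A F"
    then have par: "\<forall>c\<in>A. parallel_surface (dom_of c) (lr c)" by (simp add: parallel_iff)
    obtain p0 where p0: "p0 \<in> topspace X" "\<not> umbilic p0" using pmc pseudo_umbilical_iff by blast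
    note D = umbilics_isolated[OF par p0]
    note cs = coassociative_surface_if_parallel[OF par D]
    obtain W where W: "coassociative W" "\<phi> ` topspace X \<subseteq> W" using contained_in_coassociative[OF cs] by blast
    have "superconformal_in X A \<phi> W"
      unfolding superconformal_in_def
      using W isotropy_order_3[OF cs D] assms(2)
      by (auto simp: coassociative_def harmonic_into_sphere_def)
    then show "\<exists>W. coassociative W \<and> superconformal_in X A \<phi> W" using W by blast
  next
    assume "\<exists>W. coassociative W \<and> superconformal_in X A \<phi> W"
    then obtain W where W: "coassociative W" "superconformal_in X A \<phi> W" by blast
    then have sub: "\<phi> ` topspace X \<subseteq> W" by (auto simp: superconformal_in_def)
    have iso: "isotropy_order X A \<phi> 3"
      using W by (auto simp: superconformal_in_def coassociative_def)
    note cs = coassociative_surface_if_contained[OF W(1) sub]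
    have "parallel_mean_curvature A F"
      unfolding parallel_iff using cs by (auto simp: coassociative_surface_def)
    moreover have "\<not> pseudo_umbilical X A F"
      using not_all_umbilic[OF cs iso] pseudo_umbilical_iff by blast
    ultimately show "parallel_mean_curvature A F \<and> \<not> pseudo_umbilical X A F" by blast
  qed
qed

end
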